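(* Let $\mathcal{P}$ be the (shaded) planar algebra with generator $P_1\in\mathcal P_{1,+}$ and, writing $Q_1=X-P_1$, with the bubble, strand decomposition, colour disagreement and saddle relations (i)–(iv) listed in the context. Define $P_1$ and $Q_1$ to be self-adjoint, and extend the operation $*$ antilinearly and on diagrams. Then $\mathcal{P}$ is a subfactor planar algebra whose principal graph $\Gamma_+$ and dual principal graph $\Gamma_-$ are the $\tilde A_\infty$ graphs $$\Gamma_+:\ \cdots - Q_3 - Q_2 - Q_1 - \emptyset_+ - P_1 - P_2 - P_3 - \cdots$$ $$\Gamma_-:\ \cdots - Q'_3 - Q'_2 - Q'_1 - \emptyset_- - P'_1 - P'_2 - P'_3 - \cdots$$ (two-sided infinite paths), where $P_k=P_1\otimes\overline{Q}_1\otimes P_1\otimes\cdots$, $P_k'=\overline{P}_1\otimes Q_1\otimes\overline{P}_1\otimes\cdots$, $Q_k=Q_1\otimes\overline{P}_1\otimes Q_1\otimes\cdots$, $Q'_k=\overline{Q}_1\otimes P_1\otimes\overline{Q}_1\otimes\cdots$ ($k$ alternating factors each).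
   Context: Shaded planar algebras. A planar algebra $\mathcal P$ is a family of complex vector spaces $\mathcal P_{k,\pm}$ ($k\ge 0$) with an action of Jones' shaded planar operad: each checkerboard-shaded planar tangle $T$ (an outer box, inner boxes, non-crossing strands, a star marking a region at each box; every box has $k$ strands on top and $k$ on the bottom, and has type $(k,+)$ if its star is in an unshaded region, $(k,-)$ if in a shaded region) gives a multilinear map $Z_T$; isotopic tangles give the same map, the identity tangle gives the identity, and composition of tangles corresponds to composition of maps. The planar algebra with given generators and relations is the quotient of the free planar algebra on the generators by the planar ideal generated by the relations. Elements are drawn as diagrams with star on the left. $fg$ is $f$ stacked on top of $g$; $\otimes$ is horizontal juxtaposition (defined when shadings match); $\overline{T}$ is rotation by $\pi$; $\mathrm{tr}=\mathrm{tr}^R$ (resp. $\mathrm{tr}^L$) closes all strands up to the right (resp. left). $\emptyset_\pm\in\mathcal P_{0,\pm}$ are the empty diagrams (unshaded, shaded). $X\in\mathcal P_{1,+}$ is the vertical strand with unshaded left and shaded right; $Y=\overline X\in\mathcal P_{1,-}$. Extending $*$ "on diagrams" means: $*$ of a diagram is its reflection over a horizontal line with every box replaced by its adjoint. Subfactor planar algebra: a planar algebra such that (1) $\dim\mathcal P_{0,\pm}=1$ (closed diagrams are scalars, $\emptyset_\pm=1$); (2) $\mathrm{tr}^L=\mathrm{tr}^R$ on $\mathcal P_{1,\pm}$; (3) there is an antilinear adjoint $*$ on each $\mathcal P_{k,\pm}$, compatible with reflection of tangles over a horizontal line, such that $\langle f,g\rangle=\mathrm{tr}(f^*g)$ is positive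 definite. Principal graphs. A projection is $p$ with $p=p^2=p^*$. $\mathrm{Hom}(p,q)$ is the space of diagrams $f$ with bottom boundary that of $p$, top boundary that of $q$ and $qfp=f$ (the numbers of bottom and top points may differ; such diagrams are identified with elements of box spaces by bending strands). $p$ is minimal if $\dim\mathrm{Hom}(p,p)=1$; $p\cong q$ if there is $f\in\mathrm{Hom}(p,q)$ with $f^*f=p$, $ff^*=q$. The principal graph $\Gamma_+$ (resp. dual principal graph $\Gamma_-$) has as vertices the isomorphism classes of minimal projections in the $\mathcal P_{k,+}$ (resp. $\mathcal P_{k,-}$), $k\ge0$, with $\dim\mathrm{Hom}(p\otimes X^{\pm},q)$ edges between $p$ and $q$, where $X^\pm$ is whichever of $X$, $Y$ can be placed to the right of $p$. Relations. A red (resp. blue) strand is a strand carrying $P_1$ (resp. $Q_1$): vertical with shading on the right it is $P_1$ (resp. $Q_1$), with shading on the left it is $\overline{P}_1$ (resp. $\overline{Q}_1$), strands being taken up to isotopy. (i) (bubble) red and blue closed loops with shaded interior in an unshaded region equal $\emptyset_+$; red and blue closed loops with unshaded interior in a shaded region equal $\emptyset_-$; (ii) (strand decomposition) $X=P_1+Q_1$, $Y=\overline{P}_1+\overline{Q}_1$; (iii) (colour disagreement) $P_1Q_1=Q_1P_1=0$; (iv) (saddle) the diagram in $\mathcal P_{2,+}$ (resp. $\mathcal P_{2,-}$) consisting of a red arc joining the two top points and a red arc joining the two bottom points equals $P_1\otimes\overline{P}_1$ (resp. $\overline{P}_1\otimes P_1$); the same with blue arcs equals $Q_1\otimes\overline{Q}_1$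 (resp. $\overline{Q}_1\otimes Q_1$). *)

theory Defs
  imports Complex_Main "HOL-Library.Poly_Mapping" "HOL-Library.FuncSet"
    "HOL-Library.Extended_Nat"
begin

section \<open>Shaded planar tangles\<close>

text \<open>
  A tangle is drawn in generic position with respect to the height function, with every inner box
  upright and its star on the left, and is recorded as the list of its elementary horizontal slices,
  read from bottom to top. A slice \<open>(i, a)\<close> has exactly \<open>i\<close> vertical strands to the left
  of the elementary piece \<open>a\<close>, which is a local minimum of a strand, a local maximum of a strand,
  or a box with \<open>k\<close> strands on top, \<open>k\<close> strands on the bottom and a label.
  A star at any other boundary region of a box is obtained by rotating the box, i.e. by winding the
  strands attached to it.
\<close>

datatype shade = Unshaded | Shaded

fun opp :: "shade \<Rightarrow> shade" where
  "opp Unshaded = Shaded"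
| "opp Shaded = Unshaded"

text \<open>The shading of the region reached from a region shaded \<open>s\<close> after crossing \<open>i\<close> strands.\<close>

definition shade_at :: "shade \<Rightarrow> nat \<Rightarrow> shade" where
  "shade_at s i = (if even i then s else opp s)"

datatype 'b piece = Cup | Cap | Box nat 'b

type_synonym 'b diagram = "(nat \<times> 'b piece) list"

fun ins :: "'b piece \<Rightarrow> nat" where
  "ins Cup = 0" | "ins Cap = 2" | "ins (Box k b) = k"

fun outs :: "'b piece \<Rightarrow> nat" where
  "outs Cup = 2" | "outs Cap = 0" | "outs (Box k b) = k"

text \<open>\<open>goes m w n\<close>: the diagram \<open>w\<close> is well formed, with \<open>m\<close> bottom and \<open>n\<close> top points.\<close>

fun goes :: "nat \<Rightarrow> 'b diagram \<Rightarrow> nat \<Rightarrow> bool" where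
  "goes m [] n \<longleftrightarrow> m = n"
| "goes m ((i, a) # w) n \<longleftrightarrow> i + ins a \<le> m \<and> goes (m - ins a + outs a) w n"

text \<open>
  The labels of the boxes with their types, when the leftmost region is shaded \<open>s\<close>; the shading in
  the type of a box is that of the region at its star, i.e. to the left of the box.
\<close>

definition boxes :: "shade \<Rightarrow> 'b diagram \<Rightarrow> ('b \<times> nat \<times> shade) list" where
  "boxes s w = concat (map (\<lambda>(i, a). case a of Box k b \<Rightarrow> [(b, k, shade_at s i)] | _ \<Rightarrow> []) w)"

definition labels :: "'b diagram \<Rightarrow> 'b list" where
  "labels w = concat (map (\<lambda>(i, a). case a of Box k b \<Rightarrow> [b] | _ \<Rightarrow> []) w)"

text \<open>Nested minima (maxima): \<open>2 * k\<close> consecutive points starting at position \<open>i\<close>.\<close>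

definition cups :: "nat \<Rightarrow> nat \<Rightarrow> 'b diagram" where
  "cups i k = map (\<lambda>j. (i + j, Cup)) [0..<k]"

definition caps :: "nat \<Rightarrow> nat \<Rightarrow> 'b diagram" where
  "caps i k = map (\<lambda>j. (i + j, Cap)) (rev [0..<k])"

text \<open>
  Planar isotopy of diagrams is generated by: exchanging the heights of two pieces that are side by
  side, straightening a strand, and turning a box by a full turn. The last move is recorded as the
  equality of the two half turns: in both of its sides the box is turned upside down, clockwise in
  one and anticlockwise in the other.
\<close>

inductive move :: "'b diagram \<Rightarrow> 'b diagram \<Rightarrow> bool" where
  exchange: "i + ins a \<le> j \<Longrightarrow> move [(j, b), (i, a)] [(i, a), (j - ins a + outs a, b)]"
| straighten_left: "move [(i, Cup), (Suc i, Cap)] []"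
| straighten_right: "move [(Suc i, Cup), (i, Cap)] []"
| full_turn: "move (cups i k @ [(i + k, Box k b)] @ caps (i + k) k)
                   (cups (i + k) k @ [(i + k, Box k b)] @ caps i k)"

definition move_in :: "nat \<Rightarrow> nat \<Rightarrow> 'b diagram \<Rightarrow> 'b diagram \<Rightarrow> bool" where
  "move_in m n w w' \<longleftrightarrow> goes m w n \<and> goes m w' n \<and>
     (\<exists>u v l r. w = u @ l @ v \<and> w' = u @ r @ v \<and> move l r)"

definition isotopic :: "nat \<Rightarrow> nat \<Rightarrow> 'b diagram \<Rightarrow> 'b diagram \<Rightarrow> bool" where
  "isotopic m n = equivclp (move_in m n)"

text \<open>
  A planar tangle of type \<open>(k, s)\<close>; its inner boxes are indexed by distinct natural numbers.
\<close>

definition tangle :: "nat \<Rightarrow> nat diagram \<Rightarrow> bool" where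
  "tangle k T \<longleftrightarrow> goes k T k \<and> distinct (labels T)"

definition shift :: "nat \<Rightarrow> 'b diagram \<Rightarrow> 'b diagram" where
  "shift i w = map (\<lambda>(j, a). (i + j, a)) w"

text \<open>Composition of tangles: each inner box \<open>b\<close> is replaced by the diagram \<open>S b\<close>.\<close>

definition subst :: "'a diagram \<Rightarrow> ('a \<Rightarrow> 'b diagram) \<Rightarrow> 'b diagram" where
  "subst T S = concat (map (\<lambda>(i, a). case a of
       Cup \<Rightarrow> [(i, Cup)] | Cap \<Rightarrow> [(i, Cap)] | Box k b \<Rightarrow> shift i (S b)) T)"

text \<open>Reflection over a horizontal line.\<close>

definition reflect :: "'b diagram \<Rightarrow> 'b diagram" where
  "reflect w = rev (map (\<lambda>(i, a). (i, case a of Cup \<Rightarrow> Cap | Cap \<Rightarrow> Cup | Box k b \<Rightarrow> Box k b)) w)"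


section \<open>Planar algebras\<close>

text \<open>
  All box spaces are subspaces of one ambient complex vector space \<open>'v\<close>. The inputs of a tangle
  are given as a function on the labels of its inner boxes.
\<close>

record 'v planar =
  scl :: "complex \<Rightarrow> 'v \<Rightarrow> 'v"
  Sp :: "nat \<Rightarrow> shade \<Rightarrow> 'v set"
  Act :: "nat \<Rightarrow> shade \<Rightarrow> nat diagram \<Rightarrow> (nat \<Rightarrow> 'v) \<Rightarrow> 'v"

definition fits :: "'v planar \<Rightarrow> shade \<Rightarrow> nat diagram \<Rightarrow> (nat \<Rightarrow> 'v) \<Rightarrow> bool" where
  "fits A s T x \<longleftrightarrow> (\<forall>(b, j, t) \<in> set (boxes s T). x b \<in> Sp A j t)"

locale planar_algebra =
  fixes A :: "'v::ab_group_add planar"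
  assumes vs: "vector_space (scl A)"
    and subspace_Sp: "module.subspace (scl A) (Sp A k s)"
    and act_closed: "tangle k T \<Longrightarrow> fits A s T x \<Longrightarrow> Act A k s T x \<in> Sp A k s"
    and act_cong: "tangle k T \<Longrightarrow> fits A s T x \<Longrightarrow> (\<And>b. b \<in> set (labels T) \<Longrightarrow> x b = y b) \<Longrightarrow>
        Act A k s T x = Act A k s T y"
    and act_add: "tangle k T \<Longrightarrow> b \<in> set (labels T) \<Longrightarrow>
        fits A s T (x(b := u)) \<Longrightarrow> fits A s T (x(b := v)) \<Longrightarrow>
        Act A k s T (x(b := u + v)) = Act A k s T (x(b := u)) + Act A k s T (x(b := v))"
    and act_scale: "tangle k T \<Longrightarrow> b \<in> set (labels T) \<Longrightarrow> fits A s T (x(b := u)) \<Longrightarrow>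
        Act A k s T (x(b := scl A c u)) = scl A c (Act A k s T (x(b := u)))"
    and act_isotopic: "tangle k T \<Longrightarrow> tangle k T' \<Longrightarrow> isotopic k k T T' \<Longrightarrow> fits A s T x \<Longrightarrow>
        Act A k s T x = Act A k s T' x"
    and act_identity: "x b \<in> Sp A k s \<Longrightarrow> Act A k s [(0, Box k b)] x = x b"
    and act_compose: "tangle k T \<Longrightarrow> (\<And>b j t. (b, j, t) \<in> set (boxes s T) \<Longrightarrow> tangle j (S b)) \<Longrightarrow>
        tangle k (subst T S) \<Longrightarrow> fits A s (subst T S) x \<Longrightarrow>
        (\<And>b j t. (b, j, t) \<in> set (boxes s T) \<Longrightarrow> y b = Act A j t (S b) x) \<Longrightarrow>
        Act A k s (subst T S) x = Act A k s T y"

text \<open>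
  \<open>vert A k s\<close>: \<open>k\<close> vertical strands. Thus \<open>vert A 0 s\<close> is the empty diagram, and \<open>X\<close>, \<open>Y\<close>
  are \<open>vert A 1 Unshaded\<close>, \<open>vert A 1 Shaded\<close>.
\<close>

definition vert :: "'v planar \<Rightarrow> nat \<Rightarrow> shade \<Rightarrow> 'v" where
  "vert A k s = Act A k s [] ((!) [])"

definition mult :: "'v planar \<Rightarrow> nat \<Rightarrow> shade \<Rightarrow> 'v \<Rightarrow> 'v \<Rightarrow> 'v" where
  "mult A k s f g = Act A k s [(0, Box k 1), (0, Box k 0)] ((!) [f, g])"

text \<open>\<open>f \<otimes> g\<close> for \<open>f\<close> of type \<open>(k, s)\<close> and \<open>g\<close> of type \<open>(l, shade_at s k)\<close>.\<close>

definition tensor :: "'v planar \<Rightarrow> nat \<Rightarrow> shade \<Rightarrow> nat \<Rightarrow> 'v \<Rightarrow> 'v \<Rightarrow> 'v" where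
  "tensor A k s l f g = Act A (k + l) s [(0, Box k 0), (k, Box l 1)] ((!) [f, g])"

text \<open>Rotation by \<open>\<pi>\<close> of an element of type \<open>(k, s)\<close>.\<close>

definition rot :: "'v planar \<Rightarrow> nat \<Rightarrow> shade \<Rightarrow> 'v \<Rightarrow> 'v" where
  "rot A k s f = Act A k (shade_at s k) (cups 0 k @ [(k, Box k 0)] @ caps k k) ((!) [f])"

definition tr_right :: "'v planar \<Rightarrow> nat \<Rightarrow> shade \<Rightarrow> 'v \<Rightarrow> 'v" where
  "tr_right A k s f = Act A 0 s (cups 0 k @ [(0, Box k 0)] @ caps 0 k) ((!) [f])"

definition tr_left :: "'v planar \<Rightarrow> nat \<Rightarrow> shade \<Rightarrow> 'v \<Rightarrow> 'v" where
  "tr_left A k s f = Act A 0 (shade_at s k) (cups 0 k @ [(k, Box k 0)] @ caps 0 k) ((!) [f])"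


subsection \<open>Subfactor planar algebras\<close>

text \<open>Dimension with values in \<open>enat\<close>: the library's \<open>dim\<close> is 0 in infinite dimension.\<close>

definition edim :: "'v::ab_group_add planar \<Rightarrow> 'v set \<Rightarrow> enat" where
  "edim A S = (if \<exists>B. finite B \<and> S \<subseteq> module.span (scl A) B
     then enat (vector_space.dim (scl A) S) else \<infinity>)"

text \<open>The scalar represented by an element of type \<open>(0, s)\<close>.\<close>

definition scalar :: "'v planar \<Rightarrow> shade \<Rightarrow> 'v \<Rightarrow> complex" where
  "scalar A s x = (THE c. x = scl A c (vert A 0 s))"

locale subfactor_planar_algebra = planar_algebra A
  for A :: "'v::ab_group_add planar" and star :: "'v \<Rightarrow> 'v" +
  assumes dim_zero_boxes: "edim A (Sp A 0 s) = 1"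
    and spherical: "f \<in> Sp A 1 s \<Longrightarrow>
        scalar A (shade_at s 1) (tr_left A 1 s f) = scalar A s (tr_right A 1 s f)"
    and star_closed: "f \<in> Sp A k s \<Longrightarrow> star f \<in> Sp A k s"
    and star_add: "f \<in> Sp A k s \<Longrightarrow> g \<in> Sp A k s \<Longrightarrow> star (f + g) = star f + star g"
    and star_scale: "f \<in> Sp A k s \<Longrightarrow> star (scl A c f) = scl A (cnj c) (star f)"
    and star_star: "f \<in> Sp A k s \<Longrightarrow> star (star f) = f"
    and star_act: "tangle k T \<Longrightarrow> fits A s T x \<Longrightarrow>
        star (Act A k s T x) = Act A k s (reflect T) (\<lambda>b. star (x b))"
    and positive_definite: "f \<in> Sp A k s \<Longrightarrow> f \<noteq> 0 \<Longrightarrow>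
        scalar A s (tr_right A k s (mult A k s (star f) f)) \<in> \<real> \<and>
        0 < Re (scalar A s (tr_right A k s (mult A k s (star f) f)))"


subsection \<open>Principal graphs\<close>

text \<open>
  A diagram with \<open>a\<close> bottom and \<open>b\<close> top points, \<open>a + b\<close> even, is identified with an element \<open>f\<close>
  of the box space with parameter \<open>(a + b) div 2\<close> by bending strands on the right. \<open>bend a b c\<close>
  is the diagram from \<open>a\<close> to \<open>b\<close> points obtained from a box (labelled \<open>c\<close>) containing \<open>f\<close>, and
  \<open>unbend a b w\<close> bends a diagram \<open>w\<close> from \<open>a\<close> to \<open>b\<close> points back to a tangle. By truncated
  subtraction, at most one of the two bundles of bent strands is nonempty.
\<close>

definition bend :: "nat \<Rightarrow> nat \<Rightarrow> 'b \<Rightarrow> 'b diagram" where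
  "bend a b c = cups a ((b - a) div 2) @ [(0, Box ((a + b) div 2) c)] @ caps b ((a - b) div 2)"

definition unbend :: "nat \<Rightarrow> nat \<Rightarrow> 'b diagram \<Rightarrow> 'b diagram" where
  "unbend a b w = cups ((a + b) div 2) ((a - b) div 2) @ w @ caps ((a + b) div 2) ((b - a) div 2)"

text \<open>\<open>hom A s a p b q\<close> is \<open>Hom(p, q)\<close> for \<open>p\<close> of type \<open>(a, s)\<close> and \<open>q\<close> of type \<open>(b, s)\<close>.\<close>

definition hom :: "'v::zero planar \<Rightarrow> shade \<Rightarrow> nat \<Rightarrow> 'v \<Rightarrow> nat \<Rightarrow> 'v \<Rightarrow> 'v set" where
  "hom A s a p b q = (if even (a + b)
     then {f \<in> Sp A ((a + b) div 2) s.
             Act A ((a + b) div 2) s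
               (unbend a b ([(0, Box a 0)] @ bend a b 1 @ [(0, Box b 2)])) ((!) [p, f, q]) = f}
     else {0})"

text \<open>
  \<open>g f\<close> in the box space of type \<open>(a, s)\<close>, for \<open>f\<close> from \<open>a\<close> to \<open>b\<close> points and \<open>g\<close> from \<open>b\<close>
  to \<open>a\<close> points.
\<close>

definition hcomp :: "'v planar \<Rightarrow> shade \<Rightarrow> nat \<Rightarrow> nat \<Rightarrow> 'v \<Rightarrow> 'v \<Rightarrow> 'v" where
  "hcomp A s a b g f = Act A a s (bend a b 0 @ bend b a 1) ((!) [f, g])"

definition is_projection :: "'v planar \<Rightarrow> ('v \<Rightarrow> 'v) \<Rightarrow> shade \<Rightarrow> nat \<Rightarrow> 'v \<Rightarrow> bool" where
  "is_projection A star s k p \<longleftrightarrow> p \<in> Sp A k s \<and> mult A k s p p = p \<and> star p = p"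

definition is_minimal :: "'v::ab_group_add planar \<Rightarrow> ('v \<Rightarrow> 'v) \<Rightarrow> shade \<Rightarrow> nat \<Rightarrow> 'v \<Rightarrow> bool" where
  "is_minimal A star s k p \<longleftrightarrow> is_projection A star s k p \<and> edim A (hom A s k p k p) = 1"

definition iso_proj :: "'v::zero planar \<Rightarrow> ('v \<Rightarrow> 'v) \<Rightarrow> shade \<Rightarrow> nat \<times> 'v \<Rightarrow> nat \<times> 'v \<Rightarrow> bool" where
  "iso_proj A star s = (\<lambda>(a, p) (b, q). even (a + b) \<and>
     (\<exists>f \<in> hom A s a p b q. hcomp A s a b (star f) f = p \<and> hcomp A s b a f (star f) = q))"

definition minimal_projections ::
  "'v::ab_group_add planar \<Rightarrow> ('v \<Rightarrow> 'v) \<Rightarrow> shade \<Rightarrow> (nat \<times> 'v) set" where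
  "minimal_projections A star s = {(k, p). is_minimal A star s k p}"

definition iso_class ::
  "'v::ab_group_add planar \<Rightarrow> ('v \<Rightarrow> 'v) \<Rightarrow> shade \<Rightarrow> nat \<times> 'v \<Rightarrow> (nat \<times> 'v) set" where
  "iso_class A star s v = {w \<in> minimal_projections A star s. iso_proj A star s v w}"

text \<open>
  The principal graph (\<open>s = Unshaded\<close>) and the dual principal graph (\<open>s = Shaded\<close>). The number of
  edges from \<open>C\<close> to \<open>D\<close> is the common value of the dimension over all representatives.
\<close>

definition graph_vertices ::
  "'v::ab_group_add planar \<Rightarrow> ('v \<Rightarrow> 'v) \<Rightarrow> shade \<Rightarrow> (nat \<times> 'v) set set" where
  "graph_vertices A star s = iso_class A star s ` minimal_projections A star s"

definition graph_edges ::
  "'v::ab_group_add planar \<Rightarrow> shade \<Rightarrow> (nat \<times> 'v) set \<Rightarrow> (nat \<times> 'v) set \<Rightarrow> enat" where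
  "graph_edges A s C D = (THE n. \<forall>(a, p) \<in> C. \<forall>(b, q) \<in> D.
     edim A (hom A s (a + 1) (tensor A a s 1 p (vert A 1 (shade_at s a))) b q) = n)"


section \<open>Generators and relations\<close>

text \<open>
  The free planar algebra on generators of types given by \<open>typ\<close>: the box space of type \<open>(k, s)\<close>
  has as basis the isotopy classes of tangles whose inner boxes are filled with generators.
\<close>

type_synonym 'g ltangle = "nat \<times> shade \<times> 'g diagram set"

definition labelled :: "('g \<Rightarrow> nat \<times> shade) \<Rightarrow> nat \<Rightarrow> shade \<Rightarrow> 'g diagram \<Rightarrow> bool" where
  "labelled typ k s w \<longleftrightarrow> goes k w k \<and> (\<forall>(g, j, t) \<in> set (boxes s w). typ g = (j, t))"

definition ltangle :: "nat \<Rightarrow> shade \<Rightarrow> 'g diagram \<Rightarrow> 'g ltangle" where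
  "ltangle k s w = (k, s, {w'. isotopic k k w w'})"

definition rep :: "'g ltangle \<Rightarrow> 'g diagram" where
  "rep D = (SOME w. w \<in> snd (snd D))"

definition pm_scale :: "complex \<Rightarrow> ('a \<Rightarrow>\<^sub>0 complex) \<Rightarrow> ('a \<Rightarrow>\<^sub>0 complex)" where
  "pm_scale c f = Poly_Mapping.map (\<lambda>z. c * z) f"

text \<open>Tangles act by multilinear extension of substitution.\<close>

definition free_planar :: "('g \<Rightarrow> nat \<times> shade) \<Rightarrow> ('g ltangle \<Rightarrow>\<^sub>0 complex) planar" where
  "free_planar typ =
     \<lparr> scl = pm_scale,
       Sp = (\<lambda>k s. {f. Poly_Mapping.keys f \<subseteq> ltangle k s ` {w. labelled typ k s w}}),
       Act = (\<lambda>k s T x. \<Sum>D \<in> (\<Pi>\<^sub>E b \<in> set (labels T). Poly_Mapping.keys (x b)).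
          Poly_Mapping.single (ltangle k s (subst T (\<lambda>b. rep (D b))))
            (\<Prod>b \<in> set (labels T). Poly_Mapping.lookup (x b) (D b))) \<rparr>"

definition generator :: "('g \<Rightarrow> nat \<times> shade) \<Rightarrow> 'g \<Rightarrow> 'g ltangle \<Rightarrow>\<^sub>0 complex" where
  "generator typ g =
     (case typ g of (k, s) \<Rightarrow> Poly_Mapping.single (ltangle k s [(0, Box k g)]) 1)"

text \<open>The antilinear extension of reflection of diagrams, with all generators self-adjoint.\<close>

definition free_star :: "('g ltangle \<Rightarrow>\<^sub>0 complex) \<Rightarrow> ('g ltangle \<Rightarrow>\<^sub>0 complex)" where
  "free_star f = (\<Sum>(k, s, D) \<in> Poly_Mapping.keys f.
     Poly_Mapping.single (ltangle k s (reflect (rep (k, s, D))))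
       (cnj (Poly_Mapping.lookup f (k, s, D))))"

text \<open>A planar ideal: subspaces of the box spaces such that a tangle with an input in the ideal has
  its output in the ideal.\<close>

definition planar_ideal :: "'v::ab_group_add planar \<Rightarrow> (nat \<Rightarrow> shade \<Rightarrow> 'v set) \<Rightarrow> bool" where
  "planar_ideal A I \<longleftrightarrow>
     (\<forall>k s. module.subspace (scl A) (I k s) \<and> I k s \<subseteq> Sp A k s) \<and>
     (\<forall>k s T x. tangle k T \<and> fits A s T x \<and> (\<exists>(b, j, t) \<in> set (boxes s T). x b \<in> I j t)
        \<longrightarrow> Act A k s T x \<in> I k s)"

definition ideal_generated ::
  "'v::ab_group_add planar \<Rightarrow> (nat \<Rightarrow> shade \<Rightarrow> 'v set) \<Rightarrow> nat \<Rightarrow> shade \<Rightarrow> 'v set" where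
  "ideal_generated A R k s =
     \<Inter> {I k s | I. planar_ideal A I \<and> (\<forall>j t. R j t \<subseteq> I j t)}"


section \<open>The presentation\<close>

datatype gen = Gen

definition FA :: "(gen ltangle \<Rightarrow>\<^sub>0 complex) planar" where
  "FA = free_planar (\<lambda>_. (1, Unshaded))"

definition freeP :: "gen ltangle \<Rightarrow>\<^sub>0 complex" where
  "freeP = generator (\<lambda>_. (1, Unshaded)) Gen"

definition freeQ :: "gen ltangle \<Rightarrow>\<^sub>0 complex" where
  "freeQ = vert FA 1 Unshaded - freeP"

text \<open>
  \<open>relator k s x\<close>: \<open>x = 0\<close> is imposed in the box space of type \<open>(k, s)\<close>. A box containing \<open>P\<^sub>1\<close>
  (or \<open>Q\<^sub>1\<close>) is placed on each coloured strand where that strand runs vertically with the shading on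
  its right.
\<close>

inductive relator :: "nat \<Rightarrow> shade \<Rightarrow> (gen ltangle \<Rightarrow>\<^sub>0 complex) \<Rightarrow> bool" where
  bubble_shaded: "c \<in> {freeP, freeQ} \<Longrightarrow> relator 0 Unshaded
     (Act FA 0 Unshaded [(0, Cup), (0, Box 1 0), (0, Cap)] ((!) [c]) - vert FA 0 Unshaded)"
| bubble_unshaded: "c \<in> {freeP, freeQ} \<Longrightarrow> relator 0 Shaded
     (Act FA 0 Shaded [(0, Cup), (1, Box 1 0), (0, Cap)] ((!) [c]) - vert FA 0 Shaded)"
| strand_X: "relator 1 Unshaded (vert FA 1 Unshaded - (freeP + freeQ))"
| strand_Y: "relator 1 Shaded
     (vert FA 1 Shaded - (rot FA 1 Unshaded freeP + rot FA 1 Unshaded freeQ))"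
| disagree_PQ: "relator 1 Unshaded (mult FA 1 Unshaded freeP freeQ)"
| disagree_QP: "relator 1 Unshaded (mult FA 1 Unshaded freeQ freeP)"
| saddle_unshaded: "c \<in> {freeP, freeQ} \<Longrightarrow> relator 2 Unshaded
     (Act FA 2 Unshaded [(0, Box 1 0), (0, Cap), (0, Cup), (0, Box 1 1)] ((!) [c, c])
       - tensor FA 1 Unshaded 1 c (rot FA 1 Unshaded c))"
| saddle_shaded: "c \<in> {freeP, freeQ} \<Longrightarrow> relator 2 Shaded
     (Act FA 2 Shaded [(1, Box 1 0), (0, Cap), (0, Cup), (1, Box 1 1)] ((!) [c, c])
       - tensor FA 1 Shaded 1 (rot FA 1 Unshaded c) c)"

definition relation_ideal :: "nat \<Rightarrow> shade \<Rightarrow> (gen ltangle \<Rightarrow>\<^sub>0 complex) set" where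
  "relation_ideal = ideal_generated FA (\<lambda>k s. {x. relator k s x})"

text \<open>
  The ambient space of the quotient. The ideal is graded by the box types, so the image of each box
  space of \<open>FA\<close> is its quotient by the part of the ideal of the same type.
\<close>

definition total_ideal :: "(gen ltangle \<Rightarrow>\<^sub>0 complex) set" where
  "total_ideal = module.span (scl FA) (\<Union>k s. relation_ideal k s)"

lemma lookup_pm_scale: "Poly_Mapping.lookup (pm_scale c f) x = c * Poly_Mapping.lookup f x"
  by (simp add: pm_scale_def Poly_Mapping.map.rep_eq when_def)

lemma vector_space_pm_scale: "vector_space pm_scale"
  by unfold_locales
    (auto intro!: poly_mapping_eqI simp: lookup_pm_scale lookup_add algebra_simps)

lemma subspace_total_ideal: "module.subspace pm_scale total_ideal"
proof -
  interpret vector_space pm_scale by (rule vector_space_pm_scale)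
  show ?thesis by (simp add: total_ideal_def FA_def free_planar_def)
qed

definition congr :: "(gen ltangle \<Rightarrow>\<^sub>0 complex) \<Rightarrow> (gen ltangle \<Rightarrow>\<^sub>0 complex) \<Rightarrow> bool" where
  "congr x y \<longleftrightarrow> x - y \<in> total_ideal"

lemma equivp_congr: "equivp congr"
proof -
  interpret vector_space pm_scale by (rule vector_space_pm_scale)
  note S = subspace_total_ideal
  show ?thesis
  proof (rule equivpI)
    show "reflp congr" using subspace_0[OF S] by (simp add: reflp_def congr_def)
    show "symp congr" using subspace_neg[OF S] by (force simp: symp_def congr_def)
    show "transp congr" using subspace_add[OF S] by (force simp: transp_def congr_def)
  qed
qed

quotient_type PA = "gen ltangle \<Rightarrow>\<^sub>0 complex" / congr
  by (rule equivp_congr)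

instantiation PA :: ab_group_add
begin

lift_definition zero_PA :: PA is 0 .

lift_definition plus_PA :: "PA \<Rightarrow> PA \<Rightarrow> PA" is "(+)"
proof -
  interpret vector_space pm_scale by (rule vector_space_pm_scale)
  fix a b c d assume "congr a b" "congr c d"
  then show "congr (a + c) (b + d)"
    using subspace_add[OF subspace_total_ideal, of "a - b" "c - d"]
    by (simp add: congr_def add_diff_add)
qed

lift_definition minus_PA :: "PA \<Rightarrow> PA \<Rightarrow> PA" is "(-)"
proof -
  interpret vector_space pm_scale by (rule vector_space_pm_scale)
  fix a b c d assume "congr a b" "congr c d"
  then have "(a - b) - (c - d) \<in> total_ideal"
    using subspace_diff[OF subspace_total_ideal] by (simp add: congr_def)
  then show "congr (a - c) (b - d)" by (simp add: congr_def algebra_simps)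
qed

lift_definition uminus_PA :: "PA \<Rightarrow> PA" is uminus
proof -
  interpret vector_space pm_scale by (rule vector_space_pm_scale)
  fix a b assume "congr a b"
  then have "- (a - b) \<in> total_ideal"
    unfolding congr_def by (rule subspace_neg[OF subspace_total_ideal])
  then show "congr (- a) (- b)" by (simp add: congr_def)
qed

instance
proof -
  interpret vector_space pm_scale by (rule vector_space_pm_scale)
  have r: "congr x x" for x using equivp_congr by (rule equivp_reflp)
  show "OFCLASS(PA, ab_group_add_class)"
    by standard (transfer, simp add: algebra_simps r)+
qed

end

lift_definition scale_PA :: "complex \<Rightarrow> PA \<Rightarrow> PA" is pm_scale
proof -
  interpret vector_space pm_scale by (rule vector_space_pm_scale)
  fix c a b assume "congr a b"
  then show "congr (pm_scale c a) (pm_scale c b)"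
    using subspace_scale[OF subspace_total_ideal]
    by (force simp: congr_def scale_right_diff_distrib[symmetric])
qed

text \<open>The quotient of \<open>FA\<close> by the ideal: tangles act on representatives of the same type.\<close>

definition PAlg :: "PA planar" where
  "PAlg =
     \<lparr> scl = scale_PA,
       Sp = (\<lambda>k s. abs_PA ` Sp FA k s),
       Act = (\<lambda>k s T x. abs_PA (Act FA k s T
          (SOME y. fits FA s T y \<and> (\<forall>b \<in> set (labels T). abs_PA (y b) = x b)))) \<rparr>"

definition star_PA :: "PA \<Rightarrow> PA" where
  "star_PA x = abs_PA (free_star (rep_PA x))"

definition P1 :: PA where "P1 = abs_PA freeP"

definition Q1 :: PA where "Q1 = vert PAlg 1 Unshaded - P1"

text \<open>\<open>alt s x y k = x \<otimes> y \<otimes> x \<otimes> \<dots>\<close> (\<open>k\<close> factors), for \<open>x\<close> of type \<open>(1, s)\<close> and \<open>y\<close> of type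
  \<open>(1, opp s)\<close>.\<close>

fun alt :: "shade \<Rightarrow> PA \<Rightarrow> PA \<Rightarrow> nat \<Rightarrow> PA" where
  "alt s x y 0 = vert PAlg 0 s"
| "alt s x y (Suc k) = tensor PAlg 1 s k x (alt (opp s) y x k)"

definition P_seq :: "nat \<Rightarrow> PA" where
  "P_seq k = alt Unshaded P1 (rot PAlg 1 Unshaded Q1) k"

definition Q_seq :: "nat \<Rightarrow> PA" where
  "Q_seq k = alt Unshaded Q1 (rot PAlg 1 Unshaded P1) k"

definition P_seq' :: "nat \<Rightarrow> PA" where
  "P_seq' k = alt Shaded (rot PAlg 1 Unshaded P1) Q1 k"

definition Q_seq' :: "nat \<Rightarrow> PA" where
  "Q_seq' k = alt Shaded (rot PAlg 1 Unshaded Q1) P1 k"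

text \<open>The two-sided path \<open>\<dots>, b 2, b 1, a 0 = b 0, a 1, a 2, \<dots>\<close>, each term with its box size.\<close>

definition two_sided :: "(nat \<Rightarrow> PA) \<Rightarrow> (nat \<Rightarrow> PA) \<Rightarrow> int \<Rightarrow> nat \<times> PA" where
  "two_sided a b n = (nat \<bar>n\<bar>, if 0 \<le> n then a (nat n) else b (nat (- n)))"

text \<open>
  The graph with vertices \<open>graph_vertices\<close> and edges \<open>graph_edges\<close> is the two-sided infinite path
  whose \<open>n\<close>-th vertex is the class of \<open>v n\<close>.
\<close>

definition is_two_sided_path ::
  "'v::ab_group_add planar \<Rightarrow> ('v \<Rightarrow> 'v) \<Rightarrow> shade \<Rightarrow> (int \<Rightarrow> nat \<times> 'v) \<Rightarrow> bool" where
  "is_two_sided_path A star s v \<longleftrightarrow>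
     (\<forall>n. v n \<in> minimal_projections A star s) \<and>
     bij_betw (\<lambda>n. iso_class A star s (v n)) UNIV (graph_vertices A star s) \<and>
     (\<forall>m n. graph_edges A s (iso_class A star s (v m)) (iso_class A star s (v n)) =
        (if \<bar>m - n\<bar> = 1 then 1 else 0))"

end

theory Submission
  imports Defs
begin

text \<open>
  Colour every strand red, for \<open>P1\<close>, or blue, for \<open>Q1\<close>. A diagram whose generators are read as projections
  onto red then becomes a matrix indexed by the colourings of its bottom and top strands: the entry counts
  the compatible colourings of the whole diagram. This state sum \<open>ev\<close> is invariant under isotopy
  (\<open>ev_isotopic\<close>), compatible with composition (\<open>ev_subst\<close>), and all relations hold for it
  (\<open>relator_in_kernel\<close>), so it gives a matrix \<open>mat\<close> for each element of the quotient. Give the colours the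
  charges \<open>1\<close> and \<open>-1\<close>, counted with alternating signs along a row of strands; then all these matrices
  preserve the total charge, called \<open>degree\<close>.

  The point of the proof is that nothing else happens: \<open>mat\<close> identifies each box space with the space of
  all degree-preserving matrices (\<open>mat_inject\<close>, \<open>mat_surjective\<close>). By strand decomposition a diagram is the
  sum of the diagrams in which the boundary strands are coloured. Colour disagreement propagates the
  colours. The bubble and saddle relations say that a cap between neighbouring strands of the same colour
  is invertible, so every row of coloured strands is isomorphic to the row in which equal neighbours are
  cancelled, and this alternating row is determined by the degree. An insertion of equal neighbours
  commutes with this isomorphism (\<open>reduce_Cup\<close>); consequently a diagram with coloured boundary is the
  isomorphism through the alternating row, times the entry of the state sum (\<open>coloured_diagram\<close>).

  The rest is linear algebra. The axioms of a planar algebra are identities of state sums, the involution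
  is the adjoint of matrices and the trace form is \<open>\<Sum> \<bar>f a b\<bar>\<^sup>2\<close>. The degree-preserving matrices form a
  direct sum of full matrix algebras, one for each degree, so a minimal projection has rank one
  (\<open>minimal_rank_one\<close>) and is classified by its degree (\<open>iso_rank_one\<close>). A further strand has charge \<open>1\<close> or
  \<open>-1\<close>, according to its colour, so it links each degree to its two neighbours (\<open>path_edges\<close>). The
  alternating products project onto the alternating colourings, which have degrees \<open>k\<close> and \<open>-k\<close>.
\<close>

section \<open>State sums\<close>

definition colourings :: "nat \<Rightarrow> bool list set" where
  "colourings k = {x. length x = k}"

lemma mem_colourings [simp]: "x \<in> colourings k \<longleftrightarrow> length x = k"
  by (simp add: colourings_def)

lemma finite_colourings [simp]: "finite (colourings k)"
  using finite_lists_length_eq[of "UNIV :: bool set" k] by (simp add: colourings_def)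

lemma colourings_0 [simp]: "colourings 0 = {[]}"
  by (auto simp: colourings_def)

lemma sum_colourings_Suc:
  "(\<Sum>t\<in>colourings (Suc k). f t) = (\<Sum>c\<in>UNIV. \<Sum>t\<in>colourings k. f (c # t))"
proof -
  have "colourings (Suc k) = (\<lambda>(c, t). c # t) ` (UNIV \<times> colourings k)"
    by (auto simp: colourings_def length_Suc_conv image_iff)
  then have "(\<Sum>t\<in>colourings (Suc k). f t) = (\<Sum>(c, t)\<in>UNIV \<times> colourings k. f (c # t))"
    by (subst sum.reindex[symmetric, of "\<lambda>(c, t). c # t", unfolded comp_def case_prod_beta]
        | simp add: inj_on_def case_prod_beta sum.reindex)+
  then show ?thesis by (simp add: sum.cartesian_product)
qed

lemma sum_colourings_rev: "(\<Sum>t\<in>colourings k. f (rev t)) = (\<Sum>t\<in>colourings k. f t)"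
  by (rule sum.reindex_bij_witness[of _ rev rev]) auto

lemma sum_colourings_delta:
  "length x = k \<Longrightarrow> (\<Sum>t\<in>colourings k. of_bool (x = t) * f t) = (f x :: complex)"
  "length x = k \<Longrightarrow> (\<Sum>t\<in>colourings k. of_bool (t = x) * f t) = (f x :: complex)"
  by (simp_all add: of_bool_def if_distrib[of "\<lambda>z. z * _"] sum.delta' cong: if_cong)

type_synonym cmat = "bool list \<Rightarrow> bool list \<Rightarrow> complex"

fun piece_weight :: "('b \<Rightarrow> cmat) \<Rightarrow> 'b piece \<Rightarrow> cmat" where
  "piece_weight I Cup x y = of_bool (\<exists>c. y = [c, c])"
| "piece_weight I Cap x y = of_bool (\<exists>c. x = [c, c])"
| "piece_weight I (Box k b) x y = I b x y"

text \<open>The partition function of the colouring model, contracted slice by slice from the bottom; the first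
  argument of a matrix is the bottom colouring. The shading does not enter, so the matrices of a box of
  type \<open>(k, Unshaded)\<close> and of type \<open>(k, Shaded)\<close> live in the same space.\<close>

fun ev :: "('b \<Rightarrow> cmat) \<Rightarrow> 'b diagram \<Rightarrow> cmat" where
  "ev I [] x y = of_bool (x = y)"
| "ev I ((i, a) # w) x y = (\<Sum>t\<in>colourings (outs a).
     piece_weight I a (take (ins a) (drop i x)) t * ev I w (take i x @ t @ drop (i + ins a) x) y)"

lemma ev_piece:
  assumes "length p = i" "length u = ins a"
  shows "ev I ((i, a) # w) (p @ u @ q) y =
    (\<Sum>t\<in>colourings (outs a). piece_weight I a u t * ev I w (p @ t @ q) y)"
  using assms by (simp add: drop_append)

declare ev.simps(2) [simp del]

lemma ev_Cup:
  assumes "length p = i"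
  shows "ev I ((i, Cup) # w) (p @ q) y = (\<Sum>c\<in>UNIV. ev I w (p @ c # c # q) y)"
  using ev_piece[of p i "[]" Cup I w q y] assms
  by (simp add: numeral_2_eq_2 sum_colourings_Suc UNIV_bool)

lemma ev_Cap:
  assumes "length p = i"
  shows "ev I ((i, Cap) # w) (p @ c # d # q) y = of_bool (c = d) * ev I w (p @ q) y"
  using ev_piece[of p i "[c, d]" Cap I w q y] assms by auto

lemma ev_Box:
  assumes "length p = i" "length u = k"
  shows "ev I ((i, Box k b) # w) (p @ u @ q) y = (\<Sum>t\<in>colourings k. I b u t * ev I w (p @ t @ q) y)"
  using ev_piece[of p i u "Box k b" I w q y] assms by simp

lemma split_colouring:
  assumes "i + n \<le> length x"
  obtains p u q where "x = p @ u @ q" "length p = i" "length u = n"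
proof
  show "x = take i x @ take n (drop i x) @ drop (i + n) x"
    by (metis append_take_drop_id drop_drop add.commute)
qed (use assms in auto)

lemma goes_append: "goes m (u @ v) n \<longleftrightarrow> (\<exists>j. goes m u j \<and> goes j v n)"
  by (induction m u n rule: goes.induct) auto

lemma goes_unique: "goes m w n \<Longrightarrow> goes m w n' \<Longrightarrow> n = n'"
  by (induction m w n rule: goes.induct) auto

lemma ev_append:
  "goes m u n \<Longrightarrow> length x = m \<Longrightarrow> ev I (u @ v) x y = (\<Sum>z\<in>colourings n. ev I u x z * ev I v z y)"
proof (induction m u n arbitrary: x rule: goes.induct)
  case (1 m n)
  then show ?case by (simp add: sum_colourings_delta)
next
  case (2 m i a w n)
  then obtain p r q where x: "x = p @ r @ q" "length p = i" "length r = ins a"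
    by (auto elim: split_colouring)
  have "ev I (w @ v) (p @ t @ q) y = (\<Sum>z\<in>colourings n. ev I w (p @ t @ q) z * ev I v z y)"
    if "t \<in> colourings (outs a)" for t using 2 that x by auto
  then show ?case unfolding x(1) append_Cons ev_piece[OF x(2,3)]
    by (simp add: sum_distrib_left sum_distrib_right sum.swap[of _ _ "colourings n"] mult.assoc)
qed

lemma ev_cong:
  assumes "\<And>i j b u t. (i, Box j b) \<in> set w \<Longrightarrow> length u = j \<Longrightarrow> length t = j \<Longrightarrow> I b u t = J b u t"
    and "goes m w n" "length x = m"
  shows "ev I w x y = ev J w x y"
  using assms
proof (induction w arbitrary: m x)
  case (Cons s w)
  obtain i a where s: "s = (i, a)" by force
  obtain p u q where x: "x = p @ u @ q" "length p = i" "length u = ins a"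
    using Cons.prems(2,3) s by (auto elim: split_colouring)
  have "piece_weight I a u t * ev I w (p @ t @ q) y = piece_weight J a u t * ev J w (p @ t @ q) y"
    if "t \<in> colourings (outs a)" for t
  proof -
    have "ev I w (p @ t @ q) y = ev J w (p @ t @ q) y"
    proof (rule Cons.IH)
      show "goes (m - ins a + outs a) w n" using Cons.prems(2) unfolding s by (simp only: goes.simps)
      show "length (p @ t @ q) = m - ins a + outs a" using Cons.prems(3) that x by simp
      show "I b u t = J b u t" if "(i', Box j b) \<in> set w" "length u = j" "length t = j" for i' j b u t
        by (rule Cons.prems(1)[of i' j]) (use that in auto)
    qed
    moreover have "piece_weight I a u t = piece_weight J a u t"
      using Cons.prems(1)[of i "length t"] that x s by (cases a) auto
    ultimately show ?thesis by simp
  qed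
  then show ?case unfolding x(1) s ev_piece[OF x(2,3)] by simp
qed simp

lemma shift_Nil [simp]: "shift i [] = []"
  and shift_Cons [simp]: "shift i ((j, a) # w) = (i + j, a) # shift i w"
  and shift_append: "shift i (u @ v) = shift i u @ shift i v"
  by (simp_all add: shift_def)

lemma goes_shift_append:
  "goes k w l \<Longrightarrow> goes (i + k + r) (shift i w @ v) n \<longleftrightarrow> goes (i + l + r) v n"
proof (induction k w l rule: goes.induct)
  case (2 m j a w n)
  then have "i + m + r - ins a + outs a = i + (m - ins a + outs a) + r" by auto
  moreover have "i + j + ins a \<le> i + m + r" using 2 by simp
  ultimately show ?case using 2 by simp
qed auto

lemma ev_shift_append:
  assumes "goes k w l" "length p = i" "length x = k"
  shows "ev I (shift i w @ v) (p @ x @ q) y = (\<Sum>t\<in>colourings l. ev I w x t * ev I v (p @ t @ q) y)"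
  using assms
proof (induction k w l arbitrary: x rule: goes.induct)
  case (1 m n)
  then show ?case by (simp add: sum_colourings_delta)
next
  case (2 m j a w n)
  then obtain p' r q' where x: "x = p' @ r @ q'" "length p' = j" "length r = ins a"
    by (auto elim: split_colouring)
  have e: "ev I (shift i w @ v) ((p @ p') @ t @ q' @ q) y
     = (\<Sum>z\<in>colourings n. ev I w (p' @ t @ q') z * ev I v (p @ z @ q) y)"
    if "t \<in> colourings (outs a)" for t
    using 2(1)[of "p' @ t @ q'"] 2(2-) that x by simp
  have "ev I (shift i ((j, a) # w) @ v) (p @ x @ q) y
    = ev I ((i + j, a) # shift i w @ v) ((p @ p') @ r @ q' @ q) y" using x by simp
  also have "\<dots> = (\<Sum>t\<in>colourings (outs a). piece_weight I a r t *
      (\<Sum>z\<in>colourings n. ev I w (p' @ t @ q') z * ev I v (p @ z @ q) y))"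
    by (subst ev_piece) (use 2 x e in auto)
  finally show ?case unfolding x(1) ev_piece[OF x(2,3)]
    by (simp add: sum_distrib_left sum_distrib_right sum.swap[of _ _ "colourings n"] mult.assoc)
qed

lemma subst_Nil [simp]: "subst [] S = []"
  and subst_Cup [simp]: "subst ((i, Cup) # w) S = (i, Cup) # subst w S"
  and subst_Cap [simp]: "subst ((i, Cap) # w) S = (i, Cap) # subst w S"
  and subst_Box [simp]: "subst ((i, Box k b) # w) S = shift i (S b) @ subst w S"
  and subst_append: "subst (u @ v) S = subst u S @ subst v S"
  by (simp_all add: subst_def)

lemma goes_subst:
  assumes "\<And>i j b. (i, Box j b) \<in> set T \<Longrightarrow> goes j (S b) j" "goes m T n"
  shows "goes m (subst T S) n"
  using assms
proof (induction T arbitrary: m)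
  case (Cons s T)
  obtain i a where s: "s = (i, a)" by force
  show ?case
  proof (cases a)
    case (Box k b)
    then have g: "goes k (S b) k" using Cons.prems(1)[of i k b] s by auto
    have m: "m = i + k + (m - i - k)" using Cons.prems(2) s Box by auto
    have "goes m (subst T S) n"
      by (rule Cons.IH) (use Cons.prems s Box in \<open>auto\<close>)
    then show ?thesis using goes_shift_append[OF g, of i "m - i - k" "subst T S" n] s Box m by simp
  qed (use Cons s in auto)
qed simp

text \<open>Locality: the strands beside a box keep their colours, so the diagram put into the box contributes
  exactly its own matrix.\<close>

lemma ev_subst:
  assumes "\<And>i j b. (i, Box j b) \<in> set T \<Longrightarrow> goes j (S b) j" "goes m T n" "length x = m"
  shows "ev I (subst T S) x y = ev (\<lambda>b. ev I (S b)) T x y"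
  using assms
proof (induction T arbitrary: m x)
  case (Cons s T)
  obtain i a where s: "s = (i, a)" by force
  obtain p u q where x: "x = p @ u @ q" "length p = i" "length u = ins a"
    using Cons.prems(2,3) s by (auto elim: split_colouring)
  have IH: "ev I (subst T S) (p @ t @ q) y = ev (\<lambda>b. ev I (S b)) T (p @ t @ q) y"
    if "t \<in> colourings (outs a)" for t
  proof (rule Cons.IH)
    show "goes (m - ins a + outs a) T n" using Cons.prems(2) unfolding s by (simp only: goes.simps)
    show "length (p @ t @ q) = m - ins a + outs a" using Cons.prems(3) that x by simp
  qed (use Cons.prems(1) in auto)
  show ?case
  proof (cases a)
    case (Box k b)
    then have g: "goes k (S b) k" using Cons.prems(1)[of i k b] s by auto
    have "ev I (subst (s # T) S) x y = ev I (shift i (S b) @ subst T S) (p @ u @ q) y"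
      using s Box x by simp
    then show ?thesis using s x IH Box by (simp add: ev_shift_append[OF g x(2)] ev_Box)
  next
    case Cup
    then have "ev I (subst (s # T) S) x y = ev I ((i, Cup) # subst T S) (p @ u @ q) y" using s x by simp
    also have "\<dots> = ev (\<lambda>b. ev I (S b)) ((i, Cup) # T) (p @ u @ q) y"
      using IH[of "[_, _]"] x(3) Cup by (simp add: ev_Cup[OF x(2)])
    finally show ?thesis using s x Cup by simp
  next
    case Cap
    then have "ev I (subst (s # T) S) x y = ev I ((i, Cap) # subst T S) (p @ u @ q) y" using s x by simp
    also have "\<dots> = ev (\<lambda>b. ev I (S b)) ((i, Cap) # T) (p @ u @ q) y"
      using IH[of "[]"] x(3) Cap by (auto simp: numeral_2_eq_2 length_Suc_conv ev_Cap[OF x(2)])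
    finally show ?thesis using s x Cap by simp
  qed
qed simp

lemma cups_0 [simp]: "cups i 0 = []" and caps_0 [simp]: "caps i 0 = []"
  by (simp_all add: cups_def caps_def)

lemma cups_Suc: "cups i (Suc k) = (i, Cup) # cups (Suc i) k"
  by (simp add: cups_def upt_conv_Cons map_Suc_upt[symmetric] del: upt_Suc)

lemma caps_Suc: "caps i (Suc k) = caps (Suc i) k @ [(i, Cap)]"
  by (simp add: caps_def upt_conv_Cons map_Suc_upt[symmetric] rev_map del: upt_Suc)

lemma shift_cups: "shift h (cups i k) = cups (h + i) k"
  and shift_caps: "shift h (caps i k) = caps (h + i) k"
  by (auto simp: shift_def cups_def caps_def)

lemma goes_cups: "i \<le> m \<Longrightarrow> goes m (cups i k @ w) n \<longleftrightarrow> goes (m + 2 * k) w n"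
  by (induction k arbitrary: i m) (auto simp: cups_Suc)

lemma goes_caps: "i + 2 * k \<le> m \<Longrightarrow> goes m (caps i k @ w) n \<longleftrightarrow> goes (m - 2 * k) w n"
  by (induction k arbitrary: i w) (auto simp: caps_Suc)

lemma goes_caps_le: "goes m (caps i k @ w) n \<Longrightarrow> 0 < k \<Longrightarrow> i + 2 * k \<le> m"
proof (induction k arbitrary: i w)
  case (Suc k)
  show ?case
  proof (cases "k = 0")
    case False
    then have "Suc i + 2 * k \<le> m" using Suc.IH[of "Suc i" "(i, Cap) # w"] Suc.prems by (simp add: caps_Suc)
    then show ?thesis using Suc.prems goes_caps[of "Suc i" k m "(i, Cap) # w" n]
      by (auto simp: caps_Suc)
  qed (use Suc.prems in \<open>simp add: caps_Suc\<close>)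
qed simp

lemma ev_cups:
  assumes "length p = i"
  shows "ev I (cups i k @ v) (p @ q) y = (\<Sum>t\<in>colourings k. ev I v (p @ t @ rev t @ q) y)"
  using assms
proof (induction k arbitrary: i p q)
  case (Suc k)
  have "ev I (cups (Suc i) k @ v) (p @ c # c # q) y
     = (\<Sum>t\<in>colourings k. ev I v (p @ c # t @ rev t @ c # q) y)" for c
    using Suc.IH[of "p @ [c]" "Suc i" "c # q"] Suc.prems by simp
  then show ?case using Suc.prems by (simp add: cups_Suc ev_Cup sum_colourings_Suc)
qed simp

lemma ev_caps:
  assumes "length p = i" "length t = k" "length t' = k"
  shows "ev I (caps i k @ v) (p @ t @ t' @ q) y = of_bool (t' = rev t) * ev I v (p @ q) y"
  using assms
proof (induction k arbitrary: i p q t t' v)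
  case (Suc k)
  obtain c s where t: "t = c # s" using Suc.prems by (cases t) auto
  obtain d s' where t': "t' = s' @ [d]" using Suc.prems by (cases t' rule: rev_cases) auto
  show ?case using Suc.IH[of "p @ [c]" "Suc i" s s' "(i, Cap) # v" "d # q"] Suc.prems t t'
    by (auto simp: caps_Suc ev_Cap)
qed simp

text \<open>Conjugating by nested arcs transposes a box along the antidiagonal, whichever way it turns; this
  is the invariance under a full turn.\<close>

lemma ev_move:
  fixes l r :: "'a diagram"
  assumes "move l r" "goes m l n" "length x = m"
  shows "ev I (l @ v) x y = ev I (r @ v) x y"
  using assms
proof (induction rule: move.induct)
  case (exchange i a j b)
  then have le: "i + ins a \<le> j" "j + ins b \<le> length x" by auto
  obtain p u z where x: "x = p @ u @ z" "length p = i" "length u = ins a"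
    using le split_colouring[of i "ins a" x] by auto
  have "(j - i - ins a) + ins b \<le> length z" using x le by simp
  then obtain q u' q' where z: "z = q @ u' @ q'" "length q = j - i - ins a" "length u' = ins b"
    by (auto elim: split_colouring)
  have "ev I ([(j, b), (i, a)] @ v) x y = ev I ((j, b) # (i, a) # v) ((p @ u @ q) @ u' @ q') y"
    using x z by simp
  also have "\<dots> = (\<Sum>t'\<in>colourings (outs b). piece_weight I b u' t' *
       ev I ((i, a) # v) ((p @ u @ q) @ t' @ q') y)"
    by (rule ev_piece) (use x z le in auto)
  also have "\<dots> = (\<Sum>t'\<in>colourings (outs b). \<Sum>t\<in>colourings (outs a).
     piece_weight I b u' t' * piece_weight I a u t * ev I v (p @ t @ q @ t' @ q') y)"
    using x by (simp add: ev_piece sum_distrib_left mult.assoc)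
  also have "\<dots> = (\<Sum>t\<in>colourings (outs a). \<Sum>t'\<in>colourings (outs b).
     piece_weight I b u' t' * piece_weight I a u t * ev I v (p @ t @ q @ t' @ q') y)"
    by (rule sum.swap)
  also have "\<dots> = (\<Sum>t\<in>colourings (outs a). piece_weight I a u t *
     ev I ((j - ins a + outs a, b) # v) ((p @ t @ q) @ u' @ q') y)"
    by (rule sum.cong[OF refl], subst ev_piece)
      (use x z le in \<open>auto simp: sum_distrib_left mult_ac\<close>)
  also have "\<dots> = ev I ((i, a) # (j - ins a + outs a, b) # v) (p @ u @ q @ u' @ q') y"
    using x by (simp add: ev_piece)
  finally show ?case using x z by simp
next
  case (straighten_left i)
  then have "i + 1 \<le> length x" by auto
  then obtain p u q where x: "x = p @ u @ q" "length p = i" "length u = 1" by (rule split_colouring)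
  then obtain c where u: "u = [c]" by (cases u) auto
  have "ev I ((Suc i, Cap) # v) (p @ d # d # c # q) y = of_bool (d = c) * ev I v (p @ d # q) y" for d
    using ev_Cap[where p = "p @ [d]" and c = d and d = c and i = "Suc i" and I = I and w = v] x by simp
  then show ?case using x u by (simp add: ev_Cup UNIV_bool)
next
  case (straighten_right i)
  then have "i + 1 \<le> length x" by auto
  then obtain p u q where x: "x = p @ u @ q" "length p = i" "length u = 1" by (rule split_colouring)
  then obtain c where u: "u = [c]" by (cases u) auto
  have "ev I ((Suc i, Cup) # w) (p @ c # q) y = (\<Sum>d\<in>UNIV. ev I w (p @ c # d # d # q) y)" for w
    using ev_Cup[of "p @ [c]" "Suc i" I w q] x by simp
  then show ?case using x u by (simp add: ev_Cap UNIV_bool)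
next
  case (full_turn i k b)
  have "i + k \<le> m"
  proof (cases "k = 0")
    case False
    then have "i \<le> m" using full_turn(1) by (cases k) (auto simp: cups_Suc)
    then have "goes (m + 2 * k) (caps (i + k) k @ [] :: 'a diagram) n" using full_turn(1) by
        (auto simp: goes_cups mult_2 add_ac)
    from goes_caps_le[OF this] False show ?thesis by simp
  qed (use full_turn(1) in simp)
  then obtain p a q where x: "x = p @ a @ q" "length p = i" "length a = k"
    using full_turn by (auto elim: split_colouring)
  have L: "ev I ((i + k, Box k b) # caps (i + k) k @ v) (p @ t @ rev t @ a @ q) y
     = I b (rev t) (rev a) * ev I v (p @ t @ q) y" if "length t = k" for t
  proof -
    have "ev I ((i + k, Box k b) # caps (i + k) k @ v) ((p @ t) @ rev t @ a @ q) y
      = (\<Sum>s\<in>colourings k. I b (rev t) s * ev I (caps (i + k) k @ v) ((p @ t) @ s @ a @ q) y)"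
      by (rule ev_Box) (use x that in auto)
    also have "\<dots> = (\<Sum>s\<in>colourings k. of_bool (s = rev a) * (I b (rev t) s * ev I v (p @ t @ q) y))"
      by (rule sum.cong[OF refl], subst ev_caps) (use x that in \<open>auto simp: rev_swap\<close>)
    finally show ?thesis using x by (simp add: sum_colourings_delta)
  qed
  have R: "ev I ((i + k, Box k b) # caps i k @ v) (p @ a @ t @ rev t @ q) y
     = I b t (rev a) * ev I v (p @ rev t @ q) y" if "length t = k" for t
  proof -
    have "ev I ((i + k, Box k b) # caps i k @ v) ((p @ a) @ t @ rev t @ q) y
      = (\<Sum>s\<in>colourings k. I b t s * ev I (caps i k @ v) (p @ a @ s @ rev t @ q) y)"
      by (subst ev_Box) (use x that in auto)
    also have "\<dots> = (\<Sum>s\<in>colourings k. of_bool (s = rev a) * (I b t s * ev I v (p @ rev t @ q) y))"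
      by (rule sum.cong[OF refl], subst ev_caps) (use x that in \<open>auto simp: rev_swap\<close>)
    finally show ?thesis using x by (simp add: sum_colourings_delta)
  qed
  have "ev I ((cups i k @ [(i + k, Box k b)] @ caps (i + k) k) @ v) x y
    = (\<Sum>t\<in>colourings k. I b (rev t) (rev a) * ev I v (p @ t @ q) y)"
    using x L by (simp add: ev_cups)
  also have "\<dots> = (\<Sum>t\<in>colourings k. I b t (rev a) * ev I v (p @ rev t @ q) y)"
    using sum_colourings_rev[where f = "\<lambda>t. I b t (rev a) * ev I v (p @ rev t @ q) y"] by simp
  also have "\<dots> = ev I (cups (i + k) k @ [(i + k, Box k b)] @ caps i k @ v) ((p @ a) @ q) y"
    using x R ev_cups[where p = "p @ a" and i = "i + k" and k = k and q = q and I = I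
        and v = "[(i + k, Box k b)] @ caps i k @ v"] by simp
  finally show ?case using x by simp
qed

lemma ev_move_in:
  assumes "move_in m n w w'" "length x = m"
  shows "ev I w x y = ev I w' x y"
proof -
  obtain u v l r where w: "w = u @ l @ v" "w' = u @ r @ v" "move l r" "goes m w n" "goes m w' n"
    using assms by (auto simp: move_in_def)
  then obtain j j' where j: "goes m u j" "goes j l j'" by (auto simp: goes_append)
  show ?thesis unfolding w ev_append[OF j(1) assms(2)]
    by (intro sum.cong refl arg_cong2[where f = "(*)"] ev_move[OF w(3) j(2)]) auto
qed

lemma ev_isotopic:
  assumes "isotopic m n w w'" "length x = m"
  shows "ev I w x y = ev I w' x y"
  using assms(1) unfolding isotopic_def
proof (induction rule: equivclp_induct)
  case (step w' w'')
  then show ?case using ev_move_in[OF _ assms(2)] by metis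
qed simp

lemma labels_Nil [simp]: "labels [] = []"
  and labels_Cup [simp]: "labels ((i, Cup) # w) = labels w"
  and labels_Cap [simp]: "labels ((i, Cap) # w) = labels w"
  and labels_Box [simp]: "labels ((i, Box k b) # w) = b # labels w"
  and labels_append: "labels (u @ v) = labels u @ labels v"
  by (simp_all add: labels_def)

lemma set_labels: "b \<in> set (labels w) \<longleftrightarrow> (\<exists>i k. (i, Box k b) \<in> set w)"
proof (induction w)
  case (Cons s w)
  then show ?case by (cases s; cases "snd s") auto
qed simp

lemma labels_memI: "(i, Box k b) \<in> set w \<Longrightarrow> b \<in> set (labels w)"
  using set_labels by fast

lemma set_boxes: "(b, j, t) \<in> set (boxes s w) \<longleftrightarrow> (\<exists>i. (i, Box j b) \<in> set w \<and> t = shade_at s i)"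
proof (induction w)
  case Nil
  then show ?case by (simp add: boxes_def)
next
  case (Cons p w)
  then show ?case by (cases p; cases "snd p") (auto simp: boxes_def)
qed

lemma sum_PiE_insert:
  assumes "b \<notin> B"
  shows "(\<Sum>D\<in>PiE (insert b B) K. g D) = (\<Sum>d\<in>K b. \<Sum>D\<in>PiE B K. g (D(b := d)))"
  unfolding PiE_insert_eq sum.reindex[OF inj_combinator[OF assms]]
  by (simp add: sum.cartesian_product case_prod_beta)

text \<open>Linearity in each box, in the form in which tangles act on the free planar algebra: as an expansion
  over all choices of basis elements for the boxes.\<close>

lemma ev_multilinear:
  assumes "distinct (labels T)"
  shows "ev (\<lambda>b u t. \<Sum>d\<in>K b. c b d * J d u t) T x y
    = (\<Sum>D\<in>PiE (set (labels T)) K. (\<Prod>b\<in>set (labels T). c b (D b)) * ev (\<lambda>b. J (D b)) T x y)"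
  using assms
proof (induction T arbitrary: x)
  case (Cons s T)
  obtain i a where s: "s = (i, a)" by force
  show ?case
  proof (cases a)
    case (Box k b)
    have b: "b \<notin> set (labels T)" and d: "distinct (labels T)" using Cons.prems s Box by auto
    define p u q where "p = take i x" and "u = take k (drop i x)" and "q = drop (i + k) x"
    have ev: "ev I (s # T) x y = (\<Sum>t\<in>colourings k. I b u t * ev I T (p @ t @ q) y)" for I
      by (simp add: s Box ev.simps p_def u_def q_def)
    have upd: "ev (\<lambda>b'. J ((D(b := d)) b')) T z y = ev (\<lambda>b'. J (D b')) T z y" for D d z
    proof -
      have "ev (\<lambda>b'. J ((D(b := d)) b')) w z y = ev (\<lambda>b'. J (D b')) w z y"
        if "b \<notin> set (labels w)" for w using that
      proof (induction w arbitrary: z)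
        case (Cons r w)
        obtain h f where r: "r = (h, f)" by force
        show ?case using Cons by (cases f) (auto simp: r ev.simps intro!: sum.cong)
      qed simp
      then show ?thesis using b by blast
    qed
    have pr: "(\<Prod>b'\<in>set (labels T). c b' ((D(b := d)) b')) = (\<Prod>b'\<in>set (labels T). c b' (D b'))" for D d
      using b by (intro prod.cong) auto
    let ?c = "\<lambda>D. \<Prod>b'\<in>set (labels T). c b' (D b')" and ?e = "\<lambda>D t. ev (\<lambda>b'. J (D b')) T (p @ t @ q) y"
    have "(\<Sum>D\<in>PiE (set (labels (s # T))) K. (\<Prod>b'\<in>set (labels (s # T)). c b' (D b')) * ev (\<lambda>b'. J (D b'))
        (s # T) x y)
      = (\<Sum>d\<in>K b. \<Sum>D\<in>PiE (set (labels T)) K. c b d * ?c D * (\<Sum>t\<in>colourings k. J d u t * ?e D t))"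
      using b by (simp add: s Box sum_PiE_insert pr ev[unfolded s Box] upd del: fun_upd_apply) simp
    also have "\<dots> = (\<Sum>t\<in>colourings k. \<Sum>d\<in>K b. \<Sum>D\<in>PiE (set (labels T)) K. c b d * J d u t * (?c D * ?e D t))"
      by (simp add: sum_distrib_left sum.swap[of _ "colourings k"] mult_ac)
    also have "\<dots> = (\<Sum>t\<in>colourings k. (\<Sum>d\<in>K b. c b d * J d u t) * (\<Sum>D\<in>PiE (set (labels T)) K. ?c D * ?e D t))"
      by (simp add: sum_product)
    finally show ?thesis unfolding ev Cons.IH[OF d] by simp
  qed (use Cons s in \<open>auto simp: ev.simps sum_distrib_left mult_ac sum.swap[of _ "colourings _"]
        simp del: sum_mult_of_bool_eq sum_of_bool_mult_eq\<close>)
qed simp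

lemma reflect_Nil [simp]: "reflect [] = []"
  and reflect_Cup: "reflect ((i, Cup) # w) = reflect w @ [(i, Cap)]"
  and reflect_Cap: "reflect ((i, Cap) # w) = reflect w @ [(i, Cup)]"
  and reflect_Box: "reflect ((i, Box k b) # w) = reflect w @ [(i, Box k b)]"
  by (simp_all add: reflect_def)

lemma goes_reflect: "goes m w n \<Longrightarrow> goes n (reflect w) m"
proof (induction m w n rule: goes.induct)
  case (2 m i a w n)
  then show ?case by (cases a) (auto simp: reflect_Cup reflect_Cap reflect_Box goes_append)
qed simp

lemma labels_reflect: "labels (reflect w) = rev (labels w)"
proof (induction w)
  case (Cons s w)
  then show ?case by (cases s; cases "snd s") (auto simp: reflect_Cup reflect_Cap reflect_Box labels_append)
qed simp

lemma mem_reflect: "(i, Box j b) \<in> set (reflect w) \<longleftrightarrow> (i, Box j b) \<in> set w"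
  by (force simp: reflect_def image_iff split: piece.splits)

lemma ev_slice:
  assumes "i + ins a \<le> length x" "length z = length x - ins a + outs a"
  shows "ev I [(i, a)] x z = of_bool (take i x = take i z \<and> drop (i + ins a) x = drop (i + outs a) z)
     * piece_weight I a (take (ins a) (drop i x)) (take (outs a) (drop i z))"
proof -
  obtain p u q where x: "x = p @ u @ q" "length p = i" "length u = ins a"
    using assms by (auto elim: split_colouring)
  obtain p' t' q' where z: "z = p' @ t' @ q'" "length p' = i" "length t' = outs a"
    using assms x split_colouring[of i "outs a" z] by auto
  have "of_bool (p @ t @ q = z) = (of_bool (t = t') * of_bool (p = p' \<and> q = q') :: complex)"
    if "t \<in> colourings (outs a)" for t using z x that by auto
  then have "ev I [(i, a)] (p @ u @ q) z = (\<Sum>t\<in>colourings (outs a).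
       of_bool (t = t') * (of_bool (p = p' \<and> q = q') * piece_weight I a u t))"
    by (subst ev_piece) (use x in \<open>auto intro: sum.cong\<close>)
  then show ?thesis using x z by (simp add: sum_colourings_delta)
qed

text \<open>Cups and caps have the same weight read in opposite directions, so reflection becomes the adjoint of
  matrices.\<close>

lemma ev_reflect:
  assumes "goes m w n" "length x = m" "length y = n"
  shows "ev (\<lambda>b u t. cnj (I b t u)) (reflect w) y x = cnj (ev I w x y)"
  using assms
proof (induction m w n arbitrary: x rule: goes.induct)
  case (2 m i a w n)
  let ?J = "\<lambda>b u t. cnj (I b t u)"
  define a' where "a' = (case a of Cup \<Rightarrow> Cap | Cap \<Rightarrow> Cup | Box k b \<Rightarrow> Box k b)"
  have a': "ins a' = outs a" "outs a' = ins a" "piece_weight ?J a' u t = cnj (piece_weight I a t u)" for u t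
    by (cases a; simp add: a'_def)+
  have r: "reflect ((i, a) # w) = reflect w @ [(i, a')]" by (simp add: reflect_def a'_def)
  let ?l = "m - ins a + outs a"
  have g: "goes m [(i, a)] ?l" "goes ?l w n" and le: "i + ins a \<le> m" using "2.prems"(1) by auto
  have "ev ?J (reflect w @ [(i, a')]) y x = (\<Sum>z\<in>colourings ?l. ev ?J (reflect w) y z * ev ?J [(i, a')] z x)"
    by (rule ev_append[OF goes_reflect[OF g(2)]]) (use 2 in auto)
  also have "\<dots> = (\<Sum>z\<in>colourings ?l. cnj (ev I w z y) * cnj (ev I [(i, a)] x z))"
  proof (intro sum.cong refl arg_cong2[where f = "(*)"])
    fix z :: "bool list" assume z: "z \<in> colourings ?l"
    show "ev ?J (reflect w) y z = cnj (ev I w z y)" using 2(1)[of z] g z "2.prems" by simp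
    show "ev ?J [(i, a')] z x = cnj (ev I [(i, a)] x z)"
      using z le "2.prems" by (subst (1 2) ev_slice) (auto simp: a')
  qed
  also have "\<dots> = cnj (\<Sum>z\<in>colourings ?l. ev I [(i, a)] x z * ev I w z y)" by (simp add: mult.commute)
  also have "\<dots> = cnj (ev I ((i, a) # w) x y)"
    using ev_append[OF g(1), of x I w y] "2.prems" by simp
  finally show ?case unfolding r .
qed auto

text \<open>Strands are charged \<open>\<plusminus>1\<close> by colour, and their charges count with alternating signs because adjacent
  strands are oppositely oriented. A cup or a cap joins opposite orientations, so it is neutral.\<close>

fun degree :: "bool list \<Rightarrow> int" where
  "degree [] = 0"
| "degree (c # x) = (if c then 1 else - 1) - degree x"

lemma degree_append: "degree (x @ y) = degree x + (- 1) ^ length x * degree y"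
  by (induction x) auto

lemma ev_degree:
  assumes "\<And>i j b u t. (i, Box j b) \<in> set w \<Longrightarrow> length u = j \<Longrightarrow> length t = j \<Longrightarrow> I b u t \<noteq> 0 \<Longrightarrow> degree u = degree t"
    and "goes m w n" "length x = m" "ev I w x y \<noteq> 0"
  shows "degree x = degree y"
  using assms
proof (induction w arbitrary: m x)
  case (Cons s w)
  obtain i a where s: "s = (i, a)" by force
  obtain p u q where x: "x = p @ u @ q" "length p = i" "length u = ins a"
    using Cons.prems(2,3) s by (auto elim: split_colouring)
  have "(\<Sum>t\<in>colourings (outs a). piece_weight I a u t * ev I w (p @ t @ q) y) \<noteq> 0"
    using Cons.prems(4) unfolding s x(1) ev_piece[OF x(2,3)] .
  then obtain t where t: "length t = outs a" "piece_weight I a u t \<noteq> 0" "ev I w (p @ t @ q) y \<noteq> 0"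
    by (metis (no_types, lifting) mem_colourings mult_eq_0_iff sum.neutral)
  have "degree (p @ t @ q) = degree y"
  proof (rule Cons.IH)
    show "goes (m - ins a + outs a) w n" using Cons.prems(2) unfolding s by (simp only: goes.simps)
    show "length (p @ t @ q) = m - ins a + outs a" using Cons.prems(3) t x by simp
    show "degree u = degree t" if "(i', Box j b) \<in> set w" "length u = j" "length t = j" "I b u t \<noteq> 0"
        for i' j b u t
      by (rule Cons.prems(1)[of i' j]) (use that in auto)
  qed fact
  moreover have "degree (u @ q) = degree (t @ q)"
  proof (cases a)
    case (Box k b)
    then have "degree u = degree t" using Cons.prems(1)[of i k b u t] t x s by simp
    then show ?thesis using t x Box by (simp add: degree_append)
  qed (use t x in \<open>auto split: if_splits\<close>)
  ultimately show ?case using x by (simp add: degree_append)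
qed auto


section \<open>Isotopy and substitution\<close>

lemma isotopic_refl [simp]: "isotopic m n w w"
  by (simp add: isotopic_def)

lemma isotopic_sym: "isotopic m n w w' \<Longrightarrow> isotopic m n w' w"
  unfolding isotopic_def by (rule equivclp_sym)

lemma isotopic_trans: "isotopic m n w w' \<Longrightarrow> isotopic m n w' w'' \<Longrightarrow> isotopic m n w w''"
  unfolding isotopic_def by (rule equivclp_trans)

lemma isotopic_goes: "isotopic m n w w' \<Longrightarrow> goes m w n \<longleftrightarrow> goes m w' n"
  unfolding isotopic_def
  by (induction rule: equivclp_induct) (auto simp: move_in_def)

lemma move_shift: "move l r \<Longrightarrow> move (shift h l) (shift h r)"
proof (induction rule: move.induct)
  case (exchange i a j b)
  then show ?case using move.exchange[of "h + i" a "h + j" b] by (simp add: add.assoc)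
next
  case (full_turn i k b)
  then show ?case using move.full_turn[of "h + i" k b]
    by (simp add: shift_append shift_cups shift_caps add.assoc)
qed (use move.straighten_left[of "h + _"] move.straighten_right[of "h + _"] in auto)

lemma goes_context:
  assumes "goes a u (i + m + r)" "goes m w n" "goes (i + n + r) v b"
  shows "goes a (u @ shift i w @ v) b"
  using assms goes_shift_append[of m w n i r v b] by (auto simp: goes_append[of a u])

lemma isotopic_context:
  assumes "isotopic m n w w'" "goes a u (i + m + r)" "goes (i + n + r) v b"
  shows "isotopic a b (u @ shift i w @ v) (u @ shift i w' @ v)"
proof -
  have step_move: "move_in a b (u @ shift i w @ v) (u @ shift i w' @ v)" if "move_in m n w w'" for w w'
  proof -
    obtain p q l r where w: "w = p @ l @ q" "w' = p @ r @ q" "move l r" "goes m w n" "goes m w' n"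
      using \<open>move_in m n w w'\<close> by (auto simp: move_in_def)
    have "u @ shift i w @ v = (u @ shift i p) @ shift i l @ (shift i q @ v) \<and>
        u @ shift i w' @ v = (u @ shift i p) @ shift i r @ (shift i q @ v) \<and> move (shift i l) (shift i r)"
      using w by (simp add: shift_append move_shift)
    then have "\<exists>p l r q. u @ shift i w @ v = p @ l @ q \<and> u @ shift i w' @ v = p @ r @ q \<and> move l r" by blast
    then show ?thesis using goes_context[OF assms(2) w(4) assms(3)] goes_context[OF assms(2) w(5) assms(3)]
      unfolding move_in_def by blast
  qed
  show ?thesis using assms(1) unfolding isotopic_def
  proof (induction rule: equivclp_induct)
    case (step y z)
    then have "equivclp (move_in a b) (u @ shift i y @ v) (u @ shift i z @ v)"
      using step_move by (blast intro: r_into_equivclp converse_r_into_equivclp)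
    then show ?case using step.IH by (rule equivclp_trans[rotated])
  qed simp
qed

text \<open>Tangles act on isotopy classes through representatives; by this lemma the choice of the
  representatives does not matter.\<close>

lemma isotopic_subst:
  assumes "\<And>i j b. (i, Box j b) \<in> set T \<Longrightarrow> goes j (S b) j \<and> isotopic j j (S b) (S' b)"
    and "goes m T n" "goes a u m"
  shows "isotopic a n (u @ subst T S) (u @ subst T S')"
  using assms
proof (induction T arbitrary: m u)
  case (Cons s T)
  obtain i a' where s: "s = (i, a')" by force
  show ?case
  proof (cases a')
    case (Box k b)
    have b: "goes k (S b) k" "isotopic k k (S b) (S' b)" using Cons.prems(1)[of i k b] s Box by auto
    obtain r where m: "m = i + k + r" using Cons.prems(2) s Box
      by (metis goes.simps(2) ins.simps(3) le_iff_add)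
    have T: "goes m T n" using Cons.prems(2) s Box by auto
    have "goes m (subst T S) n"
      by (rule goes_subst[OF _ T]) (use Cons.prems(1) in auto)
    then have "isotopic a n (u @ shift i (S b) @ subst T S) (u @ shift i (S' b) @ subst T S)"
      using b Cons.prems(3) m by (intro isotopic_context) auto
    moreover have "isotopic a n ((u @ shift i (S' b)) @ subst T S) ((u @ shift i (S' b)) @ subst T S')"
    proof (rule Cons.IH[OF _ T])
      show "goes a (u @ shift i (S' b)) m"
        using goes_context[of a u i k r "S' b" k "[]" m] b Cons.prems(3) m isotopic_goes by auto
    qed (use Cons.prems(1) in auto)
    ultimately show ?thesis using s Box isotopic_trans by fastforce
  next
    case Cup
    show ?thesis using Cons.IH[of "m + 2" "u @ [(i, Cup)]"] Cons.prems s Cup by (auto simp: goes_append)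
  next
    case Cap
    show ?thesis using Cons.IH[of "m - 2" "u @ [(i, Cap)]"] Cons.prems s Cap by (auto simp: goes_append)
  qed
qed simp


section \<open>Labelled diagrams\<close>

text \<open>All generators have type \<open>(1, Unshaded)\<close>; whether the boxes of a diagram fit depends on the shading of
  the leftmost region.\<close>

definition boxes_fit :: "shade \<Rightarrow> 'b diagram \<Rightarrow> bool" where
  "boxes_fit s w \<longleftrightarrow> (\<forall>i j g. (i, Box j g) \<in> set w \<longrightarrow> j = 1 \<and> shade_at s i = Unshaded)"

definition fitting :: "nat \<Rightarrow> shade \<Rightarrow> 'g diagram \<Rightarrow> bool" where
  "fitting = labelled (\<lambda>_. (1, Unshaded))"

lemma fitting_iff: "fitting k s w \<longleftrightarrow> goes k w k \<and> boxes_fit s w"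
  unfolding fitting_def labelled_def boxes_fit_def by (fastforce simp: set_boxes)

lemma boxes_fit_append [simp]: "boxes_fit s (u @ v) \<longleftrightarrow> boxes_fit s u \<and> boxes_fit s v"
  unfolding boxes_fit_def set_append Un_iff by blast

lemma boxes_fit_simps [simp]: "boxes_fit s []"
  "boxes_fit s ((i, Cup) # w) \<longleftrightarrow> boxes_fit s w"
  "boxes_fit s ((i, Cap) # w) \<longleftrightarrow> boxes_fit s w"
  "boxes_fit s ((i, Box k b) # w) \<longleftrightarrow> k = 1 \<and> shade_at s i = Unshaded \<and> boxes_fit s w"
  by (auto simp: boxes_fit_def)

lemma shade_at_add: "shade_at s (i + j) = shade_at (shade_at s i) j"
  by (cases s) (auto simp: shade_at_def)

lemma shade_at_0 [simp]: "shade_at s 0 = s"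
  by (simp add: shade_at_def)

lemma shade_at_Suc: "shade_at s (Suc i) = opp (shade_at s i)"
  by (cases s) (auto simp: shade_at_def)

lemma opp_opp [simp]: "opp (opp s) = s"
  by (cases s) auto

lemma boxes_fit_shift: "boxes_fit s (shift i w) \<longleftrightarrow> boxes_fit (shade_at s i) w"
proof (induction w)
  case (Cons p w)
  then show ?case by (cases p; cases "snd p") (auto simp: shade_at_add)
qed simp

text \<open>A move changes the number of strands to the left of a box by an even number, so it preserves the
  shading there.\<close>

lemma boxes_fit_move: "move l r \<Longrightarrow> boxes_fit s l \<longleftrightarrow> boxes_fit s r"
proof (induction rule: move.induct)
  case (exchange i a j b)
  have "even (ins a + outs a)" by (cases a) auto
  with exchange have "even (j - ins a + outs a) = even j" by auto
  then show ?case by (cases a; cases b) (auto simp: shade_at_def)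
next
  case (full_turn i k b)
  have "boxes_fit s (cups i k)" "boxes_fit s (caps i k)" for i k
    by (auto simp: boxes_fit_def cups_def caps_def)
  then show ?case by auto
qed auto

lemma fitting_isotopic: "isotopic k k w w' \<Longrightarrow> fitting k s w \<longleftrightarrow> fitting k s w'"
  unfolding isotopic_def
proof (induction rule: equivclp_induct)
  case (step y z)
  have "fitting k s w \<longleftrightarrow> fitting k s w'" if "move_in k k w w'" for w w' :: "'a diagram"
    using that by (auto simp: move_in_def fitting_iff boxes_fit_move)
  with step show ?case by blast
qed simp

lemma boxes_fit_subst:
  assumes "\<And>i j b. (i, Box j b) \<in> set T \<Longrightarrow> boxes_fit (shade_at s i) (S b)"
  shows "boxes_fit s (subst T S)"
  using assms
proof (induction T)
  case (Cons p T)
  then have "boxes_fit s (subst T S)" by (metis list.set_intros(2))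
  then show ?case using Cons.prems[of "fst p"] by (cases p; cases "snd p") (auto simp: boxes_fit_shift)
qed simp

lemma ltangle_eq_iff: "ltangle k s w = ltangle k' s' w' \<longleftrightarrow> k = k' \<and> s = s' \<and> isotopic k k w w'"
  unfolding ltangle_def prod.inject set_eq_iff mem_Collect_eq
  using isotopic_refl isotopic_sym isotopic_trans by blast

lemma fst_ltangle [simp]: "fst (ltangle k s w) = k"
  by (simp add: ltangle_def)

lemma isotopic_rep: "isotopic k k w (rep (ltangle k s w))"
  unfolding rep_def ltangle_def by (rule someI2[of _ w]) auto

lemma fitting_rep: "fitting k s w \<Longrightarrow> fitting k s (rep (ltangle k s w))"
  using fitting_isotopic[OF isotopic_rep] by blast


section \<open>The free planar algebra\<close>

abbreviation basis_elt :: "nat \<Rightarrow> shade \<Rightarrow> 'g diagram \<Rightarrow> ('g ltangle \<Rightarrow>\<^sub>0 complex)" where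
  "basis_elt k s w \<equiv> Poly_Mapping.single (ltangle k s w) 1"

lemma scl_FA [simp]: "scl FA = pm_scale"
  and mem_Sp_FA: "f \<in> Sp FA k s \<longleftrightarrow> Poly_Mapping.keys f \<subseteq> ltangle k s ` {w. fitting k s w}"
  by (simp_all add: FA_def free_planar_def fitting_def)

interpretation pm: vector_space "pm_scale :: complex \<Rightarrow> ('a \<Rightarrow>\<^sub>0 complex) \<Rightarrow> _"
  by (rule vector_space_pm_scale)

lemma pm_scale_single [simp]: "pm_scale c (Poly_Mapping.single D d) = Poly_Mapping.single D (c * d)"
  by (rule poly_mapping_eqI) (simp add: lookup_pm_scale lookup_single when_def)

lemma subspace_Sp_FA: "pm.subspace (Sp FA k s)"
proof (rule pm.subspaceI)
  fix f g assume "f \<in> Sp FA k s" "g \<in> Sp FA k s"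
  then show "f + g \<in> Sp FA k s" using Poly_Mapping.keys_add[of f g] by (auto simp: mem_Sp_FA)
next
  fix c f assume "f \<in> Sp FA k s"
  moreover have "Poly_Mapping.keys (pm_scale c f) \<subseteq> Poly_Mapping.keys f"
    by (auto simp: in_keys_iff lookup_pm_scale)
  ultimately show "pm_scale c f \<in> Sp FA k s" by (auto simp: mem_Sp_FA)
qed (simp add: mem_Sp_FA)

lemma single_in_Sp_FA: "fitting k s w \<Longrightarrow> Poly_Mapping.single (ltangle k s w) c \<in> Sp FA k s"
  by (auto simp: mem_Sp_FA)

lemma mem_Sp_FA_keys:
  assumes "f \<in> Sp FA k s" "D \<in> Poly_Mapping.keys f"
  shows "fitting k s (rep D)" "D = ltangle k s (rep D)"
proof -
  obtain w where "fitting k s w" "D = ltangle k s w" using assms by (auto simp: mem_Sp_FA)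
  then show "fitting k s (rep D)" "D = ltangle k s (rep D)"
    using fitting_rep isotopic_rep[of k w s] by (auto simp: ltangle_eq_iff)
qed

text \<open>The action is defined by a sum over the supports of the inputs. Sums over larger sets that are common
  to several inputs make its linearity visible.\<close>

lemma Act_FA_expand:
  assumes "\<And>b. b \<in> set (labels T) \<Longrightarrow> finite (K b) \<and> Poly_Mapping.keys (x b) \<subseteq> K b"
  shows "Act FA k s T x = (\<Sum>D\<in>PiE (set (labels T)) K.
    Poly_Mapping.single (ltangle k s (subst T (\<lambda>b. rep (D b))))
      (\<Prod>b\<in>set (labels T). Poly_Mapping.lookup (x b) (D b)))"
proof -
  have fin: "finite (PiE (set (labels T)) K)" using assms by (intro finite_PiE) auto
  have sub: "PiE (set (labels T)) (\<lambda>b. Poly_Mapping.keys (x b)) \<subseteq> PiE (set (labels T)) K"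
    using assms by (intro PiE_mono) auto
  have zero: "(\<Prod>b\<in>set (labels T). Poly_Mapping.lookup (x b) (D b)) = 0"
    if "D \<in> PiE (set (labels T)) K - PiE (set (labels T)) (\<lambda>b. Poly_Mapping.keys (x b))" for D
  proof -
    obtain b where "b \<in> set (labels T)" "D b \<notin> Poly_Mapping.keys (x b)" using \<open>D \<in> _\<close> by (auto simp: PiE_iff)
    then show ?thesis by (intro prod_zero) (auto simp: in_keys_iff)
  qed
  show ?thesis unfolding FA_def free_planar_def planar.simps
    by (rule sum.mono_neutral_left[OF fin sub]) (intro ballI, subst zero, auto)
qed

lemma Act_FA_cong: "(\<And>b. b \<in> set (labels T) \<Longrightarrow> x b = y b) \<Longrightarrow> Act FA k s T x = Act FA k s T y"
  unfolding FA_def free_planar_def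
  by (auto intro!: sum.cong prod.cong arg_cong2[where f = Poly_Mapping.single] PiE_cong)

lemma Act_FA_add:
  assumes "b \<in> set (labels T)"
  shows "Act FA k s T (x(b := u + v)) = Act FA k s T (x(b := u)) + Act FA k s T (x(b := v))"
proof -
  let ?K = "\<lambda>b'. if b' = b then Poly_Mapping.keys u \<union> Poly_Mapping.keys v else Poly_Mapping.keys (x b')"
  have E: "Act FA k s T (x(b := f)) = (\<Sum>D\<in>PiE (set (labels T)) ?K.
      Poly_Mapping.single (ltangle k s (subst T (\<lambda>b. rep (D b))))
        (Poly_Mapping.lookup f (D b) * (\<Prod>b'\<in>set (labels T) - {b}. Poly_Mapping.lookup (x b') (D b'))))"
    if "Poly_Mapping.keys f \<subseteq> Poly_Mapping.keys u \<union> Poly_Mapping.keys v" for f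
    by (subst Act_FA_expand[where K = ?K])
      (use that assms in \<open>auto intro!: sum.cong arg_cong2[where f = Poly_Mapping.single] prod.cong
         simp: prod.remove[OF _ assms]\<close>)
  show ?thesis using Poly_Mapping.keys_add[of u v]
    by (simp add: E lookup_add distrib_right single_add sum.distrib)
qed

lemma Act_FA_scale:
  assumes "b \<in> set (labels T)"
  shows "Act FA k s T (x(b := pm_scale c u)) = pm_scale c (Act FA k s T (x(b := u)))"
proof -
  let ?K = "\<lambda>b'. if b' = b then Poly_Mapping.keys u else Poly_Mapping.keys (x b')"
  have E: "Act FA k s T (x(b := f)) = (\<Sum>D\<in>PiE (set (labels T)) ?K.
      Poly_Mapping.single (ltangle k s (subst T (\<lambda>b. rep (D b))))
        (Poly_Mapping.lookup f (D b) * (\<Prod>b'\<in>set (labels T) - {b}. Poly_Mapping.lookup (x b') (D b'))))"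
    if "Poly_Mapping.keys f \<subseteq> Poly_Mapping.keys u" for f
    by (subst Act_FA_expand[where K = ?K])
      (use that assms in \<open>auto intro!: sum.cong arg_cong2[where f = Poly_Mapping.single] prod.cong
         simp: prod.remove[OF _ assms]\<close>)
  have "Poly_Mapping.keys (pm_scale c u) \<subseteq> Poly_Mapping.keys u" by (auto simp: in_keys_iff lookup_pm_scale)
  then show ?thesis by (simp add: E lookup_pm_scale pm.scale_sum_right mult.assoc)
qed

lemma single_one_inject: "Poly_Mapping.single d (1 :: complex) = Poly_Mapping.single d' 1 \<Longrightarrow> d = d'"
  by (metis lookup_single_eq lookup_single_not_eq zero_neq_one)

lemma Act_FA_basis:
  assumes "goes k T k"
    and "\<And>i j b. (i, Box j b) \<in> set T \<Longrightarrow> goes j (S b) j \<and> x b = basis_elt j (t b) (S b)"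
  shows "Act FA k s T x = basis_elt k s (subst T S)"
proof -
  define D where "D = (\<lambda>b\<in>set (labels T). SOME d. x b = Poly_Mapping.single d 1)"
  have D: "x b = Poly_Mapping.single (D b) 1 \<and> D b = ltangle j (t b) (S b)" if "(i, Box j b) \<in> set T" for i j b
  proof -
    have "b \<in> set (labels T)" using that by (rule labels_memI)
    then have Db: "D b = (SOME d. x b = Poly_Mapping.single d 1)" by (simp only: D_def restrict_apply if_True)
    have xb: "x b = basis_elt j (t b) (S b)" using assms(2) that by blast
    have "x b = Poly_Mapping.single (D b) 1" unfolding Db by (rule someI, rule xb)
    then show ?thesis using single_one_inject[OF trans[OF sym xb]] by blast
  qed
  have x: "x b = Poly_Mapping.single (D b) 1" if "b \<in> set (labels T)" for b
    using D that[unfolded set_labels] by metis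
  have "PiE (set (labels T)) (\<lambda>b. {D b}) = {D}" unfolding D_def
    by (auto simp: PiE_iff fun_eq_iff extensional_def)
  then have "Act FA k s T x = basis_elt k s (subst T (\<lambda>b. rep (D b)))"
    using x by (subst Act_FA_expand[where K = "\<lambda>b. {D b}"]) auto
  also have "\<dots> = basis_elt k s (subst T S)"
  proof -
    have "isotopic k k ([] @ subst T S) ([] @ subst T (\<lambda>b. rep (D b)))"
    proof (rule isotopic_subst[OF _ assms(1)])
      fix i j b assume "(i, Box j b) \<in> set T"
      then show "goes j (S b) j \<and> isotopic j j (S b) (rep (D b))"
        using D assms(2) isotopic_rep by metis
    qed simp
    then show ?thesis by (intro arg_cong2[where f = Poly_Mapping.single])
        (auto simp: ltangle_eq_iff intro: isotopic_sym)
  qed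
  finally show ?thesis .
qed


text \<open>The relators are explicit combinations of a few diagrams. Lists of terms avoid having to decide which
  of these diagrams are isotopic.\<close>

definition combination :: "nat \<Rightarrow> shade \<Rightarrow> (complex \<times> 'g diagram) list \<Rightarrow> ('g ltangle \<Rightarrow>\<^sub>0 complex)" where
  "combination k s G = (\<Sum>(c, w)\<leftarrow>G. Poly_Mapping.single (ltangle k s w) c)"

lemma combination_simps [simp]:
  "combination k s [] = 0"
  "combination k s ((c, w) # G) = Poly_Mapping.single (ltangle k s w) c + combination k s G"
  by (simp_all add: combination_def)

lemma combination_append: "combination k s (G @ H) = combination k s G + combination k s H"
  by (simp add: combination_def)

lemma Act_FA_combination:
  assumes "b \<in> set (labels T)"
  shows "Act FA k s T (x(b := combination j t G))
    = (\<Sum>(c, w)\<leftarrow>G. pm_scale c (Act FA k s T (x(b := basis_elt j t w))))"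
proof (induction G)
  case Nil
  then show ?case using Act_FA_scale[OF assms, of k s x 0 0] by (simp del: fun_upd_apply)
next
  case (Cons p G)
  obtain c w where "p = (c, w)" by force
  then show ?case using Cons Act_FA_scale[OF assms, of k s x c "basis_elt j t w"]
    by (simp add: Act_FA_add[OF assms] del: fun_upd_apply)
qed

lemma Act_FA_unary:
  assumes "goes k T k" "labels T = [0]" "(i, Box j 0) \<in> set T" "\<forall>(c, w)\<in>set G. goes j w j"
  shows "Act FA k s T ((!) [combination j t G]) = combination k s (map (\<lambda>(c, w). (c, subst T ((!) [w]))) G)"
proof -
  have un: "i' = i \<and> j' = j \<and> b = 0" if "(i', Box j' b) \<in> set T" for i' j' b
    using assms(2,3) that
  proof (induction T)
    case (Cons p T)
    then show ?case using set_labels[of _ T] by (cases p; cases "snd p") auto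
  qed simp
  have "Act FA k s T ((!) [combination j t G]) = Act FA k s T ((\<lambda>_. 0)(0 := combination j t G))"
    by (rule Act_FA_cong) (simp add: assms)
  also have "\<dots> = (\<Sum>(c, w)\<leftarrow>G. pm_scale c (Act FA k s T ((\<lambda>_. 0)(0 := basis_elt j t w))))"
    by (rule Act_FA_combination) (simp add: assms)
  also have "\<dots> = (\<Sum>(c, w)\<leftarrow>G. pm_scale c (basis_elt k s (subst T ((!) [w]))))"
  proof (intro arg_cong[of _ _ sum_list] map_cong refl, clarify)
    fix c w assume "(c, w) \<in> set G"
    then have "Act FA k s T ((\<lambda>_. 0)(0 := basis_elt j t w)) = basis_elt k s (subst T ((!) [w]))"
      using assms(4) by (intro Act_FA_basis[OF assms(1), where t = "\<lambda>_. t"]) (auto dest!: un)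
    then show "pm_scale c (Act FA k s T ((\<lambda>_. 0)(0 := basis_elt j t w)))
        = pm_scale c (basis_elt k s (subst T ((!) [w])))"
      by simp
  qed
  also have "\<dots> = combination k s (map (\<lambda>(c, w). (c, subst T ((!) [w]))) G)"
    by (induction G) auto
  finally show ?thesis .
qed

lemma Act_FA_binary:
  assumes "goes k T k" "set (labels T) = {0, 1}"
    "\<And>i j b. (i, Box j b) \<in> set T \<Longrightarrow> j = [j0, j1] ! b"
    "\<forall>(c, w)\<in>set G. goes j0 w j0" "\<forall>(c, w)\<in>set H. goes j1 w j1"
  shows "Act FA k s T ((!) [combination j0 t0 G, combination j1 t1 H])
    = combination k s (concat (map (\<lambda>(c, w). map (\<lambda>(d, v). (c * d, subst T ((!) [w, v]))) H) G))"
proof -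
  let ?x = "\<lambda>w v. (\<lambda>_. 0)(0 := basis_elt j0 t0 w, 1 := basis_elt j1 t1 v)"
  have un: "b = 0 \<and> j = j0 \<or> b = 1 \<and> j = j1" if "(i, Box j b) \<in> set T" for i j b
  proof -
    have "b \<in> {0, 1}" using labels_memI[OF that] assms(2) by simp
    then show ?thesis using assms(3)[OF that] by auto
  qed
  have b: "Act FA k s T (?x w v) = basis_elt k s (subst T ((!) [w, v]))"
    if "(c, w) \<in> set G" "(d, v) \<in> set H" for c d w v
    by (rule Act_FA_basis[OF assms(1), where t = "(!) [t0, t1]"])
      (use assms(4,5) that in \<open>auto dest!: un\<close>)
  have "Act FA k s T ((!) [combination j0 t0 G, combination j1 t1 H])
     = Act FA k s T ((\<lambda>_. 0)(1 := combination j1 t1 H, 0 := combination j0 t0 G))"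
    by (rule Act_FA_cong) (auto simp: assms)
  also have "\<dots> = (\<Sum>(c, w)\<leftarrow>G. pm_scale c (Act FA k s T ((\<lambda>_. 0)(1 := combination j1 t1 H, 0 := basis_elt j0
      t0 w))))"
    by (rule Act_FA_combination) (simp add: assms)
  also have "\<dots> = (\<Sum>(c, w)\<leftarrow>G. pm_scale c (Act FA k s T ((\<lambda>_. 0)(0 := basis_elt j0 t0 w, 1 := combination j1
      t1 H))))"
    by (simp add: fun_upd_twist)
  also have "\<dots> = (\<Sum>(c, w)\<leftarrow>G. pm_scale c (\<Sum>(d, v)\<leftarrow>H. pm_scale d (Act FA k s T (?x w v))))"
    by (subst Act_FA_combination) (simp_all add: assms)
  also have "\<dots> = (\<Sum>(c, w)\<leftarrow>G. pm_scale c (\<Sum>(d, v)\<leftarrow>H. pm_scale d (basis_elt k s (subst T ((!) [w, v])))))"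
    by (auto simp: b[unfolded One_nat_def] simp del: fun_upd_apply
      intro!: arg_cong[of _ _ sum_list] arg_cong2[where f = pm_scale])
  also have "\<dots> = combination k s (concat (map (\<lambda>(c, w). map (\<lambda>(d, v). (c * d, subst T ((!) [w, v]))) H) G))"
  proof (induction G)
    case (Cons p G)
    obtain c w where p: "p = (c, w)" by force
    have "pm_scale c (\<Sum>(d, v)\<leftarrow>H. pm_scale d (basis_elt k s (subst T ((!) [w, v]))))
       = combination k s (map (\<lambda>(d, v). (c * d, subst T ((!) [w, v]))) H)"
      by (induction H) (auto simp: pm.scale_right_distrib)
    then show ?case using Cons by (simp add: p combination_append)
  qed simp
  finally show ?thesis .
qed

lemma Act_FA_eq: "Act FA k s T x = (\<Sum>D\<in>(\<Pi>\<^sub>E b \<in> set (labels T). Poly_Mapping.keys (x b)).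
    Poly_Mapping.single (ltangle k s (subst T (\<lambda>b. rep (D b))))
      (\<Prod>b\<in>set (labels T). Poly_Mapping.lookup (x b) (D b)))"
  by (simp add: FA_def free_planar_def)

lemma Act_FA_closed:
  assumes "goes k T k" "fits FA s T x"
  shows "Act FA k s T x \<in> Sp FA k s"
proof -
  have "fitting k s (subst T (\<lambda>b. rep (D b)))"
    if "D \<in> PiE (set (labels T)) (\<lambda>b. Poly_Mapping.keys (x b))" for D
  proof -
    have "fitting j (shade_at s i) (rep (D b))" if "(i, Box j b) \<in> set T" for i j b
    proof -
      have "x b \<in> Sp FA j (shade_at s i)" using assms(2) that unfolding fits_def by (force simp: set_boxes)
      moreover have "D b \<in> Poly_Mapping.keys (x b)"
        using \<open>D \<in> _\<close> labels_memI[OF that] by (rule PiE_mem)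
      ultimately show ?thesis by (rule mem_Sp_FA_keys)
    qed
    then show ?thesis unfolding fitting_iff
      using goes_subst[OF _ assms(1)] boxes_fit_subst by (metis (no_types, lifting))
  qed
  then show ?thesis unfolding Act_FA_eq
    by (intro pm.subspace_sum[OF subspace_Sp_FA] single_in_Sp_FA)
qed


section \<open>Evaluating the free planar algebra\<close>

text \<open>The colour red is encoded by \<open>True\<close>.\<close>

definition red_weight :: "'g \<Rightarrow> cmat" where
  "red_weight g u t = of_bool (u = [True] \<and> t = [True])"

text \<open>The value is set to zero on colourings of other lengths: then the evaluation is linear on the whole
  ambient space, in which the box spaces of all types lie side by side.\<close>

definition ev_class :: "gen ltangle \<Rightarrow> cmat" where
  "ev_class D x y = (if length x = fst D \<and> length y = fst D then ev red_weight (rep D) x y else 0)"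

definition evF :: "(gen ltangle \<Rightarrow>\<^sub>0 complex) \<Rightarrow> cmat" where
  "evF f x y = (\<Sum>D\<in>Poly_Mapping.keys f. Poly_Mapping.lookup f D * ev_class D x y)"

lemma evF_expand:
  assumes "finite K" "Poly_Mapping.keys f \<subseteq> K"
  shows "evF f x y = (\<Sum>D\<in>K. Poly_Mapping.lookup f D * ev_class D x y)"
  unfolding evF_def by (rule sum.mono_neutral_left[OF assms]) (auto simp: in_keys_iff)

lemma evF_add: "evF (f + g) x y = evF f x y + evF g x y"
proof -
  let ?K = "Poly_Mapping.keys f \<union> Poly_Mapping.keys g"
  have "evF (f + g) x y = (\<Sum>D\<in>?K. Poly_Mapping.lookup (f + g) D * ev_class D x y)"
    by (rule evF_expand) (auto simp: Poly_Mapping.keys_add)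
  then show ?thesis by (simp add: evF_expand[of ?K] lookup_add distrib_right sum.distrib)
qed

lemma evF_scale: "evF (pm_scale c f) x y = c * evF f x y"
proof -
  have "evF (pm_scale c f) x y = (\<Sum>D\<in>Poly_Mapping.keys f. Poly_Mapping.lookup (pm_scale c f) D * ev_class
      D x y)"
    by (rule evF_expand) (auto simp: in_keys_iff lookup_pm_scale)
  then show ?thesis by (simp add: evF_def lookup_pm_scale sum_distrib_left mult.assoc)
qed

lemma evF_0 [simp]: "evF 0 x y = 0"
  by (simp add: evF_def)

lemma evF_minus: "evF (- f) x y = - evF f x y"
  using evF_add[of f "- f" x y] by (simp add: eq_neg_iff_add_eq_0 add.commute)

lemma evF_diff: "evF (f - g) x y = evF f x y - evF g x y"
  using evF_add[of f "- g" x y] evF_minus[of g x y] by simp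

lemma evF_single: "evF (Poly_Mapping.single D c) x y = c * ev_class D x y"
  by (cases "c = 0") (simp_all add: evF_def)

lemma evF_sum: "evF (\<Sum>i\<in>A. f i) x y = (\<Sum>i\<in>A. evF (f i) x y)"
  by (induction A rule: infinite_finite_induct) (auto simp: evF_add)

lemma ev_class_ltangle:
  "ev_class (ltangle k s w) x y = (if length x = k \<and> length y = k then ev red_weight w x y else 0)"
  using ev_isotopic[OF isotopic_rep[of k w s]] by (simp add: ev_class_def)

lemma evF_length: "f \<in> Sp FA k s \<Longrightarrow> evF f x y \<noteq> 0 \<Longrightarrow> length x = k \<and> length y = k"
  by (rule ccontr) (auto simp: evF_def mem_Sp_FA ev_class_ltangle intro!: sum.neutral)

lemma fits_memD: "fits A s T x \<Longrightarrow> (i, Box j b) \<in> set T \<Longrightarrow> x b \<in> Sp A j (shade_at s i)"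
  unfolding fits_def by (force simp: set_boxes)

lemma evF_Act:
  assumes "tangle k T" "fits FA s T x" "length a = k" "length b = k"
  shows "evF (Act FA k s T x) a b = ev (\<lambda>l. evF (x l)) T a b"
proof -
  have T: "goes k T k" "distinct (labels T)" using assms(1) by (auto simp: tangle_def)
  have "ev_class (ltangle k s (subst T (\<lambda>l. rep (D l)))) a b = ev (\<lambda>l. ev_class (D l)) T a b"
    if D: "D \<in> PiE (set (labels T)) (\<lambda>l. Poly_Mapping.keys (x l))" for D
  proof -
    have l: "goes j (rep (D l)) j \<and> fst (D l) = j" if "(i, Box j l) \<in> set T" for i j l
      using mem_Sp_FA_keys[OF fits_memD[OF assms(2) that], of "D l"] PiE_mem[OF D labels_memI[OF that]]
      by (metis fitting_iff fst_ltangle)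
    have "ev_class (ltangle k s (subst T (\<lambda>l. rep (D l)))) a b = ev red_weight (subst T (\<lambda>l. rep (D l))) a b"
      using assms by (simp add: ev_class_ltangle)
    also have "\<dots> = ev (\<lambda>l. ev red_weight (rep (D l))) T a b"
      by (rule ev_subst[OF _ T(1) assms(3)]) (use l in blast)
    also have "\<dots> = ev (\<lambda>l. ev_class (D l)) T a b"
      by (rule ev_cong[OF _ T(1) assms(3)]) (use l in \<open>force simp: ev_class_def\<close>)
    finally show ?thesis .
  qed
  then have "evF (Act FA k s T x) a b = (\<Sum>D\<in>PiE (set (labels T)) (\<lambda>l. Poly_Mapping.keys (x l)).
      (\<Prod>l\<in>set (labels T). Poly_Mapping.lookup (x l) (D l)) * ev (\<lambda>l. ev_class (D l)) T a b)"
    by (simp add: Act_FA_eq evF_sum evF_single)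
  also have "\<dots> = ev (\<lambda>l. evF (x l)) T a b"
    unfolding evF_def[abs_def] by (rule ev_multilinear[OF T(2), symmetric])
  finally show ?thesis .
qed


section \<open>The relations hold for the state sum\<close>

definition ev_kernel :: "nat \<Rightarrow> shade \<Rightarrow> (gen ltangle \<Rightarrow>\<^sub>0 complex) set" where
  "ev_kernel k s = {f \<in> Sp FA k s. \<forall>x y. evF f x y = 0}"

text \<open>The state sum is a sum of products over the boxes, so it vanishes if the matrix of one box does.\<close>

lemma planar_ideal_ev_kernel: "planar_ideal FA ev_kernel"
  unfolding planar_ideal_def scl_FA
proof (intro conjI allI impI; (elim conjE)?)
  fix k s
  show "pm.subspace (ev_kernel k s)"
    using subspace_Sp_FA[of k s]
    by (auto simp: pm.subspace_def ev_kernel_def evF_add evF_scale)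
  show "ev_kernel k s \<subseteq> Sp FA k s" by (auto simp: ev_kernel_def)
next
  fix k s T x
  assume T: "tangle k T" "fits FA s T x" and "\<exists>(b, j, t)\<in>set (boxes s T). x b \<in> ev_kernel j t"
  then obtain b i j where b: "(i, Box j b) \<in> set T" "\<And>u v. evF (x b) u v = 0"
    by (auto simp: set_boxes ev_kernel_def)
  have z: "ev (\<lambda>l. evF (x l)) T u v = 0" for u v
    using b(1)
  proof (induction T arbitrary: u)
    case (Cons p T)
    obtain h a where p: "p = (h, a)" by force
    show ?case
    proof (cases "p = (i, Box j b)")
      case True
      then show ?thesis by (simp add: ev.simps b(2))
    next
      case False
      then have "ev (\<lambda>l. evF (x l)) T u v = 0" for u using Cons by simp
      then show ?thesis by (simp add: p ev.simps)
    qed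
  qed simp
  have S: "Act FA k s T x \<in> Sp FA k s"
    using T by (intro Act_FA_closed) (auto simp: tangle_def)
  have "evF (Act FA k s T x) u v = 0" for u v
    using evF_Act[OF T, of u v] evF_length[OF S, of u v] z[of u v] by metis
  with S show "Act FA k s T x \<in> ev_kernel k s" unfolding ev_kernel_def by simp
qed

definition coloured_strand :: "bool \<Rightarrow> (complex \<times> gen diagram) list" where
  "coloured_strand c = (if c then [(1, [(0, Box 1 Gen)])] else [(1, []), (- 1, [(0, Box 1 Gen)])])"

abbreviation free_colour :: "bool \<Rightarrow> gen ltangle \<Rightarrow>\<^sub>0 complex" where
  "free_colour c \<equiv> combination 1 Unshaded (coloured_strand c)"

lemma freeP_eq: "freeP = free_colour True"
  by (simp add: freeP_def generator_def coloured_strand_def)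

lemma vert_FA: "vert FA k s = basis_elt k s []"
  using Act_FA_basis[of k "[]" "\<lambda>_. []" "(!) []" _ s] by (simp add: vert_def)

lemma freeQ_eq: "freeQ = free_colour False"
  by (simp add: freeQ_def freeP_eq vert_FA coloured_strand_def single_diff single_uminus)

lemma colour_cases: "c \<in> {freeP, freeQ} \<longleftrightarrow> (\<exists>b. c = free_colour b)"
  unfolding freeP_eq freeQ_eq ex_bool_eq by simp

lemma fitting_coloured_strand: "(c, w) \<in> set (coloured_strand b) \<Longrightarrow> fitting 1 Unshaded w"
  by (auto simp: coloured_strand_def fitting_iff split: if_splits)

lemma combination_in_Sp: "(\<And>c w. (c, w) \<in> set G \<Longrightarrow> fitting k s w) \<Longrightarrow> combination k s G \<in> Sp FA k s"
proof (induction G)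
  case (Cons p G)
  then show ?case
    by (cases p) (auto intro!: pm.subspace_add[OF subspace_Sp_FA] single_in_Sp_FA)
qed (simp add: pm.subspace_0[OF subspace_Sp_FA])

lemma free_colour_in_Sp: "free_colour c \<in> Sp FA 1 Unshaded"
  by (rule combination_in_Sp) (rule fitting_coloured_strand)

lemma evF_free_colour: "evF (free_colour c) u t = of_bool (u = [c] \<and> t = [c])"
proof -
  have 1: "length u = Suc 0 \<longleftrightarrow> (\<exists>a. u = [a])" for u :: "bool list" by (cases u) auto
  have "ev red_weight [(0, Box (Suc 0) Gen)] [a] [b] = of_bool (a \<and> b)" for a b
    by (simp add: ev.simps red_weight_def sum_colourings_Suc UNIV_bool)
  then show ?thesis
    by (auto simp: coloured_strand_def evF_add evF_single ev_class_ltangle 1)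
qed

lemma rot_colour:
  "rot FA 1 Unshaded (free_colour c) = combination 1 Shaded
     (map (\<lambda>(d, w). (d, (0, Cup) # shift 1 w @ [(1, Cap)])) (coloured_strand c))"
proof -
  let ?T = "cups 0 1 @ [(1, Box 1 0)] @ caps 1 1"
  have T: "?T = [(0, Cup), (1, Box 1 0), (1, Cap)]" by (simp add: cups_Suc caps_Suc)
  have "rot FA 1 Unshaded (free_colour c) = Act FA 1 Shaded ?T ((!) [free_colour c])"
    by (simp add: rot_def shade_at_def)
  also have "\<dots> = combination 1 Shaded (map (\<lambda>(d, w). (d, subst ?T ((!) [w]))) (coloured_strand c))"
    by (rule Act_FA_unary[where i = 1])
      (use fitting_coloured_strand in \<open>auto simp: cups_Suc caps_Suc fitting_iff\<close>)
  finally show ?thesis by (simp add: cups_Suc caps_Suc)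
qed

lemma rot_colour_in_Sp: "rot FA 1 Unshaded (free_colour c) \<in> Sp FA 1 Shaded"
  unfolding rot_colour
  by (rule combination_in_Sp)
    (auto simp: coloured_strand_def fitting_iff shade_at_def boxes_fit_shift split: if_splits)

lemma length_1_iff: "length u = Suc 0 \<longleftrightarrow> (\<exists>a. u = [a])"
  and length_2_iff: "length u = Suc (Suc 0) \<longleftrightarrow> (\<exists>a b. u = [a, b])"
  by (auto simp: length_Suc_conv)

lemmas ev_compute = ev.simps sum_colourings_Suc UNIV_bool numeral_2_eq_2

lemma evF_rot_colour: "evF (rot FA 1 Unshaded (free_colour c)) u t = of_bool (u = [c] \<and> t = [c])"
proof (cases "length u = 1 \<and> length t = 1")
  case True
  then obtain a b where "u = [a]" "t = [b]" by (auto simp: length_1_iff)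
  have "fits FA Shaded (cups 0 1 @ [(1, Box 1 0)] @ caps 1 1) ((!) [free_colour c])"
    using free_colour_in_Sp[of c] by (simp add: fits_def boxes_def cups_Suc caps_Suc shade_at_def)
  then have "evF (rot FA 1 Unshaded (free_colour c)) u t
     = ev (\<lambda>l. evF ([free_colour c] ! l)) (cups 0 1 @ [(1, Box 1 0)] @ caps 1 1) u t"
    using True by (auto simp: rot_def shade_at_def tangle_def cups_Suc caps_Suc intro!: evF_Act)
  then show ?thesis using \<open>u = [a]\<close> \<open>t = [b]\<close>
    by (cases a; cases b; cases c)
      (simp_all add: cups_Suc caps_Suc ev_compute evF_free_colour[unfolded One_nat_def])
next
  case False
  then show ?thesis using evF_length[OF rot_colour_in_Sp] by force
qed

definition colour_weight :: "bool \<Rightarrow> cmat" where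
  "colour_weight c u t = of_bool (u = [c] \<and> t = [c])"

lemma ev_saddles:
  assumes "I 0 = colour_weight c" "I (Suc 0) = colour_weight c"
  shows "ev I [(0, Box (Suc 0) 0), (0, Cap), (0, Cup), (0, Box (Suc 0) (Suc 0))] [p, q] [r, t]
      = of_bool (p = c \<and> q = c \<and> r = c \<and> t = c)"
    "ev I [(Suc 0, Box (Suc 0) 0), (0, Cap), (0, Cup), (Suc 0, Box (Suc 0) (Suc 0))] [p, q] [r, t]
      = of_bool (p = c \<and> q = c \<and> r = c \<and> t = c)"
    "ev I [(0, Box (Suc 0) 0), (Suc 0, Box (Suc 0) (Suc 0))] [p, q] [r, t]
      = of_bool (p = c \<and> q = c \<and> r = c \<and> t = c)"
  by (cases c; cases p; cases q; cases r; cases t; simp add: ev_compute assms colour_weight_def)+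

text \<open>Red and blue project onto complementary coordinate lines: exactly one colouring survives on a
  coloured loop, and on both sides of a saddle only the monochrome colouring does.\<close>

lemma relator_in_kernel:
  assumes "relator k s x"
  shows "x \<in> ev_kernel k s"
proof -
  have W: "evF (free_colour c) = colour_weight c"
      "evF (rot FA 1 Unshaded (free_colour c)) = colour_weight c" for c
    by (simp_all add: fun_eq_iff evF_free_colour[unfolded One_nat_def] evF_rot_colour[unfolded One_nat_def]
        colour_weight_def)
  note W = W[unfolded One_nat_def]
  note S = free_colour_in_Sp[unfolded One_nat_def] rot_colour_in_Sp[unfolded One_nat_def]
  note E = evF_free_colour[unfolded One_nat_def] evF_rot_colour[unfolded One_nat_def]
  have A: "Act FA k s T x \<in> Sp FA k s \<and> (\<forall>a b. length a = k \<longrightarrow> length b = k \<longrightarrow>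
       evF (Act FA k s T x) a b = ev (\<lambda>l. evF (x l)) T a b)"
    if "tangle k T" "fits FA s T x" for k s T x
    using Act_FA_closed evF_Act that by (auto simp: tangle_def)
  have V: "vert FA k s \<in> Sp FA k s" "evF (vert FA k s) a b = of_bool (a = b)"
    if "length a = k" "length b = k" for k s a b
    using that by (simp_all add: vert_FA single_in_Sp_FA fitting_iff evF_single ev_class_ltangle)
  have V': "vert FA k s \<in> Sp FA k s" for k s by (simp add: vert_FA single_in_Sp_FA fitting_iff)
  have K: "x \<in> ev_kernel k s" if "x \<in> Sp FA k s" "\<And>a b. length a = k \<Longrightarrow> length b = k \<Longrightarrow> evF x a b = 0" for k s x
    using that evF_length[OF that(1)] unfolding ev_kernel_def by blast
  note D = pm.subspace_diff[OF subspace_Sp_FA] pm.subspace_add[OF subspace_Sp_FA]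
  note F = fits_def boxes_def shade_at_def tangle_def
  show ?thesis using assms
  proof cases
    case (bubble_shaded c)
    then obtain b where c: "c = free_colour b" using colour_cases by blast
    have "tangle 0 [(0, Cup), (0, Box 1 0), (0, Cap)]"
        "fits FA Unshaded [(0, Cup), (0, Box 1 0), (0, Cap)] ((!) [c])"
      using S by (simp_all add: F c)
    note A = A[OF this]
    show ?thesis unfolding bubble_shaded
      by (cases b; rule K) (use A in \<open>auto simp: D V' V evF_diff ev_compute E c
        simp del: sum_of_bool_mult_eq sum_mult_of_bool_eq sum_of_bool_eq\<close>)
  next
    case (bubble_unshaded c)
    then obtain b where c: "c = free_colour b" using colour_cases by blast
    have "tangle 0 [(0, Cup), (1, Box 1 0), (0, Cap)]"
        "fits FA Shaded [(0, Cup), (1, Box 1 0), (0, Cap)] ((!) [c])"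
      using S by (simp_all add: F c)
    note A = A[OF this]
    show ?thesis unfolding bubble_unshaded
      by (cases b; rule K) (use A in \<open>auto simp: D V' V evF_diff ev_compute E c
        simp del: sum_of_bool_mult_eq sum_mult_of_bool_eq sum_of_bool_eq\<close>)
  next
    case strand_X
    then show ?thesis using pm.subspace_0[OF subspace_Sp_FA] by (simp add: freeQ_def ev_kernel_def)
  next
    case strand_Y
    show ?thesis unfolding strand_Y
      by (rule K) (use S in \<open>auto simp: D V' V evF_diff evF_add E freeP_eq freeQ_eq length_1_iff\<close>)
  next
    case disagree_PQ
    have "tangle 1 [(0, Box 1 1), (0, Box 1 0)]"
        "fits FA Unshaded [(0, Box 1 1), (0, Box 1 0)] ((!) [freeP, freeQ])"
      using S by (simp_all add: F freeP_eq freeQ_eq)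
    note A = A[OF this]
    show ?thesis unfolding disagree_PQ mult_def
      by (rule K) (use A in \<open>auto simp: ev_compute E freeP_eq freeQ_eq length_1_iff\<close>)
  next
    case disagree_QP
    have "tangle 1 [(0, Box 1 1), (0, Box 1 0)]"
        "fits FA Unshaded [(0, Box 1 1), (0, Box 1 0)] ((!) [freeQ, freeP])"
      using S by (simp_all add: F freeP_eq freeQ_eq)
    note A = A[OF this]
    show ?thesis unfolding disagree_QP mult_def
      by (rule K) (use A in \<open>auto simp: ev_compute E freeP_eq freeQ_eq length_1_iff\<close>)
  next
    case (saddle_unshaded c)
    then obtain b where c: "c = free_colour b" using colour_cases by blast
    have "tangle 2 [(0, Box 1 0), (0, Cap), (0, Cup), (0, Box 1 1)]"
        "fits FA Unshaded [(0, Box 1 0), (0, Cap), (0, Cup), (0, Box 1 1)] ((!) [c, c])"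
      using S by (simp_all add: F c)
    note A1 = this A[OF this, THEN conjunct2, rule_format]
    have "tangle 2 [(0, Box 1 0), (1, Box 1 1)]"
        "fits FA Unshaded [(0, Box 1 0), (1, Box 1 1)] ((!) [c, rot FA 1 Unshaded c])"
      using S by (simp_all add: F c)
    note A2 = this A[OF this, THEN conjunct2, rule_format]
    have "ev (\<lambda>l. evF ([c, c] ! l)) [(0, Box 1 0), (0, Cap), (0, Cup), (0, Box 1 1)] u v
        = ev (\<lambda>l. evF ([c, rot FA 1 Unshaded c] ! l)) [(0, Box 1 0), (1, Box 1 1)] u v"
      if "length u = 2" "length v = 2" for u v
      using that by (auto simp: numeral_2_eq_2 length_2_iff ev_saddles W c)
    then show ?thesis unfolding saddle_unshaded tensor_def one_add_one using A1(1,2) A2(1,2)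
      by (intro K D Act_FA_closed) (simp_all only: evF_diff A1(3) A2(3) right_minus_eq tangle_def)
  next
    case (saddle_shaded c)
    then obtain b where c: "c = free_colour b" using colour_cases by blast
    have "tangle 2 [(1, Box 1 0), (0, Cap), (0, Cup), (1, Box 1 1)]"
        "fits FA Shaded [(1, Box 1 0), (0, Cap), (0, Cup), (1, Box 1 1)] ((!) [c, c])"
      using S by (simp_all add: F c)
    note A1 = this A[OF this, THEN conjunct2, rule_format]
    have "tangle 2 [(0, Box 1 0), (1, Box 1 1)]"
        "fits FA Shaded [(0, Box 1 0), (1, Box 1 1)] ((!) [rot FA 1 Unshaded c, c])"
      using S by (simp_all add: F c)
    note A2 = this A[OF this, THEN conjunct2, rule_format]
    have "ev (\<lambda>l. evF ([c, c] ! l)) [(1, Box 1 0), (0, Cap), (0, Cup), (1, Box 1 1)] u v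
        = ev (\<lambda>l. evF ([rot FA 1 Unshaded c, c] ! l)) [(0, Box 1 0), (1, Box 1 1)] u v"
      if "length u = 2" "length v = 2" for u v
      using that by (auto simp: numeral_2_eq_2 length_2_iff ev_saddles W c)
    then show ?thesis unfolding saddle_shaded tensor_def one_add_one using A1(1,2) A2(1,2)
      by (intro K D Act_FA_closed) (simp_all only: evF_diff A1(3) A2(3) right_minus_eq tangle_def)
  qed
qed

lemma relation_ideal_le: "relation_ideal k s \<subseteq> ev_kernel k s"
  unfolding relation_ideal_def ideal_generated_def
  using planar_ideal_ev_kernel relator_in_kernel by blast

lemma evF_total_ideal:
  assumes "f \<in> total_ideal"
  shows "evF f x y = 0"
proof -
  have "f \<in> pm.span (\<Union>k s. relation_ideal k s)" using assms by (simp add: total_ideal_def)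
  then show ?thesis
  proof (induction rule: pm.span_induct)
    case base
    show ?case by (auto simp: pm.subspace_def evF_add evF_scale)
  next
    case (step f)
    then show ?case using relation_ideal_le by (force simp: ev_kernel_def)
  qed
qed

lift_definition mat :: "PA \<Rightarrow> cmat" is evF
proof (intro ext)
  fix f g x y assume "congr f g"
  then show "evF f x y = evF g x y" using evF_total_ideal[of "f - g"] by (simp add: congr_def evF_diff)
qed


section \<open>Diagrams with coloured strands\<close>

interpretation pa: vector_space scale_PA
proof -
  have r: "congr x x" for x using equivp_congr by (rule equivp_reflp)
  show "vector_space scale_PA"
    by unfold_locales
      (transfer, simp add: pm.scale_right_distrib pm.scale_left_distrib r)+
qed

lemma abs_PA_add: "abs_PA (f + g) = abs_PA f + abs_PA g"
  by (simp add: plus_PA.abs_eq)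

lemma abs_PA_0: "abs_PA 0 = 0"
  by (simp add: zero_PA_def)

lemma abs_PA_diff: "abs_PA (f - g) = abs_PA f - abs_PA g"
  by (simp add: minus_PA.abs_eq)

lemma abs_PA_scale: "abs_PA (pm_scale c f) = scale_PA c (abs_PA f)"
  by (simp add: scale_PA.abs_eq)

lemma abs_PA_sum: "abs_PA (\<Sum>i\<in>A. f i) = (\<Sum>i\<in>A. abs_PA (f i))"
  by (induction A rule: infinite_finite_induct) (auto simp: abs_PA_add abs_PA_0)

lemma abs_PA_eq_0: "abs_PA f = 0 \<longleftrightarrow> f \<in> total_ideal"
  by (simp add: zero_PA_def PA.abs_eq_iff congr_def)

lemma abs_PA_relation: "f \<in> relation_ideal k s \<Longrightarrow> abs_PA f = 0"
  unfolding abs_PA_eq_0 total_ideal_def scl_FA by (rule pm.span_base) blast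

text \<open>A diagram becomes a tangle, with the generator as every input, by numbering its boxes.\<close>

fun number_boxes :: "nat \<Rightarrow> 'g diagram \<Rightarrow> nat diagram" where
  "number_boxes n [] = []"
| "number_boxes n ((i, a) # w) = (i, map_piece (\<lambda>_. n) a) # number_boxes (Suc n) w"

lemma number_boxes_labels:
  "distinct (labels (number_boxes n w)) \<and> set (labels (number_boxes n w)) \<subseteq> {n..<n + length w}"
proof (induction n w rule: number_boxes.induct)
  case (2 n i a w)
  then show ?case by (cases a) force+
qed simp

lemma goes_number_boxes [simp]: "goes m (number_boxes n w) l \<longleftrightarrow> goes m w l"
proof (induction n w arbitrary: m rule: number_boxes.induct)
  case (2 n i a w)
  then show ?case by (cases a) auto
qed simp

lemma mem_number_boxes:
  "(i, Box j b) \<in> set (number_boxes n w) \<Longrightarrow> n \<le> b \<and> (\<exists>g. (i, Box j g) \<in> set w)"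
proof (induction n w rule: number_boxes.induct)
  case (2 n h a w)
  then show ?case by (cases a) force+
qed simp

lemma subst_number_boxes:
  assumes "\<And>b. n \<le> b \<Longrightarrow> S b = [(0, Box 1 Gen)]" "boxes_fit s w"
  shows "subst (number_boxes n w) S = w"
  using assms
proof (induction n w rule: number_boxes.induct)
  case (2 n h a w)
  then show ?case
  proof (cases a)
    case (Box j g)
    then show ?thesis using 2 by (cases g) auto
  qed auto
qed simp

text \<open>A relator in the middle of a diagram is the value of a tangle that has the relator in one box and the
  generator in all others, so it belongs to the ideal.\<close>

lemma relator_context:
  assumes rel: "relator j t (combination j t G)"
    and G: "\<And>c w. (c, w) \<in> set G \<Longrightarrow> fitting j t w"
    and u: "goes k u (i + j + r)" "boxes_fit s u"
    and v: "goes (i + j + r) v k" "boxes_fit s v"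
    and t: "shade_at s i = t"
  shows "(\<Sum>(c, l)\<leftarrow>G. scale_PA c (abs_PA (basis_elt k s (u @ shift i l @ v)))) = 0"
proof -
  define T where "T = number_boxes 1 u @ (i, Box j 0) # number_boxes (1 + length u) v"
  define x where "x = (\<lambda>_ :: nat. freeP)(0 := combination j t G)"
  have "goes k ((u @ shift i [(0, Box j Gen)]) @ v) k"
    using goes_context[OF u(1) _ v(1), of "[(0, Box j Gen)]"] by simp
  then have gT: "goes k T k" using u v unfolding T_def by (auto simp: goes_append)
  have "distinct (labels T)"
    using number_boxes_labels[of 1 u] number_boxes_labels[of "1 + length u" v]
    unfolding T_def by (force simp: labels_append subset_eq)
  with gT have tT: "tangle k T" by (simp add: tangle_def)
  have boxT: "(b = 0 \<and> l = j \<and> h = i) \<or> (b \<noteq> 0 \<and> l = 1 \<and> shade_at s h = Unshaded)"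
      if "(h, Box l b) \<in> set T" for h l b
    using that u(2) v(2) mem_number_boxes[of h l b 1 u] mem_number_boxes[of h l b "1 + length u" v]
    unfolding T_def by (force simp: boxes_fit_def)
  have fits: "fits FA s T x"
    using boxT combination_in_Sp[of G j t] G free_colour_in_Sp[of True] t
    unfolding fits_def x_def freeP_eq[symmetric] by (force simp: set_boxes)
  have 0: "0 \<in> set (labels T)" unfolding T_def by (simp add: labels_append)
  have "Act FA k s T x \<in> I k s" if I: "planar_ideal FA I" "\<forall>j t. {x. relator j t x} \<subseteq> I j t" for I
  proof -
    have "(0, j, t) \<in> set (boxes s T)" using t unfolding T_def by (auto simp: set_boxes)
    moreover have "x 0 \<in> I j t" using I(2) rel unfolding x_def by auto
    ultimately have "\<exists>(b, j, t)\<in>set (boxes s T). x b \<in> I j t" by blast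
    then show ?thesis using I(1)[unfolded planar_ideal_def, THEN conjunct2] tT fits by simp
  qed
  then have "Act FA k s T x \<in> relation_ideal k s"
    unfolding relation_ideal_def ideal_generated_def by blast
  then have "abs_PA (Act FA k s T x) = 0" by (rule abs_PA_relation)
  moreover have "Act FA k s T x = (\<Sum>(c, w)\<leftarrow>G. pm_scale c (basis_elt k s (u @ shift i w @ v)))"
    unfolding x_def Act_FA_combination[OF 0]
  proof (intro arg_cong[of _ _ sum_list] map_cong refl, clarify)
    fix c w assume w: "(c, w) \<in> set G"
    let ?S = "\<lambda>b. if b = 0 then w else [(0, Box 1 Gen)]"
    have "Act FA k s T ((\<lambda>_. freeP)(0 := basis_elt j t w)) = basis_elt k s (subst T ?S)"
    proof (rule Act_FA_basis[OF gT, where t = "\<lambda>b. if b = 0 then t else Unshaded"])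
      fix h l b assume "(h, Box l b) \<in> set T"
      from boxT[OF this] G[OF w] show "goes l (?S b) l \<and>
          ((\<lambda>_. freeP)(0 := basis_elt j t w)) b = basis_elt l (if b = 0 then t else Unshaded) (?S b)"
        by (auto simp: freeP_eq coloured_strand_def fitting_iff)
    qed
    moreover have "subst T ?S = u @ shift i w @ v"
      unfolding T_def using u v by (simp add: subst_append subst_number_boxes)
    ultimately show "pm_scale c (Act FA k s T ((\<lambda>_. freeP)(0 := basis_elt j t w)))
        = pm_scale c (basis_elt k s (u @ shift i w @ v))" by simp
  qed
  moreover have "abs_PA (\<Sum>(c, w)\<leftarrow>G. pm_scale c (f w)) = (\<Sum>(c, w)\<leftarrow>G. scale_PA c (abs_PA (f w)))" for f
    by (induction G) (auto simp: abs_PA_add abs_PA_0 abs_PA_scale simp del: pm_scale_single)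
  ultimately show ?thesis by metis
qed

lemma isotopic_move: "move l r \<Longrightarrow> goes m l n \<Longrightarrow> goes m r n \<Longrightarrow> isotopic m n l r"
  unfolding isotopic_def move_in_def by (rule r_into_equivclp) (metis append_Nil append_Nil2)

lemma shift_0 [simp]: "shift 0 w = w"
  by (induction w) auto

lemma isotopic_append:
  "isotopic m n l r \<Longrightarrow> goes a u m \<Longrightarrow> goes n v b \<Longrightarrow> isotopic a b (u @ l @ v) (u @ r @ v)"
  using isotopic_context[of m n l r a u 0 0 v b] by simp

lemma goes_shift: "goes k w l \<Longrightarrow> i + k \<le> m \<Longrightarrow> goes m (shift i w) (m - k + l)"
  using goes_shift_append[of k w l i "m - i - k" "[]" "m - k + l"] by simp

lemma isotopic_exchange_piece:
  assumes "goes q w q'" "i + ins a \<le> J" "J + q \<le> m"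
  shows "isotopic m (m - q + q' - ins a + outs a) (shift J w @ [(i, a)])
    ((i, a) # shift (J - ins a + outs a) w)"
  using assms
proof (induction q w q' arbitrary: m rule: goes.induct)
  case (1 q q')
  then show ?case by simp
next
  case (2 q j b w q')
  let ?m = "m - ins b + outs b" and ?J = "J - ins a + outs a"
  have g: "J + j + ins b \<le> m" "goes (q - ins b + outs b) w q'" "q \<le> m" "ins b \<le> q"
    using 2 by auto
  have n: "?m - (q - ins b + outs b) + q' = m - q + q'" using g by auto
  have "isotopic ?m (m - q + q' - ins a + outs a) (shift J w @ [(i, a)]) ((i, a) # shift ?J w)"
    using 2(1)[of ?m] "2.prems" g n by auto
  then have "isotopic m (m - q + q' - ins a + outs a) ([(J + j, b)] @ (shift J w @ [(i, a)]) @ [])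
      ([(J + j, b)] @ ((i, a) # shift ?J w) @ [])"
    by (rule isotopic_append) (use g in auto)
  moreover have "isotopic m (m - q + q' - ins a + outs a) ([] @ [(J + j, b), (i, a)] @ shift ?J w)
     ([] @ [(i, a), (J + j - ins a + outs a, b)] @ shift ?J w)"
  proof (rule isotopic_append[OF isotopic_move[OF move.exchange]])
    show "goes m [(J + j, b), (i, a)] (?m - ins a + outs a)"
      "goes m [(i, a), (J + j - ins a + outs a, b)] (?m - ins a + outs a)"
      "i + ins a \<le> J + j" using "2.prems" g by auto
    have e: "?m - ins a + outs a - (q - ins b + outs b) + q' = m - q + q' - ins a + outs a"
      using g "2.prems" by auto
    show "goes (?m - ins a + outs a) (shift ?J w) (m - q + q' - ins a + outs a)"
      unfolding e[symmetric] by (rule goes_shift[OF g(2)]) (use g "2.prems" in auto)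
  qed simp
  moreover have "J + j - ins a + outs a = ?J + j" using "2.prems" by auto
  ultimately show ?case using isotopic_trans by fastforce
qed

text \<open>Not only pieces but whole diagrams exchange their heights. This is needed because a red strand with
  the shading on its left is drawn with three pieces.\<close>

lemma isotopic_exchange:
  assumes "goes p w p'" "goes q v q'" "i + p \<le> J" "J + q \<le> m"
  shows "isotopic m (m - q + q' - p + p') (shift J v @ shift i w) (shift i w @ shift (J - p + p') v)"
  using assms(1,3,4)
proof (induction p w p' arbitrary: J m rule: goes.induct)
  case (1 p p')
  then show ?case by simp
next
  case (2 p j a w p')
  let ?p = "p - ins a + outs a" and ?J = "J - ins a + outs a" and ?n = "m - q + q' - p + p'"
  let ?m = "m - ins a + outs a"
  have g: "i + j + ins a \<le> J" "goes ?p w p'" "j + ins a \<le> p" using "2.prems" by auto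
  have n: "?m - q + q' - ?p + p' = ?n" "?J - ?p + p' = J - p + p'"
      "m - q + q' - ins a + outs a - ?p + p' = ?n" using "2.prems" g by auto
  have "isotopic ?m ?n (shift ?J v @ shift i w) (shift i w @ shift (J - p + p') v)"
    using 2(1)[of ?J ?m] "2.prems" g n by auto
  then have "isotopic m ?n ([(i + j, a)] @ (shift ?J v @ shift i w) @ [])
      ([(i + j, a)] @ (shift i w @ shift (J - p + p') v) @ [])"
    by (rule isotopic_append) (use "2.prems" g in auto)
  moreover have "isotopic m ?n ([] @ (shift J v @ [(i + j, a)]) @ shift i w)
     ([] @ ((i + j, a) # shift ?J v) @ shift i w)"
  proof (rule isotopic_append[OF isotopic_exchange_piece[OF assms(2)]])
    show "goes (m - q + q' - ins a + outs a) (shift i w) ?n"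
      unfolding n(3)[symmetric] by (rule goes_shift[OF g(2)]) (use g "2.prems" in auto)
  qed (use g "2.prems" in auto)
  ultimately show ?case using isotopic_trans by fastforce
qed

text \<open>A red vertical strand, with \<open>t\<close> the shading to its left: the star of the generator lies in an
  unshaded region, so in the second case the box is turned upside down.\<close>

definition red_strand :: "shade \<Rightarrow> gen diagram" where
  "red_strand t = (if t = Unshaded then [(0, Box 1 Gen)] else [(0, Cup), (1, Box 1 Gen), (1, Cap)])"

lemma goes_red_strand: "goes 1 (red_strand t) 1"
  by (simp add: red_strand_def)

lemma goes_red_strand_shift: "i < m \<Longrightarrow> goes m (shift i (red_strand t)) m"
  using goes_shift[OF goes_red_strand, of i m t] by simp

text \<open>Ill-formed diagrams get the value zero. Relations between parts of diagrams can then be stated for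
  arbitrary completions.\<close>

definition diag_PA :: "nat \<Rightarrow> shade \<Rightarrow> gen diagram \<Rightarrow> PA" where
  "diag_PA k s w = (if fitting k s w then abs_PA (basis_elt k s w) else 0)"

lemma diag_PA_isotopic:
  assumes "isotopic m n l r" "goes m l n" "goes k u m"
  shows "diag_PA k s (u @ l @ v) = diag_PA k s (u @ r @ v)"
proof (cases "goes n v k")
  case True
  then have "isotopic k k (u @ l @ v) (u @ r @ v)" using isotopic_append[OF assms(1,3)] by blast
  then have "ltangle k s (u @ l @ v) = ltangle k s (u @ r @ v)"
      "fitting k s (u @ l @ v) \<longleftrightarrow> fitting k s (u @ r @ v)"
    by (simp only: ltangle_eq_iff, rule fitting_isotopic)
  then show ?thesis by (simp only: diag_PA_def)
next
  case False
  then have "\<not> goes k (u @ l @ v) k" "\<not> goes k (u @ r @ v) k"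
    using assms isotopic_goes[OF assms(1)] unfolding goes_append by (metis goes_unique)+
  then show ?thesis by (simp add: diag_PA_def fitting_iff)
qed

lemma sum_list_scale_diff: "(\<Sum>(c, u)\<leftarrow>F. scale_PA c (f u - g u)) =
    (\<Sum>(c, u)\<leftarrow>F. scale_PA c (f u)) - (\<Sum>(c, u)\<leftarrow>F. scale_PA c (g u))"
  by (induction F) (auto simp: pa.scale_right_diff_distrib)

definition red_piece :: "shade \<Rightarrow> bool piece \<Rightarrow> gen diagram" where
  "red_piece t a = (case a of Cup \<Rightarrow> [(0, Cup)] | Cap \<Rightarrow> [(0, Cap)] | Box n c \<Rightarrow> red_strand t)"

definition elementary :: "bool piece \<Rightarrow> bool" where
  "elementary a \<longleftrightarrow> a = Cup \<or> a = Cap \<or> (\<exists>c. a = Box 1 c)"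

lemma elementary_simps [simp]: "elementary Cup" "elementary Cap" "elementary (Box n c) \<longleftrightarrow> n = 1"
  by (auto simp: elementary_def)

locale box_type =
  fixes k :: nat and s :: shade
begin

text \<open>The element of the quotient given by a diagram with marked strands of both colours and both
  directions. The markings are expanded from the bottom, \<open>u\<close> being the part that is already expanded;
  a blue strand is the identity minus a red one.\<close>

fun cv :: "gen diagram \<Rightarrow> bool diagram \<Rightarrow> PA" where
  "cv u [] = diag_PA k s u"
| "cv u ((i, Cup) # w) = cv (u @ [(i, Cup)]) w"
| "cv u ((i, Cap) # w) = cv (u @ [(i, Cap)]) w"
| "cv u ((i, Box n c) # w) = (if n \<noteq> 1 then 0
     else if c then cv (u @ shift i (red_strand (shade_at s i))) w
     else cv u w - cv (u @ shift i (red_strand (shade_at s i))) w)"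

text \<open>A continuation with colours is a combination of continuations without, so relations need to be checked
  only for the latter.\<close>

lemma cv_linear:
  assumes "\<And>v. (\<Sum>(c, u)\<leftarrow>F. scale_PA c (diag_PA k s (u @ v))) = 0"
  shows "(\<Sum>(c, u)\<leftarrow>F. scale_PA c (cv u w)) = 0"
  using assms
proof (induction w arbitrary: F)
  case Nil
  then show ?case using Nil[of "[]"] by simp
next
  case (Cons p w)
  obtain i a where p: "p = (i, a)" by force
  have ext: "(\<Sum>(c, u)\<leftarrow>F. scale_PA c (cv (u @ x) w)) = 0" for x
  proof -
    have "(\<Sum>(c, u)\<leftarrow>map (\<lambda>(c, u). (c, u @ x)) F. scale_PA c (diag_PA k s (u @ v))) = 0" for v
      using Cons.prems[of "x @ v"] by (simp add: comp_def split_def)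
    from Cons.IH[OF this] show ?thesis by (simp add: comp_def split_def)
  qed
  have z: "(\<Sum>(c, u)\<leftarrow>F. 0) = (0 :: PA)" by (induction F) auto
  show ?case
  proof (cases a)
    case (Box n c)
    then show ?thesis unfolding p using ext ext[of "[]"]
      by (cases "n = 1"; cases c) (simp_all add: sum_list_scale_diff z)
  qed (use p ext in simp_all)
qed

lemma cv_cong: "(\<And>v. diag_PA k s (u @ v) = diag_PA k s (u' @ v)) \<Longrightarrow> cv u w = cv u' w"
  using cv_linear[of "[(1, u), (- 1, u')]" w] by simp

lemma cv_isotopic:
  assumes "isotopic m n l r" "goes m l n" "goes k u m"
  shows "cv (u @ l) v = cv (u @ r) v"
  using diag_PA_isotopic[OF assms] by (intro cv_cong) simp

lemma cv_blue: "cv u (U @ (i, Box 1 False) # v) = cv u (U @ v) - cv u (U @ (i, Box 1 True) # v)"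
proof (induction U arbitrary: u)
  case (Cons p U)
  obtain j a where "p = (j, a)" by force
  then show ?case using Cons by (cases a) auto
qed simp


text \<open>Below, only contexts that are already expanded are tested; \<open>eqv_context\<close> extends the relation to
  contexts with markings.\<close>

definition eqv :: "nat \<Rightarrow> bool diagram \<Rightarrow> bool diagram \<Rightarrow> bool" where
  "eqv m l r \<longleftrightarrow> (\<forall>u v. goes k u m \<longrightarrow> cv u (l @ v) = cv u (r @ v))"

definition null :: "nat \<Rightarrow> bool diagram \<Rightarrow> bool" where
  "null m l \<longleftrightarrow> (\<forall>u v. goes k u m \<longrightarrow> cv u (l @ v) = 0)"

lemma eqv_refl [simp]: "eqv m l l"
  by (simp add: eqv_def)

lemma eqv_sym: "eqv m l r \<Longrightarrow> eqv m r l"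
  by (simp add: eqv_def)

lemma eqv_trans [trans]: "eqv m l r \<Longrightarrow> eqv m r t \<Longrightarrow> eqv m l t"
  by (simp add: eqv_def)

lemma null_eqv: "eqv m l r \<Longrightarrow> null m r \<Longrightarrow> null m l"
  by (simp add: eqv_def null_def)

lemma cv_linear_prefix:
  assumes "\<And>u v. goes k u m \<Longrightarrow> (\<Sum>(c, l)\<leftarrow>G. scale_PA c (cv u (l @ v))) = 0" "goes m' U m" "goes k u m'"
  shows "(\<Sum>(c, l)\<leftarrow>G. scale_PA c (cv u (U @ l @ v))) = 0"
  using assms(2,3)
proof (induction U arbitrary: u m')
  case Nil
  then show ?case using assms(1) by simp
next
  case (Cons p U)
  obtain i a where p: "p = (i, a)" by force
  have U: "goes (m' - ins a + outs a) U m" "i + ins a \<le> m'" using Cons.prems p by auto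
  have IH: "(\<Sum>(c, l)\<leftarrow>G. scale_PA c (cv (u @ w) (U @ l @ v))) = 0" if "goes m' w (m' - ins a + outs a)" for w
    using Cons.IH[OF U(1), of "u @ w"] Cons.prems(2) that by (auto simp: goes_append)
  show ?case
  proof (cases a)
    case (Box n c)
    show ?thesis
    proof (cases "n = 1")
      case True
      then have "goes m' (shift i (red_strand t)) (m' - ins a + outs a)"
          "goes m' [] (m' - ins a + outs a)" for t
        using U(2) Box goes_red_strand_shift by auto
      from IH[OF this(1)] IH[OF this(2)] show ?thesis
        using p Box True by (cases c) (simp_all add: sum_list_scale_diff)
    qed (use p Box sum_list_scale_diff[of "\<lambda>_. 0" "\<lambda>_. 0"] in simp)
  qed (use IH[of "[(i, Cup)]"] IH[of "[(i, Cap)]"] U p in auto)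
qed

lemma eqv_context:
  assumes "eqv m l r" "goes m' U m"
  shows "eqv m' (U @ l @ V) (U @ r @ V)"
  unfolding eqv_def
proof (intro allI impI)
  fix u :: "gen diagram" and v assume "goes k u m'"
  then have "(\<Sum>(c, l)\<leftarrow>[(1, l), (- 1, r)]. scale_PA c (cv u (U @ l @ V @ v))) = 0"
    by (intro cv_linear_prefix[OF _ assms(2)]) (use assms(1) in \<open>auto simp: eqv_def\<close>)
  then show "cv u ((U @ l @ V) @ v) = cv u ((U @ r @ V) @ v)" by simp
qed

lemma null_context:
  assumes "null m l" "goes m' U m"
  shows "null m' (U @ l @ V)"
  unfolding null_def
proof (intro allI impI)
  fix u :: "gen diagram" and v assume "goes k u m'"
  then have "(\<Sum>(c, l)\<leftarrow>[(1, l)]. scale_PA c (cv u (U @ l @ V @ v))) = 0"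
    by (intro cv_linear_prefix[OF _ assms(2)]) (use assms(1) in \<open>auto simp: null_def\<close>)
  then show "cv u ((U @ l @ V) @ v) = 0" by simp
qed

lemma eqv_append: "eqv m l r \<Longrightarrow> eqv m (l @ V) (r @ V)"
  using eqv_context[of m l r m "[]" V] by simp

lemma eqv_prefix: "eqv m l r \<Longrightarrow> goes m' U m \<Longrightarrow> eqv m' (U @ l) (U @ r)"
  using eqv_context[of m l r m' U "[]"] by simp

subsection \<open>Local relations\<close>

lemma exchange_red:
  assumes "a \<in> {Cup, Cap, Box 1 True}" "b \<in> {Cup, Cap, Box 1 True}"
    and "i + ins a \<le> j" "j + ins b \<le> m"
  shows "eqv m [(j, b), (i, a)] [(i, a), (j - ins a + outs a, b)]"
  unfolding eqv_def
proof (intro allI impI)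
  fix u :: "gen diagram" and v assume u: "goes k u m"
  have cv: "cv u ((i, a) # v) = cv (u @ shift i (red_piece (shade_at s i) a)) v"
    if "a \<in> {Cup, Cap, Box 1 True}" for a i u v
    using that by (auto simp: red_piece_def)
  have g: "goes (ins a) (red_piece t a) (outs a)" if "a \<in> {Cup, Cap, Box 1 True}" for a t
    using that goes_red_strand by (auto simp: red_piece_def)
  define J where "J = j - ins a + outs a"
  have sh: "shade_at s J = shade_at s j"
    using assms(1,3) by (auto simp: shade_at_def J_def)
  let ?a = "red_piece (shade_at s i) a" and ?b = "red_piece (shade_at s j) b"
  have "cv (u @ shift j ?b @ shift i ?a) v = cv (u @ shift i ?a @ shift J ?b) v"
    unfolding J_def
  proof (rule cv_isotopic[OF isotopic_exchange[OF g g] _ u])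
    show "goes m (shift j ?b @ shift i ?a) (m - ins b + outs b - ins a + outs a)"
      unfolding goes_append
    proof (intro exI conjI)
      show "goes m (shift j ?b) (m - ins b + outs b)"
        by (rule goes_shift[OF g]) (use assms in simp_all)
      show "goes (m - ins b + outs b) (shift i ?a) (m - ins b + outs b - ins a + outs a)"
        by (rule goes_shift[OF g]) (use assms in simp_all)
    qed
  qed (use assms in auto)
  moreover have "cv u ([(j, b), (i, a)] @ v) = cv (u @ shift j ?b @ shift i ?a) v"
    by (simp add: cv[OF assms(1)] cv[OF assms(2)])
  moreover have "cv u ([(i, a), (J, b)] @ v) = cv (u @ shift i ?a @ shift J ?b) v"
    by (simp add: cv[OF assms(1)] cv[OF assms(2)] sh)
  ultimately show "cv u ([(j, b), (i, a)] @ v) = cv u ([(i, a), (j - ins a + outs a, b)] @ v)"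
    by (simp only: J_def)
qed

lemma exchange:
  assumes "elementary a" "elementary b" "i + ins a \<le> j" "j + ins b \<le> m"
  shows "eqv m [(j, b), (i, a)] [(i, a), (j - ins a + outs a, b)]"
proof -
  have R: "cv u ([(j, b), (i, a)] @ v) = cv u ([(i, a), (j - ins a + outs a, b)] @ v)"
    if "a \<in> {Cup, Cap, Box 1 True}" "b \<in> {Cup, Cap, Box 1 True}" "i + ins a \<le> j" "j + ins b \<le> m" "goes k u m"
    for a b u v using exchange_red[OF that(1-4)] that(5) by (simp add: eqv_def)
  have B: "cv u ([(j, b), (i, a)] @ v) = cv u ([(i, a), (j - ins a + outs a, b)] @ v)"
    if a: "a \<in> {Cup, Cap, Box 1 True}" and h: "elementary b" "i + ins a \<le> j" "j + ins b \<le> m" "goes k u m"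
        for a b u v
  proof (cases "b = Box 1 False")
    case True
    then show ?thesis
      using R[OF a, of "Box 1 True" u v] h cv_blue[of u "[]" j "(i, a) # v"]
        cv_blue[of u "[(i, a)]" "j - ins a + outs a" v] by simp
  next
    case False
    then show ?thesis using R[OF a _ h(2-)] h(1) by (auto simp: elementary_def)
  qed
  show ?thesis unfolding eqv_def
  proof (intro allI impI)
    fix u :: "gen diagram" and v assume u: "goes k u m"
    show "cv u ([(j, b), (i, a)] @ v) = cv u ([(i, a), (j - ins a + outs a, b)] @ v)"
    proof (cases "a = Box 1 False")
      case True
      then show ?thesis
        using B[of "Box 1 True" b u v] assms u cv_blue[of u "[(j, b)]" i v]
          cv_blue[of u "[]" i "(j, b) # v"] by simp
    next
      case False
      then show ?thesis using B[OF _ assms(2-4) u] assms(1) by (auto simp: elementary_def)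
    qed
  qed
qed

lemma straighten:
  assumes "i < m"
  shows "eqv m [(i, Cup), (Suc i, Cap)] []" "eqv m [(Suc i, Cup), (i, Cap)] []"
proof -
  have "cv (u @ [(i, Cup), (Suc i, Cap)]) v = cv (u @ []) v"
      "cv (u @ [(Suc i, Cup), (i, Cap)]) v = cv (u @ []) v"
    if "goes k u m" for u v
    using assms that
    by (intro cv_isotopic[OF isotopic_move] move.intros; auto)+
  then show "eqv m [(i, Cup), (Suc i, Cap)] []" "eqv m [(Suc i, Cup), (i, Cap)] []"
    by (simp_all add: eqv_def)
qed

lemma red_rotate:
  assumes "i < m" "shade_at s i = Shaded"
  shows "eqv m [(i, Box 1 True)] [(i, Cup), (Suc i, Box 1 True), (Suc i, Cap)]"
    "eqv m [(i, Box 1 True)] [(Suc i, Cup), (Suc i, Box 1 True), (i, Cap)]"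
proof -
  have "cv (u @ cups i 1 @ [(i + 1, Box 1 Gen)] @ caps (i + 1) 1) v =
      cv (u @ cups (i + 1) 1 @ [(i + 1, Box 1 Gen)] @ caps i 1) v" if "goes k u m" for u v
    by (rule cv_isotopic[OF isotopic_move[OF move.full_turn] _ that])
      (use assms in \<open>auto simp: cups_Suc caps_Suc\<close>)
  then show "eqv m [(i, Box 1 True)] [(i, Cup), (Suc i, Box 1 True), (Suc i, Cap)]"
    "eqv m [(i, Box 1 True)] [(Suc i, Cup), (Suc i, Box 1 True), (i, Cap)]"
    using assms by (auto simp: eqv_def cups_Suc caps_Suc red_strand_def shade_at_Suc)
qed

lemma eqv_blue:
  assumes "eqv m (U @ V) (U' @ V')" "eqv m (U @ (i, Box 1 True) # V) (U' @ (i', Box 1 True) # V')"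
  shows "eqv m (U @ (i, Box 1 False) # V) (U' @ (i', Box 1 False) # V')"
proof -
  have "cv u ((U @ (i, Box 1 False) # V) @ v) = cv u ((U' @ (i', Box 1 False) # V') @ v)" if "goes k u m"
      for u v
    using assms that cv_blue[of u U i "V @ v"] cv_blue[of u U' i' "V' @ v"] unfolding eqv_def by simp
  then show ?thesis by (simp add: eqv_def)
qed

text \<open>At a turn of a strand the generator sits upright on one leg and upside down on the other. Straightening
  the strand that turns the box moves it from leg to leg. The two half turns of the box, equal by
  isotopy, serve the two shadings.\<close>

lemma slide_cap:
  assumes "Suc (Suc i) \<le> m"
  shows "eqv m [(i, Box 1 c), (i, Cap)] [(Suc i, Box 1 c), (i, Cap)]"
proof -
  have T: "eqv m [(i, Box 1 True), (i, Cap)] [(Suc i, Box 1 True), (i, Cap)]"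
  proof (cases "shade_at s i")
    case Unshaded
    have "eqv m ([] @ [(Suc i, Box 1 True)] @ [(i, Cap)]) ([] @ [(Suc i, Cup), (Suc (Suc i), Box 1 True),
        (Suc (Suc i), Cap)] @ [(i, Cap)])"
      by (rule eqv_context[OF red_rotate(1)]) (use assms Unshaded in \<open>auto simp: shade_at_Suc\<close>)
    also have "eqv m \<dots> ([(Suc i, Cup), (Suc (Suc i), Box 1 True)] @ [(i, Cap), (i, Cap)] @ [])"
      using eqv_context[OF exchange[of Cap Cap i "Suc (Suc i)" "m + 2"], of m
          "[(Suc i, Cup), (Suc (Suc i), Box 1 True)]" "[]"] assms
      by simp
    also have "eqv m \<dots> ([(Suc i, Cup)] @ [(i, Cap), (i, Box 1 True)] @ [(i, Cap)])"
      using eqv_context[OF exchange[of Cap "Box 1 True" i "Suc (Suc i)" "m + 2"], of m "[(Suc i, Cup)]"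
          "[(i, Cap)]"] assms
      by simp
    also have "eqv m \<dots> [(i, Box 1 True), (i, Cap)]"
      using eqv_append[OF straighten(2)[of i m], of "[(i, Box 1 True), (i, Cap)]"] assms by simp
    finally show ?thesis by (simp add: eqv_def)
  next
    case Shaded
    have "eqv m ([] @ [(i, Box 1 True)] @ [(i, Cap)]) ([] @ [(Suc i, Cup), (Suc i, Box 1 True), (i, Cap)]
        @ [(i, Cap)])"
      by (rule eqv_context[OF red_rotate(2)]) (use assms Shaded in auto)
    also have "eqv m \<dots> ([(Suc i, Cup), (Suc i, Box 1 True)] @ [(Suc (Suc i), Cap), (i, Cap)] @ [])"
      using eqv_context[OF exchange[of Cap Cap i "Suc (Suc i)" "m + 2", THEN eqv_sym], of m
          "[(Suc i, Cup), (Suc i, Box 1 True)]" "[]"] assms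
      by simp
    also have "eqv m \<dots> ([(Suc i, Cup)] @ [(Suc (Suc i), Cap), (Suc i, Box 1 True)] @ [(i, Cap)])"
      using eqv_context[OF exchange[of "Box 1 True" Cap "Suc i" "Suc (Suc i)" "m + 2", THEN eqv_sym], of m
          "[(Suc i, Cup)]" "[(i, Cap)]"] assms
      by simp
    also have "eqv m \<dots> [(Suc i, Box 1 True), (i, Cap)]"
      using eqv_append[OF straighten(1)[of "Suc i" m], of "[(Suc i, Box 1 True), (i, Cap)]"] assms by simp
    finally show ?thesis by simp
  qed
  show ?thesis using eqv_blue[of m "[]" "[(i, Cap)]" "[]" "[(i, Cap)]" i "Suc i"] T by (cases c) auto
qed

lemma slide_cup:
  assumes "i \<le> m"
  shows "eqv m [(i, Cup), (i, Box 1 c)] [(i, Cup), (Suc i, Box 1 c)]"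
proof -
  have T: "eqv m [(i, Cup), (i, Box 1 True)] [(i, Cup), (Suc i, Box 1 True)]"
  proof (cases "shade_at s i")
    case Unshaded
    have "eqv m ([(i, Cup)] @ [(Suc i, Box 1 True)] @ []) ([(i, Cup)] @ [(Suc (Suc i), Cup), (Suc (Suc i),
        Box 1 True), (Suc i, Cap)] @ [])"
      by (rule eqv_context[OF red_rotate(2)]) (use assms Unshaded in \<open>auto simp: shade_at_Suc\<close>)
    also have "eqv m \<dots> ([] @ [(i, Cup), (i, Cup)] @ [(Suc (Suc i), Box 1 True), (Suc i, Cap)])"
      using eqv_context[OF exchange[of Cup Cup i i m, THEN eqv_sym], of m "[]"
          "[(Suc (Suc i), Box 1 True), (Suc i, Cap)]"] assms
      by simp
    also have "eqv m \<dots> ([(i, Cup)] @ [(i, Box 1 True), (i, Cup)] @ [(Suc i, Cap)])"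
      using eqv_context[OF exchange[of Cup "Box 1 True" i i "m + 2", THEN eqv_sym], of m "[(i, Cup)]"
          "[(Suc i, Cap)]"] assms
      by simp
    also have "eqv m \<dots> ([(i, Cup), (i, Box 1 True)] @ [] @ [])"
      using eqv_context[OF straighten(1)[of i "m + 2"], of m "[(i, Cup), (i, Box 1 True)]" "[]"] assms by simp
    finally show ?thesis by (simp add: eqv_def)
  next
    case Shaded
    have "eqv m ([(i, Cup)] @ [(i, Box 1 True)] @ []) ([(i, Cup)] @ [(i, Cup), (Suc i, Box 1 True), (Suc
        i, Cap)] @ [])"
      by (rule eqv_context[OF red_rotate(1)]) (use assms Shaded in auto)
    also have "eqv m \<dots> ([] @ [(i, Cup), (Suc (Suc i), Cup)] @ [(Suc i, Box 1 True), (Suc i, Cap)])"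
      using eqv_context[OF exchange[of Cup Cup i i m], of m "[]" "[(Suc i, Box 1 True), (Suc i, Cap)]"] assms
      by simp
    also have "eqv m \<dots> ([(i, Cup)] @ [(Suc i, Box 1 True), (Suc (Suc i), Cup)] @ [(Suc i, Cap)])"
      using eqv_context[OF exchange[of "Box 1 True" Cup "Suc i" "Suc (Suc i)" "m + 2"], of m "[(i, Cup)]"
          "[(Suc i, Cap)]"] assms
      by simp
    also have "eqv m \<dots> ([(i, Cup), (Suc i, Box 1 True)] @ [] @ [])"
      using eqv_context[OF straighten(2)[of "Suc i" "m + 2"], of m "[(i, Cup), (Suc i, Box 1 True)]" "[]"]
          assms by simp
    finally show ?thesis by simp
  qed
  show ?thesis using eqv_blue[of m "[(i, Cup)]" "[]" "[(i, Cup)]" "[]" i "Suc i"] T by (cases c) auto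
qed

end


section \<open>The relations between coloured strands\<close>

lemma relator_mult:
  "relator 1 Unshaded (combination 1 Unshaded [(1, [(0, Box 1 Gen)]), (- 1, [(0, Box 1 Gen), (0, Box 1 Gen)])])"
proof -
  have "mult FA 1 Unshaded freeP freeQ = combination 1 Unshaded (concat (map (\<lambda>(c, w). map (\<lambda>(d, v).
      (c * d, subst [(0, Box 1 1), (0, Box 1 0)] ((!) [w, v]))) (coloured_strand False)) (coloured_strand
          True)))"
    unfolding mult_def freeP_eq freeQ_eq
    by (rule Act_FA_binary) (auto simp: coloured_strand_def)
  then show ?thesis using disagree_PQ by (simp add: coloured_strand_def)
qed

lemma relator_bubble:
  "relator 0 Unshaded (combination 0 Unshaded
     (map (\<lambda>(d, w). (d, (0, Cup) # w @ [(0, Cap)])) (coloured_strand c) @ [(- 1, [])]))"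
  "relator 0 Shaded (combination 0 Shaded
     (map (\<lambda>(d, w). (d, (0, Cup) # shift 1 w @ [(0, Cap)])) (coloured_strand c) @ [(- 1, [])]))"
proof -
  have c: "free_colour c \<in> {freeP, freeQ}" using colour_cases by blast
  have "Act FA 0 Unshaded [(0, Cup), (0, Box 1 0), (0, Cap)] ((!) [free_colour c]) = combination 0 Unshaded
     (map (\<lambda>(d, w). (d, subst [(0, Cup), (0, Box 1 0), (0, Cap)] ((!) [w]))) (coloured_strand c))"
    by (rule Act_FA_unary[where i = 0]) (auto simp: coloured_strand_def)
  then show "relator 0 Unshaded (combination 0 Unshaded
     (map (\<lambda>(d, w). (d, (0, Cup) # w @ [(0, Cap)])) (coloured_strand c) @ [(- 1, [])]))"
    using bubble_shaded[OF c] by (simp add: combination_append vert_FA single_uminus)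
  have "Act FA 0 Shaded [(0, Cup), (1, Box 1 0), (0, Cap)] ((!) [free_colour c]) = combination 0 Shaded
     (map (\<lambda>(d, w). (d, subst [(0, Cup), (1, Box 1 0), (0, Cap)] ((!) [w]))) (coloured_strand c))"
    by (rule Act_FA_unary[where i = 1]) (auto simp: coloured_strand_def)
  then show "relator 0 Shaded (combination 0 Shaded
     (map (\<lambda>(d, w). (d, (0, Cup) # shift 1 w @ [(0, Cap)])) (coloured_strand c) @ [(- 1, [])]))"
    using bubble_unshaded[OF c] by (simp add: combination_append vert_FA single_uminus)
qed

abbreviation negated :: "(complex \<times> 'g diagram) list \<Rightarrow> (complex \<times> 'g diagram) list" where
  "negated G \<equiv> map (\<lambda>(c, w). (- c, w)) G"

lemma combination_negated: "combination k s (negated G) = - combination k s G"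
  by (induction G) (auto simp: single_uminus)

abbreviation pairs :: "(complex \<times> 'g diagram) list \<Rightarrow> (complex \<times> 'g diagram) list
    \<Rightarrow> ('g diagram \<Rightarrow> 'g diagram \<Rightarrow> 'g diagram) \<Rightarrow> (complex \<times> 'g diagram) list" where
  "pairs G H f \<equiv> concat (map (\<lambda>(c, w). map (\<lambda>(d, v). (c * d, f w v)) H) G)"

abbreviation rotated :: "(complex \<times> 'g diagram) list \<Rightarrow> (complex \<times> 'g diagram) list" where
  "rotated G \<equiv> map (\<lambda>(d, w). (d, (0, Cup) # shift 1 w @ [(1, Cap)])) G"

lemma relator_saddle:
  "relator 2 Unshaded (combination 2 Unshaded
     (pairs (coloured_strand c) (coloured_strand c) (\<lambda>w v. w @ [(0, Cap), (0, Cup)] @ v) @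
      negated (pairs (coloured_strand c) (rotated (coloured_strand c)) (\<lambda>w v. w @ shift 1 v))))"
  "relator 2 Shaded (combination 2 Shaded
     (pairs (coloured_strand c) (coloured_strand c) (\<lambda>w v. shift 1 w @ [(0, Cap), (0, Cup)] @ shift 1 v) @
      negated (pairs (rotated (coloured_strand c)) (coloured_strand c) (\<lambda>w v. w @ shift 1 v))))"
proof -
  have c: "free_colour c \<in> {freeP, freeQ}" using colour_cases by blast
  have "Act FA 2 Unshaded [(0, Box 1 0), (0, Cap), (0, Cup), (0, Box 1 1)] ((!) [free_colour c, free_colour c])
     = combination 2 Unshaded (pairs (coloured_strand c) (coloured_strand c)
        (\<lambda>w v. subst [(0, Box 1 0), (0, Cap), (0, Cup), (0, Box 1 1)] ((!) [w, v])))"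
    by (rule Act_FA_binary) (auto simp: coloured_strand_def)
  moreover have "tensor FA 1 Unshaded 1 (free_colour c) (rot FA 1 Unshaded (free_colour c))
     = combination 2 Unshaded (pairs (coloured_strand c) (rotated (coloured_strand c))
        (\<lambda>w v. subst [(0, Box 1 0), (1, Box 1 1)] ((!) [w, v])))"
    unfolding tensor_def rot_colour one_add_one
    by (rule Act_FA_binary) (auto simp: coloured_strand_def)
  ultimately show "relator 2 Unshaded (combination 2 Unshaded
     (pairs (coloured_strand c) (coloured_strand c) (\<lambda>w v. w @ [(0, Cap), (0, Cup)] @ v) @
      negated (pairs (coloured_strand c) (rotated (coloured_strand c)) (\<lambda>w v. w @ shift 1 v))))"
    using saddle_unshaded[OF c] unfolding combination_append combination_negated by simp
  have "Act FA 2 Shaded [(1, Box 1 0), (0, Cap), (0, Cup), (1, Box 1 1)] ((!) [free_colour c, free_colour c])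
     = combination 2 Shaded (pairs (coloured_strand c) (coloured_strand c)
        (\<lambda>w v. subst [(1, Box 1 0), (0, Cap), (0, Cup), (1, Box 1 1)] ((!) [w, v])))"
    by (rule Act_FA_binary) (auto simp: coloured_strand_def)
  moreover have "tensor FA 1 Shaded 1 (rot FA 1 Unshaded (free_colour c)) (free_colour c)
     = combination 2 Shaded (pairs (rotated (coloured_strand c)) (coloured_strand c)
        (\<lambda>w v. subst [(0, Box 1 0), (1, Box 1 1)] ((!) [w, v])))"
    unfolding tensor_def rot_colour one_add_one
    by (rule Act_FA_binary) (auto simp: coloured_strand_def)
  ultimately show "relator 2 Shaded (combination 2 Shaded
     (pairs (coloured_strand c) (coloured_strand c) (\<lambda>w v. shift 1 w @ [(0, Cap), (0, Cup)] @ shift 1 v) @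
      negated (pairs (rotated (coloured_strand c)) (coloured_strand c) (\<lambda>w v. w @ shift 1 v))))"
    using saddle_shaded[OF c] unfolding combination_append combination_negated by simp
qed

context box_type
begin

lemma relator_cv:
  assumes rel: "relator j t (combination j t G)" and t: "shade_at s i = t"
    and fit: "list_all (\<lambda>(c, w). fitting j t w) G" and m: "i + j \<le> m" and u: "goes k u m"
  shows "(\<Sum>(c, l)\<leftarrow>G. scale_PA c (cv (u @ shift i l) v)) = 0"
proof -
  have G: "fitting j t w" if "(c, w) \<in> set G" for c w using fit that by (auto simp: list_all_iff)
  have "(\<Sum>(c, u)\<leftarrow>map (\<lambda>(c, l). (c, u @ shift i l)) G. scale_PA c (diag_PA k s (u @ w))) = 0" for w
  proof (cases "goes m w k \<and> boxes_fit s u \<and> boxes_fit s w")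
    case True
    obtain r where r: "m = i + j + r" using m by (metis le_iff_add)
    have "diag_PA k s (u @ shift i l @ w) = abs_PA (basis_elt k s (u @ shift i l @ w))"
      if "(c, l) \<in> set G" for c l
      using G[OF that] t True u goes_context[of k u i j r l j w k]
      by (simp add: diag_PA_def fitting_iff boxes_fit_shift r)
    then have "(\<Sum>(c, l)\<leftarrow>G. scale_PA c (diag_PA k s (u @ shift i l @ w))) =
        (\<Sum>(c, l)\<leftarrow>G. scale_PA c (abs_PA (basis_elt k s (u @ shift i l @ w))))"
      by (intro arg_cong[of _ _ sum_list] map_cong) auto
    also have "\<dots> = 0"
      by (rule relator_context[OF rel G]) (use True u r t in auto)
    finally show ?thesis by (simp add: comp_def split_def)
  next
    case False
    have "diag_PA k s (u @ shift i l @ w) = 0" if "(c, l) \<in> set G" for c l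
    proof -
      have "goes m (shift i l) m" using G[OF that] goes_shift[of j l j i m] m by (simp add: fitting_iff)
      then have "goes k (u @ shift i l @ w) k \<Longrightarrow> goes m w k"
        using u unfolding goes_append by (metis goes_unique)
      then show ?thesis using False by (auto simp: diag_PA_def fitting_iff)
    qed
    then have "(\<Sum>(c, l)\<leftarrow>G. scale_PA c (diag_PA k s (u @ shift i l @ w))) = (\<Sum>(c, l)\<leftarrow>G. 0)"
      by (intro arg_cong[of _ _ sum_list] map_cong) auto
    then show ?thesis by (simp add: comp_def split_def)
  qed
  from cv_linear[OF this, of v] show ?thesis by (simp add: comp_def split_def)
qed

text \<open>Colour disagreement says \<open>P (1 - P) = 0\<close>. If the shading is on the left, bend the strand so that
  both markings come to its part with the shading on the right.\<close>

lemma red_idempotent: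
  assumes "i < m"
  shows "eqv m [(i, Box 1 True), (i, Box 1 True)] [(i, Box 1 True)]"
proof -
  have U: "eqv m [(i, Box 1 True), (i, Box 1 True)] [(i, Box 1 True)]"
      if "i < m" "shade_at s i = Unshaded" for i m
    unfolding eqv_def
  proof (intro allI impI)
    fix u :: "gen diagram" and v assume "goes k u m"
    from relator_cv[OF relator_mult that(2) _ _ this, of v] that
    show "cv u ([(i, Box 1 True), (i, Box 1 True)] @ v) = cv u ([(i, Box 1 True)] @ v)"
      by (auto simp: fitting_iff red_strand_def)
  qed
  show ?thesis
  proof (cases "shade_at s i")
    case Unshaded
    then show ?thesis using U assms by blast
  next
    case Shaded
    then have S: "shade_at s (Suc i) = Unshaded" by (simp add: shade_at_Suc)
    note rr = red_rotate(1)[OF assms Shaded]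
    have "eqv m [(i, Box 1 True), (i, Box 1 True)] ([] @ [(i, Cup), (Suc i, Box 1 True), (Suc i, Cap)] @
        [(i, Box 1 True)])"
      using eqv_append[OF rr, of "[(i, Box 1 True)]"] by simp
    also have "eqv m \<dots> ([(i, Cup), (Suc i, Box 1 True)] @ [(i, Box 1 True), (Suc i, Cap)] @ [])"
      using eqv_context[OF exchange[of "Box 1 True" Cap i "Suc i" "m + 2"], of m
          "[(i, Cup), (Suc i, Box 1 True)]" "[]"] assms
      by simp
    also have "eqv m \<dots> ([(i, Cup)] @ [(i, Box 1 True), (Suc i, Box 1 True)] @ [(Suc i, Cap)])"
      using eqv_context[OF exchange[of "Box 1 True" "Box 1 True" i "Suc i" "m + 2"], of m "[(i, Cup)]"
          "[(Suc i, Cap)]"] assms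
      by simp
    also have "eqv m \<dots> ([] @ [(i, Cup), (Suc i, Box 1 True)] @ [(Suc i, Box 1 True), (Suc i, Cap)])"
      using eqv_context[OF slide_cup[of i m True], of m "[]" "[(Suc i, Box 1 True), (Suc i, Cap)]"] assms
          by simp
    also have "eqv m \<dots> ([(i, Cup)] @ [(Suc i, Box 1 True)] @ [(Suc i, Cap)])"
      using eqv_context[OF U[of "Suc i" "m + 2"], of m "[(i, Cup)]" "[(Suc i, Cap)]"] assms S by simp
    also have "eqv m \<dots> [(i, Box 1 True)]" using eqv_sym[OF rr] by simp
    finally show ?thesis .
  qed
qed

lemma colour_idempotent:
  assumes "i < m"
  shows "eqv m [(i, Box 1 c), (i, Box 1 c)] [(i, Box 1 c)]"
proof (cases c)
  case False
  then show ?thesis using red_idempotent[OF assms] cv_blue[of _ "[]" i] cv_blue[of _ "[(i, Box 1 True)]" i]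
     cv_blue[of _ "[(i, Box 1 False)]" i]
    unfolding eqv_def by simp
qed (use red_idempotent[OF assms] in simp)

lemma colour_clash:
  assumes "i < m" "c \<noteq> d"
  shows "null m [(i, Box 1 c), (i, Box 1 d)]"
  using red_idempotent[OF assms(1)] assms(2) cv_blue[of _ "[]" i] cv_blue[of _ "[(i, Box 1 True)]" i]
  unfolding eqv_def null_def by (cases c; cases d) simp_all

lemma bubble:
  assumes "i \<le> m"
  shows "eqv m [(i, Cup), (i, Box 1 c), (i, Cap)] []"
proof (cases "shade_at s i")
  case Unshaded
  show ?thesis unfolding eqv_def
  proof (intro allI impI)
    fix u :: "gen diagram" and v assume "goes k u m"
    from relator_cv[OF relator_bubble(1) Unshaded _ _ this, of c v] assms
    show "cv u ([(i, Cup), (i, Box 1 c), (i, Cap)] @ v) = cv u ([] @ v)"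
      by (cases c) (auto simp: coloured_strand_def fitting_iff red_strand_def Unshaded algebra_simps)
  qed
next
  case Shaded
  have "eqv m [(i, Cup), (Suc i, Box 1 c), (i, Cap)] []" unfolding eqv_def
  proof (intro allI impI)
    fix u :: "gen diagram" and v assume "goes k u m"
    from relator_cv[OF relator_bubble(2) Shaded _ _ this, of c v] assms
    show "cv u ([(i, Cup), (Suc i, Box 1 c), (i, Cap)] @ v) = cv u ([] @ v)"
      by (cases c) (auto simp: coloured_strand_def fitting_iff red_strand_def Shaded shade_at_Suc algebra_simps)
  qed
  moreover have "eqv m [(i, Cup), (i, Box 1 c), (i, Cap)] [(i, Cup), (Suc i, Box 1 c), (i, Cap)]"
    using eqv_append[OF slide_cup[OF assms], of c "[(i, Cap)]"] by simp
  ultimately show ?thesis by (simp add: eqv_def)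
qed

lemma saddle:
  assumes "Suc (Suc i) \<le> m"
  shows "eqv m [(i, Box 1 c), (i, Cap), (i, Cup), (i, Box 1 c)] [(i, Box 1 c), (Suc i, Box 1 c)]"
proof (cases "shade_at s i")
  case Unshaded
  then have S: "shade_at s (Suc i) = Shaded" by (simp add: shade_at_Suc)
  show ?thesis unfolding eqv_def
  proof (intro allI impI)
    fix u :: "gen diagram" and v assume u: "goes k u m"
    have st0: "cv (u @ [(Suc i, Cup), (Suc (Suc i), Cap)] @ w) v = cv (u @ [] @ w) v" if "goes k u m" for u w v
      using diag_PA_isotopic[OF isotopic_move[OF move.straighten_left] _ that] assms by (intro cv_cong) simp
    have "goes k (u @ [(i, Box 1 Gen)]) m" using u assms by (auto simp: goes_append)
    from st0[OF u] st0[OF this]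
    have st: "cv (u @ (Suc i, Cup) # (Suc (Suc i), Cap) # w) v = cv (u @ w) v"
      "cv (u @ (i, Box 1 Gen) # (Suc i, Cup) # (Suc (Suc i), Cap) # w) v = cv (u @ (i, Box 1 Gen) # w) v"
          for w v
      by simp_all
    from relator_cv[OF relator_saddle(1) Unshaded _ _ u, of c v] assms
    show "cv u ([(i, Box 1 c), (i, Cap), (i, Cup), (i, Box 1 c)] @ v)
        = cv u ([(i, Box 1 c), (Suc i, Box 1 c)] @ v)"
      using st[unfolded One_nat_def] st(1)[of "[]"] by (cases c)
          (auto simp: coloured_strand_def fitting_iff red_strand_def Unshaded S shade_at_Suc algebra_simps)
  qed
next
  case Shaded
  then have S: "shade_at s (Suc i) = Unshaded" by (simp add: shade_at_Suc)
  have "eqv m [(Suc i, Box 1 c), (i, Cap), (i, Cup), (Suc i, Box 1 c)] [(i, Box 1 c), (Suc i, Box 1 c)]"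
    unfolding eqv_def
  proof (intro allI impI)
    fix u :: "gen diagram" and v assume u: "goes k u m"
    have st: "cv (u @ (i, Cup) # (Suc i, Cap) # w) v = cv (u @ w) v" for w v
    proof -
      have "cv (u @ [(i, Cup), (Suc i, Cap)] @ w) v = cv (u @ [] @ w) v"
        using diag_PA_isotopic[OF isotopic_move[OF move.straighten_left] _ u] assms by (intro cv_cong) simp
      then show ?thesis by simp
    qed
    from relator_cv[OF relator_saddle(2) Shaded _ _ u, of c v] assms
    show "cv u ([(Suc i, Box 1 c), (i, Cap), (i, Cup), (Suc i, Box 1 c)] @ v)
        = cv u ([(i, Box 1 c), (Suc i, Box 1 c)] @ v)"
      using st st[of "[]"] by (cases c) (auto simp: coloured_strand_def fitting_iff red_strand_def Shaded
          S shade_at_Suc algebra_simps)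
  qed
  moreover have "eqv m [(i, Box 1 c), (i, Cap), (i, Cup), (i, Box 1 c)] [(Suc i, Box 1 c), (i, Cap), (i,
      Cup), (Suc i, Box 1 c)]"
    using eqv_append[OF slide_cap[OF assms, of c], of "[(i, Cup), (i, Box 1 c)]"]
      eqv_context[OF slide_cup[of i "m - 2" c], of m "[(Suc i, Box 1 c), (i, Cap)]" "[]"] assms
    by (auto simp: eqv_def)
  ultimately show ?thesis by (simp add: eqv_def)
qed

end


section \<open>Propagation of colours\<close>

fun marks :: "nat \<Rightarrow> bool list \<Rightarrow> bool diagram" where
  "marks i [] = []"
| "marks i (c # x) = (i, Box 1 c) # marks (Suc i) x"

lemma marks_append: "marks i (x @ y) = marks i x @ marks (i + length x) y"
  by (induction x arbitrary: i) auto

lemma goes_marks: "i + length x \<le> m \<Longrightarrow> goes m (marks i x @ w) n \<longleftrightarrow> goes m w n"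
  by (induction x arbitrary: i) auto

lemma goes_marks' [simp]: "i + length x \<le> m \<Longrightarrow> goes m (marks i x) n \<longleftrightarrow> m = n"
  using goes_marks[of i x m "[]" n] by simp

context box_type
begin

lemma eqv_Cons: "eqv m l r \<Longrightarrow> goes m' [p] m \<Longrightarrow> eqv m' (p # l) (p # r)"
  using eqv_prefix[of m l r m' "[p]"] by simp

lemma marks_exchange_above:
  assumes "elementary a" "i + ins a \<le> j" "j + length x \<le> m"
  shows "eqv m (marks j x @ [(i, a)]) ((i, a) # marks (j - ins a + outs a) x)"
  using assms(2,3)
proof (induction x arbitrary: j)
  case (Cons c x)
  have "eqv m (marks j (c # x) @ [(i, a)]) ((j, Box 1 c) # (i, a) # marks (Suc j - ins a + outs a) x)"
    using eqv_Cons[OF Cons.IH[of "Suc j"], of m "(j, Box 1 c)"] Cons.prems by simp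
  also have "eqv m \<dots> ([(i, a), (j - ins a + outs a, Box 1 c)] @ marks (Suc j - ins a + outs a) x)"
    using eqv_append[OF exchange[OF assms(1), of "Box 1 c" i j m]] Cons.prems by simp
  also have "Suc j - ins a + outs a = Suc (j - ins a + outs a)" using Cons.prems by simp
  finally show ?case by simp
qed simp

lemma marks_exchange_below:
  assumes "elementary a" "i + length x \<le> j" "j + ins a \<le> m"
  shows "eqv m (marks i x @ [(j, a)]) ((j, a) # marks i x)"
  using assms(2,3)
proof (induction x arbitrary: i)
  case (Cons c x)
  have "eqv m (marks i (c # x) @ [(j, a)]) ((i, Box 1 c) # (j, a) # marks (Suc i) x)"
    using eqv_Cons[OF Cons.IH[of "Suc i"], of m "(i, Box 1 c)"] Cons.prems by simp
  also have "eqv m \<dots> ([(j, a), (i, Box 1 c)] @ marks (Suc i) x)"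
    using eqv_append[OF eqv_sym[OF exchange[of "Box 1 c" a i j m]], of "marks (Suc i) x"] assms(1)
        Cons.prems by simp
  finally show ?case by simp
qed simp

lemma marks_product:
  assumes "Suc i + length x \<le> m"
  shows "eqv m (marks i (c # x) @ marks i (d # y)) ([(i, Box 1 c), (i, Box 1 d)] @ marks (Suc i) x @ marks
      (Suc i) y)"
  using eqv_context[OF marks_exchange_above[of "Box 1 d" i "Suc i" x m], of m "[(i, Box 1 c)]"
      "marks (Suc i) y"] assms
  by simp

lemma marks_idempotent:
  assumes "i + length x \<le> m"
  shows "eqv m (marks i x @ marks i x) (marks i x)"
  using assms
proof (induction x arbitrary: i)
  case (Cons c x)
  have "eqv m (marks i (c # x) @ marks i (c # x)) ([(i, Box 1 c), (i, Box 1 c)] @ marks (Suc i) x @ marks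
      (Suc i) x)"
    using Cons.prems by (intro marks_product) simp
  also have "eqv m \<dots> ([(i, Box 1 c)] @ (marks (Suc i) x @ marks (Suc i) x))"
    using eqv_append[OF colour_idempotent[of i m c]] Cons.prems by simp
  also have "eqv m \<dots> ([(i, Box 1 c)] @ marks (Suc i) x)"
    by (rule eqv_prefix[OF Cons.IH]) (use Cons.prems in auto)
  finally show ?case by simp
qed simp

lemma marks_clash:
  assumes "i + length x \<le> m" "length x = length y" "x \<noteq> y"
  shows "null m (marks i x @ marks i y)"
  using assms(2,1,3)
proof (induction x y arbitrary: i rule: list_induct2)
  case (Cons c x d y)
  have "null m ([(i, Box 1 c), (i, Box 1 d)] @ marks (Suc i) x @ marks (Suc i) y)"
  proof (cases "c = d")
    case True
    then have "null m (marks (Suc i) x @ marks (Suc i) y)" using Cons by simp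
    then show ?thesis
      using null_context[of m "marks (Suc i) x @ marks (Suc i) y" m "[(i, Box 1 c), (i, Box 1 d)]" "[]"]
          Cons.prems
      by simp
  next
    case False
    then show ?thesis
      using null_context[OF colour_clash[of i m c d], of m "[]" "marks (Suc i) x @ marks (Suc i) y"]
          Cons.prems by simp
  qed
  then show ?case by (rule null_eqv[OF marks_product, rotated]) (use Cons in simp)
qed simp

lemma marks_mark:
  assumes "length (p @ d # q) = m"
  shows "eqv m (marks 0 (p @ d # q) @ [(length p, Box 1 c)])
    (marks 0 p @ [(length p, Box 1 d), (length p, Box 1 c)] @ marks (Suc (length p)) q)"
  using eqv_prefix[OF marks_exchange_above[of "Box 1 c" "length p" "Suc (length p)" q m], of m
      "marks 0 p @ [(length p, Box 1 d)]"] assms by (simp add: marks_append goes_marks)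

lemma absorb_right:
  assumes "length (p @ c # q) = m"
  shows "eqv m (marks 0 (p @ c # q) @ [(length p, Box 1 c)]) (marks 0 (p @ c # q))"
proof -
  have "eqv m (marks 0 p @ [(length p, Box 1 c), (length p, Box 1 c)] @ marks (Suc (length p)) q)
     (marks 0 p @ [(length p, Box 1 c)] @ marks (Suc (length p)) q)"
    by (rule eqv_context[OF colour_idempotent]) (use assms in auto)
  with marks_mark[OF assms, of c] show ?thesis using eqv_trans by (simp add: marks_append)
qed

lemma clash_right:
  assumes "length (p @ d # q) = m" "c \<noteq> d"
  shows "null m (marks 0 (p @ d # q) @ [(length p, Box 1 c)])"
proof (rule null_eqv[OF marks_mark[OF assms(1)]])
  show "null m (marks 0 p @ [(length p, Box 1 d), (length p, Box 1 c)] @ marks (Suc (length p)) q)"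
    by (rule null_context[OF colour_clash]) (use assms in auto)
qed

lemma absorb_left:
  assumes "length (p @ c # q) = m"
  shows "eqv m ((length p, Box 1 c) # marks 0 (p @ c # q)) (marks 0 (p @ c # q))"
proof -
  have "eqv m ([] @ ((length p, Box 1 c) # marks 0 p) @ (length p, Box 1 c) # marks (Suc (length p)) q)
      ([] @ (marks 0 p @ [(length p, Box 1 c)]) @ (length p, Box 1 c) # marks (Suc (length p)) q)"
    by (intro eqv_context eqv_sym[OF marks_exchange_below]) (use assms in auto)
  also have "eqv m \<dots> (marks 0 p @ [(length p, Box 1 c), (length p, Box 1 c)] @ marks (Suc (length p)) q)"
      by simp
  also have "eqv m \<dots> (marks 0 p @ [(length p, Box 1 c)] @ marks (Suc (length p)) q)"
    by (rule eqv_context[OF colour_idempotent]) (use assms in auto)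
  finally show ?thesis by (simp add: marks_append)
qed

lemma absorb_marks_right:
  assumes "length (p @ x @ q) = m"
  shows "eqv m (marks 0 (p @ x @ q) @ marks (length p) x) (marks 0 (p @ x @ q))"
  using assms
proof (induction x arbitrary: p)
  case (Cons c x)
  have "eqv m (marks 0 (p @ c # x @ q) @ [(length p, Box 1 c)] @ marks (Suc (length p)) x)
      (marks 0 (p @ c # x @ q) @ marks (Suc (length p)) x)"
    using eqv_append[OF absorb_right[of p c "x @ q" m], of "marks (Suc (length p)) x"] Cons.prems by simp
  also have "eqv m \<dots> (marks 0 (p @ c # x @ q))" using Cons.IH[of "p @ [c]"] Cons.prems by simp
  finally show ?case by simp
qed simp

lemma absorb_marks_left:
  assumes "length (p @ x @ q) = m"
  shows "eqv m (marks (length p) x @ marks 0 (p @ x @ q)) (marks 0 (p @ x @ q))"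
  using assms
proof (induction x arbitrary: p)
  case (Cons c x)
  have "eqv m ([(length p, Box 1 c)] @ marks (Suc (length p)) x @ marks 0 (p @ c # x @ q))
      ([(length p, Box 1 c)] @ marks 0 (p @ c # x @ q))"
    using eqv_prefix[OF Cons.IH[of "p @ [c]"], of m "[(length p, Box 1 c)]"] Cons.prems by simp
  also have "eqv m \<dots> (marks 0 (p @ c # x @ q))" using absorb_left[of p c "x @ q" m] Cons.prems by simp
  finally show ?case by simp
qed simp

text \<open>Markings are idempotent, so a second copy of them can be split off and moved upwards: the outer ones
  pass beside the cap, and the two under the cap are absorbed again.\<close>

lemma marks_Cap:
  fixes p q :: "bool list"
  defines "i \<equiv> length p"
  assumes "m = length p + length q + 2"
  shows "eqv m (marks 0 (p @ c # c # q) @ [(i, Cap)]) (marks 0 (p @ c # c # q) @ [(i, Cap)] @ marks 0 (p @ q))"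
proof -
  let ?x = "p @ c # c # q" and ?C = "[(i, Box 1 c), (Suc i, Box 1 c)]"
  have len: "length ?x = m" using assms by simp
  have "eqv m (marks 0 ?x @ [(i, Cap)]) (marks 0 ?x @ marks 0 ?x @ [(i, Cap)])"
    using eqv_append[OF eqv_sym[OF marks_idempotent[of 0 ?x m]], of "[(i, Cap)]"] len by simp
  also have "eqv m \<dots> ((marks 0 ?x @ marks 0 p @ ?C) @ (marks (Suc (Suc i)) q @ [(i, Cap)]) @ [])"
    by (simp add: marks_append i_def)
  also have "eqv m \<dots> ((marks 0 ?x @ marks 0 p @ ?C) @ ((i, Cap) # marks i q) @ [])"
    by (rule eqv_context[of m]) (use marks_exchange_above[of Cap i "Suc (Suc i)" q m] assms in \<open>auto simp:
        goes_marks\<close>)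
  also have "eqv m \<dots> ((marks 0 ?x) @ (marks 0 p @ [(i, Box 1 c)]) @ [(Suc i, Box 1 c), (i, Cap)] @ marks i q)"
    by simp
  also have "eqv m \<dots> ((marks 0 ?x) @ ((i, Box 1 c) # marks 0 p) @ [(Suc i, Box 1 c), (i, Cap)] @ marks i q)"
    by (rule eqv_context[of m], rule marks_exchange_below) (use assms in auto)
  also have "eqv m \<dots> ((marks 0 ?x @ [(i, Box 1 c)]) @ (marks 0 p @ [(Suc i, Box 1 c)]) @ [(i, Cap)] @
      marks i q)"
    by simp
  also have "eqv m \<dots> ((marks 0 ?x @ [(i, Box 1 c)]) @ ((Suc i, Box 1 c) # marks 0 p) @ [(i, Cap)] @ marks i q)"
    by (rule eqv_context[of m], rule marks_exchange_below) (use assms in \<open>auto simp: goes_marks\<close>)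
  also have "eqv m \<dots> ((marks 0 ?x @ ?C) @ (marks 0 p @ [(i, Cap)]) @ marks i q)"
    by simp
  also have "eqv m \<dots> ((marks 0 ?x @ ?C) @ ((i, Cap) # marks 0 p) @ marks i q)"
    by (rule eqv_context[of m], rule marks_exchange_below) (use assms in \<open>auto simp: goes_marks\<close>)
  also have "eqv m \<dots> ([] @ (marks 0 ?x @ marks i [c, c]) @ [(i, Cap)] @ marks 0 (p @ q))"
    by (simp add: marks_append i_def)
  also have "eqv m \<dots> ([] @ marks 0 ?x @ [(i, Cap)] @ marks 0 (p @ q))"
    by (rule eqv_context[of m]) (use absorb_marks_right[of p "[c, c]" q m] assms in auto)
  finally show ?thesis by simp
qed

lemma marks_Cap_clash:
  assumes "c \<noteq> d" "m = length p + length q + 2"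
  shows "null m (marks 0 (p @ c # d # q) @ [(length p, Cap)])"
proof -
  let ?x = "p @ c # d # q"
  have "eqv m (marks 0 ?x @ [(length p, Cap)]) (marks 0 ?x @ [(length p, Box 1 c), (length p, Cap)])"
    using eqv_append[OF eqv_sym[OF absorb_right[of p c "d # q" m]], of "[(length p, Cap)]"] assms by simp
  also have "eqv m \<dots> ((marks 0 ?x @ [(Suc (length p), Box 1 c)]) @ [(length p, Cap)])"
    using eqv_prefix[OF slide_cap[of "length p" m c], of m "marks 0 ?x"] assms by simp
  finally show ?thesis
  proof (rule null_eqv)
    show "null m ((marks 0 ?x @ [(Suc (length p), Box 1 c)]) @ [(length p, Cap)])"
      using null_context[OF clash_right[of "p @ [c]" d q m c], of m "[]" "[(length p, Cap)]"] assms by simp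
  qed
qed

lemma marks_Cup_Cup:
  fixes p q :: "bool list"
  defines "i \<equiv> length p"
  assumes "m = length p + length q"
  shows "eqv m (marks 0 (p @ q) @ [(i, Cup)]) ((i, Cup) # marks 0 p @ marks (Suc (Suc i)) q)"
proof -
  have "eqv m (marks 0 p @ (marks i q @ [(i, Cup)])) (marks 0 p @ ((i, Cup) # marks (Suc (Suc i)) q))"
    by (rule eqv_prefix[of m]) (use marks_exchange_above[of Cup i i q m] assms in auto)
  also have "eqv m \<dots> ([] @ (marks 0 p @ [(i, Cup)]) @ marks (Suc (Suc i)) q)" by simp
  also have "eqv m \<dots> ([] @ ((i, Cup) # marks 0 p) @ marks (Suc (Suc i)) q)"
    by (rule eqv_context[of m], rule marks_exchange_below) (use assms in auto)
  finally show ?thesis by (simp add: marks_append i_def)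
qed

lemma Cup_marks:
  fixes p q :: "bool list"
  defines "i \<equiv> length p"
  assumes "m = length p + length q"
  shows "eqv m ((i, Cup) # marks 0 (p @ c # c # q)) (marks 0 (p @ q) @ [(i, Cup)] @ marks 0 (p @ c # c # q))"
proof -
  let ?x = "p @ c # c # q"
  have "eqv m (marks 0 (p @ q) @ [(i, Cup)] @ marks 0 ?x) (((i, Cup) # marks 0 p @ marks (Suc (Suc i)) q)
      @ marks 0 ?x)"
    using eqv_append[OF marks_Cup_Cup[OF assms(2)], of "marks 0 ?x"] by (simp add: i_def)
  also have "eqv m \<dots> (((i, Cup) # marks 0 p) @ (marks (Suc (Suc i)) q @ marks 0 ?x))" by simp
  also have "eqv m \<dots> (((i, Cup) # marks 0 p) @ marks 0 ?x)"
    by (rule eqv_prefix[of "m + 2"])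
      (use absorb_marks_left[of "p @ [c, c]" q "[]" "m + 2"] assms in auto)
  also have "eqv m \<dots> ([(i, Cup)] @ (marks 0 p @ marks 0 ?x))" by simp
  also have "eqv m \<dots> ([(i, Cup)] @ marks 0 ?x)"
    by (rule eqv_prefix[of "m + 2"])
      (use absorb_marks_left[of "[]" p "c # c # q" "m + 2"] assms in auto)
  finally show ?thesis by (simp add: eqv_def)
qed

lemma marks_Cup:
  fixes p q :: "bool list"
  defines "i \<equiv> length p"
  assumes "m = length p + length q"
  shows "eqv m (marks 0 (p @ q) @ [(i, Cup), (i, Box 1 c)])
    (marks 0 (p @ q) @ [(i, Cup)] @ marks 0 (p @ c # c # q))"
proof -
  let ?y = "p @ q"
  have il: "i \<le> m" using assms by simp
  have C: "eqv m [(i, Cup), (i, Box 1 c)] [(i, Cup), (i, Box 1 c), (Suc i, Box 1 c)]"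
  proof -
    have "eqv m [(i, Cup), (i, Box 1 c)] ([(i, Cup)] @ [(i, Box 1 c), (i, Box 1 c)])"
      using eqv_sym[OF eqv_prefix[OF colour_idempotent[of i "m + 2" c], of m "[(i, Cup)]"]] il by simp
    also have "eqv m \<dots> ([(i, Cup), (Suc i, Box 1 c)] @ [(i, Box 1 c)])"
      using eqv_append[OF slide_cup[OF il], of c "[(i, Box 1 c)]"] by simp
    also have "eqv m \<dots> ([(i, Cup)] @ [(i, Box 1 c), (Suc i, Box 1 c)])"
      using eqv_prefix[OF exchange[of "Box 1 c" "Box 1 c" i "Suc i" "m + 2"], of m "[(i, Cup)]"] il by simp
    finally show ?thesis by simp
  qed
  have "eqv m (marks 0 ?y @ [(i, Cup), (i, Box 1 c)]) (marks 0 ?y @ [(i, Cup), (i, Box 1 c), (Suc i, Box 1 c)])"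
    by (rule eqv_prefix[OF C]) (use assms in auto)
  also have "eqv m \<dots> (marks 0 ?y @ marks 0 ?y @ [(i, Cup), (i, Box 1 c), (Suc i, Box 1 c)])"
    using eqv_append[OF eqv_sym[OF marks_idempotent[of 0 ?y m]]] assms by simp
  also have "eqv m \<dots> (marks 0 ?y @ (marks 0 ?y @ [(i, Cup)]) @ [(i, Box 1 c), (Suc i, Box 1 c)])" by simp
  also have "eqv m \<dots> (marks 0 ?y @ ((i, Cup) # marks 0 p @ marks (Suc (Suc i)) q) @ [(i, Box 1 c), (Suc i,
      Box 1 c)])"
    by (rule eqv_context[of m]) (use marks_Cup_Cup[OF assms(2)] assms in auto)
  also have "eqv m \<dots> ((marks 0 ?y @ (i, Cup) # marks 0 p) @ (marks (Suc (Suc i)) q @ [(i, Box 1 c)]) @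
      [(Suc i, Box 1 c)])"
    by simp
  also have "eqv m \<dots> ((marks 0 ?y @ (i, Cup) # marks 0 p) @ ((i, Box 1 c) # marks (Suc (Suc i)) q) @ [(Suc
      i, Box 1 c)])"
    by (rule eqv_context[of "m + 2"])
      (use marks_exchange_above[of "Box 1 c" i "Suc (Suc i)" q "m + 2"] assms in \<open>auto simp: goes_marks\<close>)
  also have "eqv m \<dots> ((marks 0 ?y @ (i, Cup) # marks 0 p @ [(i, Box 1 c)]) @ (marks (Suc (Suc i)) q @
      [(Suc i, Box 1 c)]) @ [])"
    by simp
  also have "eqv m \<dots> ((marks 0 ?y @ (i, Cup) # marks 0 p @ [(i, Box 1 c)]) @ ((Suc i, Box 1 c) # marks
      (Suc (Suc i)) q) @ [])"
    by (rule eqv_context[of "m + 2"])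
      (use marks_exchange_above[of "Box 1 c" "Suc i" "Suc (Suc i)" q "m + 2"] assms in \<open>auto simp: goes_marks\<close>)
  finally show ?thesis by (simp add: marks_append i_def)
qed

end


section \<open>Reduction to alternating colourings\<close>

text \<open>Neighbouring strands of equal colour are capped off while the colouring is read from left to
  right; the first argument is the stack of the strands left over so far, its top first. By the bubble
  and saddle relations each of these caps is invertible on the coloured strands. The fixed order of the
  cancellations replaces a confluence argument by the single lemma \<open>reduce_Cup\<close> below.\<close>

fun reduce :: "bool list \<Rightarrow> bool list \<Rightarrow> bool diagram" where
  "reduce r [] = []"
| "reduce [] (c # x) = reduce [c] x"
| "reduce (d # r) (c # x) = (if c = d then (length r, Cap) # reduce r x else reduce (c # d # r) x)"

fun normal_form :: "bool list \<Rightarrow> bool list \<Rightarrow> bool list" where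
  "normal_form r [] = rev r"
| "normal_form [] (c # x) = normal_form [c] x"
| "normal_form (d # r) (c # x) = (if c = d then normal_form r x else normal_form (c # d # r) x)"

lemma goes_reduce: "goes (length r + length x) (reduce r x) (length (normal_form r x))"
  by (induction r x rule: reduce.induct) auto

text \<open>The isomorphism from \<open>x\<close> to \<open>y\<close> through their common normal form.\<close>

definition connect :: "bool list \<Rightarrow> bool list \<Rightarrow> bool diagram" where
  "connect x y = marks 0 x @ reduce [] x @ reflect (reduce [] y) @ marks 0 y"

context box_type
begin

text \<open>A new pair of neighbours of equal colour does not affect the reduction. Either the pair cancels
  itself, which is a bubble, or its left strand cancels the top of the stack and its right strand takes
  that place, which straightens a strand. The stack has no equal neighbours, so after the second kind of
  cancellation the right strand is indeed pushed.\<close>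

lemma reduce_Cup:
  assumes "distinct_adj r" "i = length r + length p" "m = length r + length p + length q"
  shows "eqv m (marks 0 (rev r @ p @ q) @ [(i, Cup), (i, Box 1 c)] @ reduce r (p @ c # c # q))
    (marks 0 (rev r @ p @ q) @ reduce r (p @ q))"
  using assms
proof (induction p arbitrary: r m i)
  case Nil
  let ?M = "marks 0 (rev r @ q)"
  have bub: ?case if "reduce r (c # c # q) = (length r, Cap) # reduce r q"
  proof -
    have "eqv m (?M @ [(i, Cup), (i, Box 1 c), (i, Cap)] @ reduce r q) (?M @ [] @ reduce r q)"
      by (rule eqv_context[OF bubble]) (use Nil in auto)
    then show ?thesis using that Nil by simp
  qed
  show ?case
  proof (cases r)
    case Nil
    then show ?thesis by (intro bub) simp
  next
    case (Cons d r')
    show ?thesis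
    proof (cases "c = d")
      case False
      then show ?thesis by (intro bub) (simp add: Cons)
    next
      case True
      let ?j = "length r'"
      have i: "i = Suc ?j" "m = length r' + length q + 1" "?j < m" using Nil.prems Cons by auto
      have "reduce r' (c # q) = reduce (c # r') q"
        using Nil.prems(1) True Cons by (cases r') (auto simp: distinct_adj_def)
      then have r: "reduce r (c # c # q) = (?j, Cap) # reduce r q" using True Cons by simp
      have "eqv m (?M @ [(i, Cup)] @ [(i, Box 1 c), (?j, Cap)] @ reduce r q)
         (?M @ [(i, Cup)] @ [(?j, Box 1 c), (?j, Cap)] @ reduce r q)"
        using eqv_context[OF eqv_sym[OF slide_cap[of ?j "m + 2" c]], of m "?M @ [(i, Cup)]" "reduce r q"] i Cons
        by (auto simp: goes_marks)
      also have "eqv m \<dots> (?M @ [(i, Cup), (?j, Box 1 c)] @ (?j, Cap) # reduce r q)" by simp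
      also have "eqv m \<dots> (?M @ [(?j, Box 1 c), (i, Cup)] @ (?j, Cap) # reduce r q)"
        using eqv_context[OF exchange[of "Box 1 c" Cup ?j i m], of m ?M "(?j, Cap) # reduce r q"] i Cons
        by (auto simp: goes_marks)
      also have "eqv m \<dots> ((?M @ [(?j, Box 1 c)]) @ [(Suc ?j, Cup), (?j, Cap)] @ reduce r q)" using i by simp
      also have "eqv m \<dots> ((?M @ [(?j, Box 1 c)]) @ [] @ reduce r q)"
        by (rule eqv_context[OF straighten(2)]) (use i Cons in \<open>auto simp: goes_marks\<close>)
      also have "eqv m \<dots> (?M @ reduce r q)"
        using eqv_append[OF absorb_right[of "rev r'" c q m], of "reduce r q"] i Cons True by simp
      finally show ?thesis using r by simp
    qed
  qed
next
  case (Cons a p)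
  have push: ?case if "distinct_adj (a # r)" "\<And>z. reduce r (a # z) = reduce (a # r) z"
    using Cons.IH[of "a # r" i m] Cons.prems that by simp
  show ?case
  proof (cases r)
    case Nil
    then show ?thesis by (intro push) auto
  next
    case (Cons d r')
    show ?thesis
    proof (cases "a = d")
      case False
      then show ?thesis using Cons.prems(1) Cons by (intro push) auto
    next
      case True
      let ?j = "length r'" and ?M = "marks 0 (rev r' @ d # d # p @ q)" and ?Y = "marks 0 (rev r' @ p @ q)"
      let ?i = "length r' + length p"
      have i: "i = ?i + 2" "m = ?j + length p + length q + 2" using Cons.prems Cons by auto
      have da: "distinct_adj r'" using Cons.prems(1) Cons by (cases r') auto
      have red: "reduce r (a # z) = (?j, Cap) # reduce r' z" for z using True Cons by simp
      have M: "rev r @ (a # p) @ q = rev r' @ d # d # p @ q" using True Cons by simp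
      have cap: "eqv m (?M @ [(?j, Cap)]) (?M @ [(?j, Cap)] @ ?Y)"
        using marks_Cap[of m "rev r'" "p @ q" d] i by simp
      have "eqv m ((?M @ [(i, Cup)]) @ [(i, Box 1 c), (?j, Cap)] @ reduce r' (p @ c # c # q))
         ((?M @ [(i, Cup)]) @ [(?j, Cap), (?i, Box 1 c)] @ reduce r' (p @ c # c # q))"
        using eqv_context[OF exchange[of Cap "Box 1 c" ?j i "m + 2"], of m "?M @ [(i, Cup)]"
            "reduce r' (p @ c # c # q)"] i
        by (auto simp: goes_marks)
      also have "eqv m \<dots> (?M @ [(i, Cup), (?j, Cap)] @ (?i, Box 1 c) # reduce r' (p @ c # c # q))" by simp
      also have "eqv m \<dots> (?M @ [(?j, Cap), (?i, Cup)] @ (?i, Box 1 c) # reduce r' (p @ c # c # q))"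
        using eqv_context[OF exchange[of Cap Cup ?j i m], of m ?M "(?i, Box 1 c) # reduce r' (p @ c # c # q)"] i
        by (auto simp: goes_marks)
      also have "eqv m \<dots> ((?M @ [(?j, Cap)]) @ [(?i, Cup), (?i, Box 1 c)] @ reduce r' (p @ c # c # q))" by simp
      also have "eqv m \<dots> ((?M @ [(?j, Cap)] @ ?Y) @ [(?i, Cup), (?i, Box 1 c)] @ reduce r' (p @ c # c # q))"
        by (rule eqv_append[OF cap])
      also have "eqv m \<dots> ((?M @ [(?j, Cap)]) @ ?Y @ [(?i, Cup), (?i, Box 1 c)] @ reduce r' (p @ c # c #
          q))" by simp
      also have "eqv m \<dots> ((?M @ [(?j, Cap)]) @ ?Y @ reduce r' (p @ q))"
        by (rule eqv_prefix[OF Cons.IH[OF da refl refl]]) (use i in \<open>auto simp: goes_marks\<close>)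
      also have "eqv m \<dots> ((?M @ [(?j, Cap)] @ ?Y) @ reduce r' (p @ q))" by simp
      also have "eqv m \<dots> ((?M @ [(?j, Cap)]) @ reduce r' (p @ q))"
        by (rule eqv_append[OF eqv_sym[OF cap]])
      finally show ?thesis unfolding M using red by simp
    qed
  qed
qed

lemma marks_saddle:
  assumes "m = length p + length q + 2"
  shows "eqv m (marks 0 (p @ c # c # q) @ [(length p, Cap), (length p, Cup), (length p, Box 1 c)]) (marks
      0 (p @ c # c # q))"
proof -
  let ?x = "p @ c # c # q" and ?i = "length p"
  have "eqv m (marks 0 ?x @ [(?i, Cap), (?i, Cup), (?i, Box 1 c)])
     ((marks 0 ?x @ [(?i, Box 1 c)]) @ [(?i, Cap), (?i, Cup), (?i, Box 1 c)])"
    by (rule eqv_append[OF eqv_sym[OF absorb_right]]) (use assms in simp)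
  also have "eqv m \<dots> (marks 0 ?x @ [(?i, Box 1 c), (?i, Cap), (?i, Cup), (?i, Box 1 c)])" by simp
  also have "eqv m \<dots> (marks 0 ?x @ [(?i, Box 1 c), (Suc ?i, Box 1 c)])"
    by (rule eqv_prefix[OF saddle]) (use assms in auto)
  also have "eqv m \<dots> (marks 0 ?x)"
    using absorb_marks_right[of p "[c, c]" q m] assms by simp
  finally show ?thesis .
qed

text \<open>The saddle relation, once for each cap.\<close>

lemma reduce_invertible:
  assumes "m = length r + length x"
  shows "eqv m (marks 0 (rev r @ x) @ reduce r x @ reflect (reduce r x) @ marks 0 (rev r @ x)) (marks 0
      (rev r @ x))"
  using assms
proof (induction r x arbitrary: m rule: reduce.induct)
  case (1 r)
  then show ?case using marks_idempotent[of 0 "rev r" m] by simp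
next
  case (2 c x)
  then show ?case by simp
next
  case (3 d r c x)
  show ?case
  proof (cases "c = d")
    case False
    then show ?thesis using 3 by simp
  next
    case True
    let ?X = "rev r @ d # d # x" and ?Y = "rev r @ x" and ?j = "length r" and ?R = "reduce r x"
    have m: "m = length r + length x + 2" using 3 by simp
    have "eqv m ((marks 0 ?X @ [(?j, Cap)]) @ ?R @ reflect ?R @ (?j, Cup) # marks 0 ?X)
       ((marks 0 ?X @ [(?j, Cap)] @ marks 0 ?Y) @ ?R @ reflect ?R @ (?j, Cup) # marks 0 ?X)"
      using eqv_append[OF marks_Cap[of m "rev r" x d]] m by simp
    also have "eqv m \<dots> ((marks 0 ?X @ [(?j, Cap)] @ marks 0 ?Y @ ?R @ reflect ?R) @ ((?j, Cup) # marks 0 ?X))"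
      by simp
    also have "eqv m \<dots> ((marks 0 ?X @ [(?j, Cap)] @ marks 0 ?Y @ ?R @ reflect ?R) @ (marks 0 ?Y @ [(?j,
        Cup)] @ marks 0 ?X))"
    proof (rule eqv_prefix)
      show "eqv (length r + length x) ((?j, Cup) # marks 0 ?X) (marks 0 ?Y @ [(?j, Cup)] @ marks 0 ?X)"
        using Cup_marks[of "length r + length x" "rev r" x d] by simp
      have "goes (?j + length x) (?R @ reflect ?R) (?j + length x)"
        using goes_reduce[of r x] goes_reflect[OF goes_reduce[of r x]] by (auto simp: goes_append)
      then show "goes m (marks 0 ?X @ [(?j, Cap)] @ marks 0 ?Y @ ?R @ reflect ?R) (length r + length x)"
        using m by (simp add: goes_marks)
    qed
    also have "eqv m \<dots> ((marks 0 ?X @ [(?j, Cap)]) @ (marks 0 ?Y @ ?R @ reflect ?R @ marks 0 ?Y) @ (?j,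
        Cup) # marks 0 ?X)"
      by simp
    also have "eqv m \<dots> ((marks 0 ?X @ [(?j, Cap)]) @ marks 0 ?Y @ (?j, Cup) # marks 0 ?X)"
      by (rule eqv_context[OF 3(1)[OF True refl]]) (use m in \<open>auto simp: goes_marks\<close>)
    also have "eqv m \<dots> ((marks 0 ?X @ [(?j, Cap)]) @ (marks 0 ?Y @ [(?j, Cup)] @ marks 0 ?X))" by simp
    also have "eqv m \<dots> ((marks 0 ?X @ [(?j, Cap)]) @ ((?j, Cup) # marks 0 ?X))"
      by (rule eqv_prefix[of "length r + length x"], rule eqv_sym)
        (use m Cup_marks[of "length r + length x" "rev r" x d] in \<open>auto simp: goes_marks\<close>)
    also have "eqv m \<dots> ((marks 0 ?X @ [(?j, Cap), (?j, Cup)]) @ marks 0 ?X)" by simp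
    also have "eqv m \<dots> ((marks 0 ?X @ [(?j, Cap), (?j, Cup)]) @ ((?j, Box 1 d) # marks 0 ?X))"
      by (rule eqv_prefix[of m], rule eqv_sym)
        (use m absorb_left[of "rev r" d "d # x" m] in \<open>auto simp: goes_marks\<close>)
    also have "eqv m \<dots> ((marks 0 ?X @ [(?j, Cap), (?j, Cup), (?j, Box 1 d)]) @ marks 0 ?X)" by simp
    also have "eqv m \<dots> (marks 0 ?X @ marks 0 ?X)"
      using eqv_append[OF marks_saddle[of m "rev r" x d]] m by simp
    also have "eqv m \<dots> (marks 0 ?X)" by (rule marks_idempotent) (use m in simp)
    finally show ?thesis using True by (simp add: reflect_Cap)
  qed
qed

definition proportional :: "nat \<Rightarrow> bool diagram \<Rightarrow> complex \<Rightarrow> bool diagram \<Rightarrow> bool" where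
  "proportional m l a r \<longleftrightarrow> (\<forall>u v. goes k u m \<longrightarrow> cv u (l @ v) = scale_PA a (cv u (r @ v)))"

lemma proportional_prefix:
  assumes "proportional m l a r" "goes m' U m"
  shows "proportional m' (U @ l) a (U @ r)"
  unfolding proportional_def
proof (intro allI impI)
  fix u :: "gen diagram" and v assume "goes k u m'"
  then have "(\<Sum>(c, l)\<leftarrow>[(1, l), (- a, r)]. scale_PA c (cv u (U @ l @ v))) = 0"
    by (intro cv_linear_prefix[OF _ assms(2)]) (use assms(1) in \<open>auto simp: proportional_def\<close>)
  then show "cv u ((U @ l) @ v) = scale_PA a (cv u ((U @ r) @ v))" by simp
qed

lemma proportional_eqv:
  "eqv m l l' \<Longrightarrow> proportional m l' a r' \<Longrightarrow> eqv m r' r \<Longrightarrow> proportional m l a r"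
  by (simp add: eqv_def proportional_def)

lemma null_proportional: "null m l \<Longrightarrow> proportional m (l @ w) 0 r"
  by (simp add: null_def proportional_def)

text \<open>The reduction of all diagrams. By induction from the bottom slice, every strand acquires a colour: a
  cup gets both colours in turn, a cap between different colours vanishes, and \<open>reduce_Cup\<close> absorbs the
  remaining cups, and by the saddle relation also the caps, into the connecting isomorphism. The
  colourings that survive are those counted by the state sum.\<close>

lemma coloured_diagram:
  assumes "goes (length x) W (length y)" "\<And>i a. (i, a) \<in> set W \<Longrightarrow> elementary a"
  shows "proportional (length x) (marks 0 x @ W @ marks 0 y) (ev colour_weight W x y) (connect x y)"
  using assms
proof (induction W arbitrary: x)
  case Nil
  show ?case
  proof (cases "x = y")
    case True
    have "eqv (length y) (connect y y) (marks 0 y)"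
      using reduce_invertible[of "length y" "[]" y] by (simp add: connect_def)
    moreover have "eqv (length y) (marks 0 y @ marks 0 y) (marks 0 y)"
      by (rule marks_idempotent) simp
    ultimately show ?thesis using True by (simp add: proportional_def eqv_def)
  next
    case False
    then have "null (length x) (marks 0 x @ marks 0 y)" using Nil by (intro marks_clash) auto
    then show ?thesis using False null_proportional[of "length x" _ "[]"] by simp
  qed
next
  case (Cons s W)
  obtain i a where s: "s = (i, a)" by force
  obtain p u q where x: "x = p @ u @ q" "length p = i" "length u = ins a"
    using Cons.prems(1) s split_colouring[of i "ins a" x] by auto
  have W: "goes (length x - ins a + outs a) W (length y)" "\<And>i a. (i, a) \<in> set W \<Longrightarrow> elementary a"
    using Cons.prems s by auto
  have gW: "goes m (marks 0 x @ v) n \<longleftrightarrow> goes m v n" if "m = length x" for m v n and x :: "bool list"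
    using goes_marks[of 0 x m v n] that by simp
  show ?case
  proof (cases a)
    case Cup
    then have x: "x = p @ q" "length p = i" using x by auto
    let ?X = "\<lambda>c. p @ c # c # q"
    have "proportional (length x) (marks 0 x @ [(i, Cup), (i, Box 1 c)] @ W @ marks 0 y)
       (ev colour_weight W (?X c) y) (connect x y)" for c
    proof (rule proportional_eqv)
      let ?c = "marks 0 x @ [(i, Cup)]" and ?r = "reflect (reduce [] y) @ marks 0 y"
      have e: "eqv (length x) (marks 0 x @ [(i, Cup), (i, Box 1 c)]) (?c @ marks 0 (?X c))"
        using marks_Cup[of "length x" p q c] x by simp
      show "eqv (length x) (marks 0 x @ [(i, Cup), (i, Box 1 c)] @ W @ marks 0 y) (?c @ (marks 0 (?X c) @
          W @ marks 0 y))"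
        using eqv_append[OF e, of "W @ marks 0 y"] by simp
      show "proportional (length x) (?c @ (marks 0 (?X c) @ W @ marks 0 y)) (ev colour_weight W (?X c) y)
          (?c @ connect (?X c) y)"
      proof (rule proportional_prefix[OF Cons.IH])
        show "goes (length (?X c)) W (length y)" using W(1) Cup x by simp
        show "goes (length x) ?c (length (?X c))" using x by (simp add: gW)
      qed (rule W(2))
      have "eqv (length x) ((?c @ marks 0 (?X c)) @ reduce [] (?X c) @ ?r) ((marks 0 x @ [(i, Cup), (i,
          Box 1 c)]) @ reduce [] (?X c) @ ?r)"
        by (rule eqv_append[OF eqv_sym[OF e]])
      also have "eqv (length x) \<dots> ((marks 0 x @ [(i, Cup), (i, Box 1 c)] @ reduce [] (?X c)) @ ?r)" by simp
      also have "eqv (length x) \<dots> ((marks 0 x @ reduce [] x) @ ?r)"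
        using eqv_append[OF reduce_Cup[of "[]" i p "length x" q c], of ?r] x by simp
      finally show "eqv (length x) (?c @ connect (?X c) y) (connect x y)" by (simp add: connect_def)
    qed
    then have "cv u' (marks 0 x @ (i, Cup) # (i, Box 1 c) # W @ marks 0 y @ v)
        = scale_PA (ev colour_weight W (?X c) y) (cv u' (connect x y @ v))"
      if "goes k u' (length x)" for u' v c using that by (simp add: proportional_def)
    moreover have "cv u' (marks 0 x @ (i, Cup) # W @ v)
        = (\<Sum>c\<in>UNIV. cv u' (marks 0 x @ (i, Cup) # (i, Box 1 c) # W @ v))" for u' v
      using cv_blue[of u' "marks 0 x @ [(i, Cup)]" i "W @ v"] by (simp add: UNIV_bool)
    ultimately show ?thesis unfolding s Cup x(1)[symmetric] unfolding x(1) ev_Cup[OF x(2)]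
      by (simp add: proportional_def pa.scale_sum_left x(1)[symmetric])
  next
    case Cap
    then obtain c d where u: "u = [c, d]" using x by (auto simp: numeral_2_eq_2 length_Suc_conv)
    show ?thesis
    proof (cases "c = d")
      case False
      then have "null (length x) (marks 0 x @ [(i, Cap)])"
          using marks_Cap_clash[of c d "length x" p q] x u by simp
      from null_proportional[OF this, of "W @ marks 0 y"] show ?thesis
        unfolding s Cap x(1) u using False by (simp add: ev_Cap[OF x(2)])
    next
      case True
      let ?X = "p @ q" and ?c = "marks 0 x @ [(i, Cap)]" and ?r = "reflect (reduce [] y) @ marks 0 y"
      have x': "x = p @ c # c # q" using x u True by simp
      have len: "length x = length p + length q + 2" using x' by simp
      have e: "eqv (length x) ?c (?c @ marks 0 ?X)"
        using marks_Cap[OF len, of c] x(2) x' by simp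
      have "proportional (length x) (?c @ W @ marks 0 y) (ev colour_weight W ?X y) (connect x y)"
      proof (rule proportional_eqv)
        show "eqv (length x) (?c @ W @ marks 0 y) (?c @ (marks 0 ?X @ W @ marks 0 y))"
          using eqv_append[OF e, of "W @ marks 0 y"] by simp
        show "proportional (length x) (?c @ (marks 0 ?X @ W @ marks 0 y)) (ev colour_weight W ?X y) (?c @
            connect ?X y)"
        proof (rule proportional_prefix[OF Cons.IH])
          show "goes (length ?X) W (length y)" using W(1) Cap x u by simp
          show "goes (length x) ?c (length ?X)" using x u by (simp add: gW)
        qed (rule W(2))
        have "eqv (length x) (?c @ (marks 0 ?X @ reduce [] ?X) @ ?r) (?c @ (marks 0 ?X @ [(i, Cup), (i,
            Box 1 c)] @ reduce [] x) @ ?r)"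
          by (rule eqv_context[of "length ?X"], rule eqv_sym)
            (use reduce_Cup[of "[]" i p "length ?X" q c] x x' in \<open>auto simp: gW\<close>)
        also have "eqv (length x) \<dots> ((?c @ marks 0 ?X) @ [(i, Cup), (i, Box 1 c)] @ reduce [] x @ ?r)" by simp
        also have "eqv (length x) \<dots> (?c @ [(i, Cup), (i, Box 1 c)] @ reduce [] x @ ?r)"
          by (rule eqv_append[OF eqv_sym[OF e]])
        also have "eqv (length x) \<dots> ((marks 0 x @ [(i, Cap), (i, Cup), (i, Box 1 c)]) @ reduce [] x @ ?r)"
            by simp
        also have "eqv (length x) \<dots> (marks 0 x @ reduce [] x @ ?r)"
          using eqv_append[OF marks_saddle[OF len, of c]] x(2) x' by simp
        finally show "eqv (length x) (?c @ connect ?X y) (connect x y)" by (simp add: connect_def)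
      qed
      then show ?thesis unfolding s Cap by (simp add: x' ev_Cap[OF x(2)])
    qed
  next
    case (Box n c)
    then have n: "n = 1" using Cons.prems(2)[of i a] s by (simp add: elementary_def)
    then obtain d where u: "u = [d]" using x Box by (auto simp: length_Suc_conv)
    have "colourings (Suc 0) = {[True], [False]}" by (auto simp: length_Suc_conv)
    then have ev: "ev colour_weight (s # W) x y = (if d = c then ev colour_weight W x y else 0)"
      unfolding s Box n using ev_Box[OF x(2), of "[d]" 1 colour_weight c W q y] x(1) u
      by (cases c; cases d) (simp_all add: colour_weight_def)
    show ?thesis
    proof (cases "d = c")
      case True
      have "eqv (length x) (marks 0 x @ [(i, Box 1 c)]) (marks 0 x)"
        using absorb_right[of p c q "length x"] x(1,2) u True by simp
      from eqv_append[OF this] have "eqv (length x) (marks 0 x @ (s # W) @ marks 0 y) (marks 0 x @ W @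
          marks 0 y)"
        using s Box n by simp
      moreover have "proportional (length x) (marks 0 x @ W @ marks 0 y) (ev colour_weight W x y) (connect x y)"
        by (rule Cons.IH) (use W Box n x in auto)
      ultimately show ?thesis unfolding ev using True by (auto intro: proportional_eqv)
    next
      case False
      then have "null (length x) (marks 0 x @ [(i, Box 1 c)])"
        using clash_right[of p d q "length x" c] x(1,2) u by simp
      from null_proportional[OF this, of "W @ marks 0 y"] show ?thesis
        unfolding ev using False s Box n by simp
    qed
  qed
qed

lemma cv_sum_marks: "cv u (U @ V) = (\<Sum>x\<in>colourings n. cv u (U @ marks i x @ V))"
proof (induction n arbitrary: i U)
  case (Suc n)
  have "(\<Sum>x\<in>colourings (Suc n). cv u (U @ marks i x @ V))
     = (\<Sum>c\<in>UNIV. \<Sum>x\<in>colourings n. cv u ((U @ [(i, Box 1 c)]) @ marks (Suc i) x @ V))"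
    by (simp add: sum_colourings_Suc)
  also have "\<dots> = (\<Sum>c\<in>UNIV. cv u ((U @ [(i, Box 1 c)]) @ V))"
    by (intro sum.cong refl Suc.IH[symmetric])
  also have "\<dots> = cv u (U @ V)"
    using cv_blue[of u U i V] by (simp add: UNIV_bool)
  finally show ?case by simp
qed simp

definition red_diagram :: "gen diagram \<Rightarrow> bool diagram" where
  "red_diagram w = map (\<lambda>(i, a). (i, map_piece (\<lambda>_. True) a)) w"

lemma red_diagram_simps [simp]: "red_diagram [] = []"
  "red_diagram ((i, Cup) # w) = (i, Cup) # red_diagram w"
  "red_diagram ((i, Cap) # w) = (i, Cap) # red_diagram w"
  "red_diagram ((i, Box n g) # w) = (i, Box n True) # red_diagram w"
  by (simp_all add: red_diagram_def)

lemma goes_red_diagram: "goes m (red_diagram w) n \<longleftrightarrow> goes m w n"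
proof (induction w arbitrary: m)
  case (Cons p w)
  then show ?case by (cases p; cases "snd p") auto
qed simp

lemma elementary_red_diagram: "boxes_fit s w \<Longrightarrow> (i, a) \<in> set (red_diagram w) \<Longrightarrow> elementary a"
proof (induction w)
  case (Cons p w)
  then show ?case by (cases p; cases "snd p") auto
qed simp

lemma ev_red_diagram: "ev colour_weight (red_diagram w) x y = ev red_weight w x y"
proof (induction w arbitrary: x)
  case (Cons p w)
  then show ?case by (cases p; cases "snd p") (simp_all add: ev.simps colour_weight_def red_weight_def)
qed simp

lemma cv_red_diagram: "boxes_fit s w \<Longrightarrow> cv u (red_diagram w) = diag_PA k s (u @ w)"
proof (induction w arbitrary: u)
  case (Cons p w)
  obtain i a where p: "p = (i, a)" by force
  show ?case
  proof (cases a)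
    case (Box n g)
    then show ?thesis using Cons p by (cases g) (simp add: red_strand_def)
  qed (use Cons p in auto)
qed simp

text \<open>Every boundary strand is the sum of a red and a blue one.\<close>

lemma diagram_expansion:
  assumes "fitting k s w"
  shows "abs_PA (basis_elt k s w) = (\<Sum>x\<in>colourings k. \<Sum>y\<in>colourings k.
    scale_PA (ev red_weight w x y) (cv [] (connect x y)))"
proof -
  let ?W = "red_diagram w"
  have w: "goes k w k" "boxes_fit s w" using assms by (auto simp: fitting_iff)
  have "proportional k (marks 0 x @ ?W @ marks 0 y) (ev colour_weight ?W x y) (connect x y)"
    if "length x = k" "length y = k" for x y
    using coloured_diagram[of x ?W y] elementary_red_diagram[OF w(2)] that w by (simp add: goes_red_diagram)
  then have p: "cv [] (marks 0 x @ ?W @ marks 0 y) = scale_PA (ev red_weight w x y) (cv [] (connect x y))"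
    if "length x = k" "length y = k" for x y
    using that unfolding proportional_def by (metis append_Nil2 ev_red_diagram goes.simps(1))
  have "abs_PA (basis_elt k s w) = cv [] ?W"
    using assms w by (simp add: cv_red_diagram diag_PA_def)
  also have "\<dots> = (\<Sum>x\<in>colourings k. cv [] (marks 0 x @ ?W))"
    using cv_sum_marks[where u = "[]" and U = "[]" and V = ?W and n = k and i = 0] by simp
  also have "\<dots> = (\<Sum>x\<in>colourings k. \<Sum>y\<in>colourings k. cv [] (marks 0 x @ ?W @ marks 0 y))"
    using cv_sum_marks[where u = "[]" and U = "marks 0 _ @ ?W" and V = "[]" and n = k and i = 0] by simp
  finally show ?thesis by (simp add: p)
qed

end


section \<open>The box spaces are the matrices that preserve the degree\<close>

lemma mat_abs: "mat (abs_PA f) = evF f"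
  by (rule mat.abs_eq)

lemma mat_add: "mat (x + y) a b = mat x a b + mat y a b"
  by transfer (rule evF_add)

lemma mat_scale: "mat (scale_PA c x) a b = c * mat x a b"
  by transfer (rule evF_scale)

lemma mat_0 [simp]: "mat 0 a b = 0"
  by transfer simp

lemma mat_minus: "mat (x - y) a b = mat x a b - mat y a b"
  by transfer (rule evF_diff)

lemma scl_PAlg [simp]: "scl PAlg = scale_PA"
  and Sp_PAlg: "Sp PAlg k s = abs_PA ` Sp FA k s"
  by (simp_all add: PAlg_def)

lemma subspace_Sp_PAlg: "pa.subspace (Sp PAlg k s)"
proof (rule pa.subspaceI)
  show "0 \<in> Sp PAlg k s" unfolding Sp_PAlg
    using pm.subspace_0[OF subspace_Sp_FA] abs_PA_0 by (metis image_eqI)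
next
  fix x y assume "x \<in> Sp PAlg k s" "y \<in> Sp PAlg k s"
  then show "x + y \<in> Sp PAlg k s" unfolding Sp_PAlg
    using pm.subspace_add[OF subspace_Sp_FA] by (auto simp: abs_PA_add[symmetric])
next
  fix c x assume "x \<in> Sp PAlg k s"
  then show "scale_PA c x \<in> Sp PAlg k s" unfolding Sp_PAlg
    using pm.subspace_scale[OF subspace_Sp_FA] by (auto simp: abs_PA_scale[symmetric])
qed

lemma sum_single_keys: "(\<Sum>D\<in>Poly_Mapping.keys f. Poly_Mapping.single D (Poly_Mapping.lookup f D)) = f"
  by (rule poly_mapping_eqI) (auto simp: lookup_sum lookup_single when_def in_keys_iff)

text \<open>The candidate for the matrix unit with bottom colouring \<open>a\<close> and top colouring \<open>b\<close>.\<close>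

definition unit_PA :: "nat \<Rightarrow> shade \<Rightarrow> bool list \<Rightarrow> bool list \<Rightarrow> PA" where
  "unit_PA k s a b = box_type.cv k s [] (connect a b)"

text \<open>The coefficients are those of the matrix, so an element of a box space is determined by its matrix.\<close>

lemma Sp_expansion:
  assumes "x \<in> Sp PAlg k s"
  shows "x = (\<Sum>a\<in>colourings k. \<Sum>b\<in>colourings k. scale_PA (mat x a b) (unit_PA k s a b))"
proof -
  obtain f where f: "f \<in> Sp FA k s" "x = abs_PA f" using assms by (auto simp: Sp_PAlg)
  note K = mem_Sp_FA_keys[OF f(1)]
  have ec: "ev_class D a b = ev red_weight (rep D) a b"
    if "D \<in> Poly_Mapping.keys f" "length a = k" "length b = k" for D a b
    using K[OF that(1)] that(2,3) ev_class_ltangle[of k s "rep D"] by metis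
  have ex: "abs_PA (Poly_Mapping.single D c) = scale_PA c (\<Sum>a\<in>colourings k. \<Sum>b\<in>colourings k.
      scale_PA (ev red_weight (rep D) a b) (unit_PA k s a b))" if "D \<in> Poly_Mapping.keys f" for D c
  proof -
    have "abs_PA (Poly_Mapping.single D c) = scale_PA c (abs_PA (basis_elt k s (rep D)))"
      using K(2)[OF that] by (simp add: abs_PA_scale[symmetric])
    then show ?thesis by (simp add: box_type.diagram_expansion[OF K(1)[OF that]] unit_PA_def)
  qed
  have "x = abs_PA (\<Sum>D\<in>Poly_Mapping.keys f. Poly_Mapping.single D (Poly_Mapping.lookup f D))"
    using f(2) by (simp add: sum_single_keys)
  also have "\<dots> = (\<Sum>D\<in>Poly_Mapping.keys f. \<Sum>a\<in>colourings k. \<Sum>b\<in>colourings k.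
      scale_PA (Poly_Mapping.lookup f D * ev_class D a b) (unit_PA k s a b))"
    by (simp add: abs_PA_sum ex ec pa.scale_sum_right)
  also have "\<dots> = (\<Sum>a\<in>colourings k. \<Sum>b\<in>colourings k. scale_PA (evF f a b) (unit_PA k s a b))"
    by (simp add: evF_def pa.scale_sum_left sum.swap[of _ "Poly_Mapping.keys f"])
  finally show ?thesis unfolding f(2) mat_abs .
qed

lemma mat_inject:
  assumes "x \<in> Sp PAlg k s" "y \<in> Sp PAlg k s"
    and "\<And>a b. length a = k \<Longrightarrow> length b = k \<Longrightarrow> mat x a b = mat y a b"
  shows "x = y"
  using assms(3) by (subst Sp_expansion[OF assms(1)], subst Sp_expansion[OF assms(2)]) simp

lemma mat_support:
  assumes "x \<in> Sp PAlg k s" "mat x a b \<noteq> 0"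
  shows "length a = k" "length b = k" "degree a = degree b"
proof -
  obtain f where f: "f \<in> Sp FA k s" "x = abs_PA f" using assms by (auto simp: Sp_PAlg)
  then have ne: "evF f a b \<noteq> 0" using assms(2) by (simp add: mat_abs)
  then show l: "length a = k" "length b = k" using evF_length[OF f(1)] by auto
  obtain D where D: "D \<in> Poly_Mapping.keys f" "ev_class D a b \<noteq> 0"
    using ne unfolding evF_def by (rule sum.not_neutral_contains_not_neutral) auto
  then have "ev red_weight (rep D) a b \<noteq> 0" by (simp add: ev_class_def split: if_splits)
  moreover have "goes k (rep D) k" using mem_Sp_FA_keys[OF f(1) D(1)] by (simp add: fitting_iff)
  ultimately show "degree a = degree b"
    using l ev_degree[of "rep D" red_weight k k a b] by (auto simp: red_weight_def)
qed

lemma ev_red_strand: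
  assumes "length p = i"
  shows "ev red_weight (shift i (red_strand t)) (p @ c # q) y = of_bool (c \<and> y = p @ c # q)"
proof -
  have s: "ev red_weight (red_strand t) [c] [d] = of_bool (c \<and> d)" for d
    by (cases c; cases d) (simp_all add: red_strand_def ev_compute red_weight_def)
  have "ev red_weight (shift i (red_strand t) @ []) (p @ [c] @ q) y
     = (\<Sum>d\<in>colourings 1. ev red_weight (red_strand t) [c] d * of_bool (p @ d @ q = y))"
    using ev_shift_append[OF goes_red_strand assms, of "[c]" red_weight t "[]" q y] by simp
  also have "\<dots> = of_bool (c \<and> y = p @ c # q)"
    by (auto simp: sum_colourings_Suc UNIV_bool s)
  finally show ?thesis by simp
qed

lemma ev_mark:
  assumes "length p = i"
  shows "ev colour_weight ((i, Box 1 c) # W) (p @ d # q) y = of_bool (d = c) * ev colour_weight W (p @ d # q) y"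
proof -
  have "colourings (Suc 0) = {[True], [False]}" by (auto simp: length_Suc_conv)
  then show ?thesis
    using ev_Box[OF assms, of "[d]" 1 colour_weight c W q y]
    by (cases c; cases d) (simp_all add: colour_weight_def)
qed

lemma cv_in_Sp:
  assumes "boxes_fit s u" "goes k u m" "goes m W k" "\<And>i a. (i, a) \<in> set W \<Longrightarrow> elementary a"
  shows "box_type.cv k s u W \<in> Sp PAlg k s \<and> (\<forall>a b. length a = k \<longrightarrow> length b = k \<longrightarrow>
    mat (box_type.cv k s u W) a b = (\<Sum>z\<in>colourings m. ev red_weight u a z * ev colour_weight W z b))"
  using assms
proof (induction W arbitrary: u m)
  case Nil
  then have "fitting k s u" "m = k" by (auto simp: fitting_iff)
  moreover have "(\<Sum>z\<in>colourings k. ev red_weight u a z * of_bool (z = b)) = ev red_weight u a b"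
      if "length b = k" for a b
    using sum_colourings_delta(2)[OF that, of "ev red_weight u a"] by (simp add: mult.commute)
  ultimately show ?case
    by (auto simp: box_type.cv.simps diag_PA_def Sp_PAlg single_in_Sp_FA mat_abs evF_single ev_class_ltangle)
next
  case (Cons p W)
  obtain i a' where p: "p = (i, a')" by force
  define m' where "m' = m - ins a' + outs a'"
  have W: "goes m' W k" "\<And>i a. (i, a) \<in> set W \<Longrightarrow> elementary a" "i + ins a' \<le> m" and gp: "goes m [p] m'"
    using Cons.prems p by (auto simp: m'_def)
  have step: "box_type.cv k s (u @ w) W \<in> Sp PAlg k s \<and> (\<forall>a b. length a = k \<longrightarrow> length b = k \<longrightarrow>
      mat (box_type.cv k s (u @ w) W) a b = (\<Sum>z\<in>colourings m. ev red_weight u a z * ev colour_weight (P #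
          W) z b))"
    if w: "boxes_fit s w" "goes m w m'" and P: "goes m [P] m'"
      and e: "\<And>z z'. length z = m \<Longrightarrow> ev red_weight w z z' = ev colour_weight [P] z z'" for w P
  proof -
    have "(\<Sum>z\<in>colourings m'. ev red_weight (u @ w) a z * ev colour_weight W z b)
       = (\<Sum>z\<in>colourings m. ev red_weight u a z * ev colour_weight (P # W) z b)" if "length a = k" for a b
    proof -
      have "(\<Sum>z\<in>colourings m'. ev red_weight (u @ w) a z * ev colour_weight W z b)
        = (\<Sum>z'\<in>colourings m'. \<Sum>z\<in>colourings m. ev red_weight u a z * ev colour_weight [P] z z' * ev
            colour_weight W z' b)"
        by (simp add: ev_append[OF Cons.prems(2) that] e sum_distrib_right)
      also have "\<dots> = (\<Sum>z\<in>colourings m. ev red_weight u a z * (\<Sum>z'\<in>colourings m'. ev colour_weight [P] z z'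
          * ev colour_weight W z' b))"
        by (subst sum.swap) (simp add: sum_distrib_left mult.assoc)
      also have "\<dots> = (\<Sum>z\<in>colourings m. ev red_weight u a z * ev colour_weight (P # W) z b)"
        using ev_append[OF P, of _ colour_weight W b] by simp
      finally show ?thesis .
    qed
    moreover have "goes k (u @ w) m'" using Cons.prems(2) w(2) by (auto simp: goes_append)
    ultimately show ?thesis using Cons.IH[of "u @ w" m'] Cons.prems(1) w(1) W by simp
  qed
  show ?case
  proof (cases a')
    case Cup
    have "ev red_weight [(i, Cup :: gen piece)] z z' = ev colour_weight [(i, Cup)] z z'" for z z'
      by (simp add: ev.simps)
    then show ?thesis using step[of "[(i, Cup)]" p] gp p Cup by (simp add: box_type.cv.simps)
  next
    case Cap
    have "ev red_weight [(i, Cap :: gen piece)] z z' = ev colour_weight [(i, Cap)] z z'" for z z'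
      by (simp add: ev.simps)
    then show ?thesis using step[of "[(i, Cap)]" p] gp p Cap by (simp add: box_type.cv.simps)
  next
    case (Box n c)
    then have n: "n = 1" "m' = m" "i < m" using Cons.prems(4)[of i a'] p W(3) by
        (auto simp: elementary_def m'_def)
    let ?r = "shift i (red_strand (shade_at s i))"
    have "ev red_weight ?r z z' = ev colour_weight [(i, Box 1 True)] z z'" if lz: "length z = m" for z z'
    proof -
      obtain q u r where z: "z = q @ u @ r" "length q = i" "length u = 1"
        using split_colouring[of i 1 z] lz n(3) by auto
      then obtain d where "u = [d]" by (auto simp: length_Suc_conv)
      then show ?thesis using ev_mark[OF z(2), of True "[]" d r z'] ev_red_strand[OF z(2)] z(1) by auto
    qed
    moreover have "boxes_fit s ?r"
      by (auto simp: boxes_fit_shift red_strand_def shade_at_def split: if_splits) (metis shade.exhaust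
          opp.simps)+
    ultimately have R: "box_type.cv k s (u @ ?r) W \<in> Sp PAlg k s \<and> (\<forall>a b. length a = k \<longrightarrow> length b = k \<longrightarrow>
      mat (box_type.cv k s (u @ ?r) W) a b = (\<Sum>z\<in>colourings m. ev red_weight u a z * ev colour_weight ((i,
          Box 1 True) # W) z b))"
      using n goes_red_strand_shift by (intro step) auto
    show ?thesis
    proof (cases c)
      case True
      then show ?thesis using R Box n p by (simp add: box_type.cv.simps)
    next
      case False
      have I: "box_type.cv k s u W \<in> Sp PAlg k s \<and> (\<forall>a b. length a = k \<longrightarrow> length b = k \<longrightarrow>
        mat (box_type.cv k s u W) a b = (\<Sum>z\<in>colourings m. ev red_weight u a z * ev colour_weight W z b))"
        using Cons.IH[of u m'] Cons.prems W n by simp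
      have "ev colour_weight W z b - ev colour_weight ((i, Box 1 True) # W) z b
         = ev colour_weight ((i, Box 1 False) # W) z b" if lz: "length z = m" for z b
      proof -
        obtain q u r where z: "z = q @ u @ r" "length q = i" "length u = 1"
          using split_colouring[of i 1 z] lz n(3) by auto
        then obtain d where "u = [d]" by (auto simp: length_Suc_conv)
        then show ?thesis using ev_mark[OF z(2), of True W d r b] ev_mark[OF z(2), of False W d r b] z(1)
            by auto
      qed
      then have "mat (box_type.cv k s u W) a b - mat (box_type.cv k s (u @ ?r) W) a b
         = (\<Sum>z\<in>colourings m. ev red_weight u a z * ev colour_weight ((i, Box 1 False) # W) z b)"
         if "length a = k" "length b = k" for a b
        using R I that by (auto simp: sum_subtractf[symmetric] right_diff_distrib[symmetric])
      then show ?thesis using R I Box n p False pa.subspace_diff[OF subspace_Sp_PAlg]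
        by (simp add: box_type.cv.simps mat_minus)
    qed
  qed
qed

lemma ev_marks:
  "length p = i \<Longrightarrow> length u = length x \<Longrightarrow>
    ev colour_weight (marks i x @ W) (p @ u) y = of_bool (u = x) * ev colour_weight W (p @ u) y"
proof (induction x arbitrary: i p u)
  case (Cons c x)
  then obtain d v where u: "u = d # v" by (cases u) auto
  show ?case using Cons.IH[of "p @ [d]" "Suc i" v] Cons.prems ev_mark[OF Cons.prems(1), of c _ d v] by
      (auto simp: u)
qed simp

lemma ev_reduce: "ev colour_weight (reduce r x) (rev r @ x) z = of_bool (z = normal_form r x)"
proof (induction r x rule: reduce.induct)
  case (3 d r c x)
  then show ?case using ev_Cap[where p = "rev r" and i = "length r" and c = d and d = d and q = x
    and I = colour_weight] by auto
qed auto

lemma ev_connect: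
  assumes "normal_form [] a = normal_form [] b" "length u = length a"
  shows "ev colour_weight (connect a b) u v = of_bool (u = a \<and> v = b)"
proof -
  let ?n = "length (normal_form [] a)"
  have g: "goes (length a) (reduce [] a) ?n" "goes (length b) (reduce [] b) ?n"
    using goes_reduce[of "[]" a] goes_reduce[of "[]" b] assms by auto
  have refl: "ev colour_weight (reflect (reduce [] b)) z v = of_bool (z = normal_form [] b)"
    if "v = b" "length z = ?n" for z v
  proof -
    have "(\<lambda>b u t. cnj (colour_weight b t u)) = colour_weight"
      by (auto simp: colour_weight_def fun_eq_iff)
    then show ?thesis using ev_reflect[OF g(2), of b z colour_weight] that ev_reduce[of "[]" b z] by simp
  qed
  have end_: "ev colour_weight (marks 0 b) w v = of_bool (w = b \<and> v = b)" if "length w = length b" for w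
    using ev_marks[of "[]" 0 w b "[]" v] that by auto
  have "ev colour_weight (connect a b) u v = of_bool (u
      = a) * ev colour_weight (reduce [] a @ reflect (reduce [] b) @ marks 0 b) u v"
    using ev_marks[of "[]" 0 u a] assms(2) by (simp add: connect_def)
  also have "\<dots> = of_bool (u = a) * (\<Sum>z\<in>colourings ?n. of_bool (z
      = normal_form [] a) * ev colour_weight (reflect (reduce [] b) @ marks 0 b) z v)"
    using ev_append[OF g(1), of u colour_weight] ev_reduce[of "[]" a] assms(2) by auto
  also have "\<dots> = of_bool (u = a) * ev colour_weight (reflect (reduce [] b) @ marks 0 b) (normal_form [] b) v"
    using assms(1) by (simp add: sum_colourings_delta)
  also have "ev colour_weight (reflect (reduce [] b) @ marks 0 b) (normal_form [] b) v
     = (\<Sum>w\<in>colourings (length b). ev colour_weight (reflect (reduce [] b)) (normal_form [] b) w * of_bool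
         (w = b \<and> v = b))"
    using ev_append[OF goes_reflect[OF g(2)], of "normal_form [] b" colour_weight "marks 0 b" v] assms(1)
        by (simp add: end_)
  also have "\<dots> = (\<Sum>w\<in>colourings (length b). of_bool (w = b) * of_bool (v = b))"
    using assms(1) by (intro sum.cong) (auto simp: refl)
  also have "\<dots> = of_bool (v = b)" by (simp add: sum_colourings_delta)
  finally show ?thesis by auto
qed

fun alternating :: "bool \<Rightarrow> nat \<Rightarrow> bool list" where
  "alternating c 0 = []"
| "alternating c (Suc n) = c # alternating (\<not> c) n"

lemma length_alternating [simp]: "length (alternating c n) = n"
  by (induction n arbitrary: c) auto

lemma degree_alternating: "degree (alternating c n) = (if c then int n else - int n)"
  by (induction n arbitrary: c) auto

definition alternating_word :: "int \<Rightarrow> bool list" where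
  "alternating_word n = alternating (0 < n) (nat \<bar>n\<bar>)"

lemma distinct_adj_alternating: "distinct_adj x \<Longrightarrow> x = alternating (hd x) (length x)"
proof (induction x)
  case (Cons c x)
  then show ?case by (cases x) auto
qed simp

lemma distinct_adj_alternating_word:
  assumes "distinct_adj x"
  shows "x = alternating_word (degree x)"
proof (cases x)
  case Nil
  then show ?thesis by (simp add: alternating_word_def)
next
  case (Cons c y)
  have x: "x = alternating (hd x) (length x)" using assms by (rule distinct_adj_alternating)
  have "degree x = (if hd x then int (length x) else - int (length x))" by (subst x) (rule degree_alternating)
  then show ?thesis unfolding alternating_word_def using Cons x by (auto split: if_splits simp: nat_add_distrib)
qed

text \<open>Cancelling equal neighbours preserves the degree, and the degree determines an alternating word. So
  colourings of the same degree have a common normal form.\<close>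

lemma normal_form_alternating_word: "normal_form [] x = alternating_word (degree x)"
proof -
  have "distinct_adj (normal_form r x) \<and> degree (normal_form r x) = degree (rev r @ x)"
      if "distinct_adj r" for r
    using that
  proof (induction r x rule: normal_form.induct)
    case (3 d r c x)
    then show ?case by (cases r) (auto simp: degree_append)
  qed auto
  from this[of "[]"] show ?thesis using distinct_adj_alternating_word[of "normal_form [] x"] by simp
qed

lemma elementary_connect: "(i, a) \<in> set (connect x y) \<Longrightarrow> elementary a"
proof -
  have m: "elementary a" if "(i, a) \<in> set (marks j x)" for i a j x
    using that by (induction x arbitrary: j) auto
  have r: "a = Cap" if "(i, a) \<in> set (reduce r x)" for i a r x
    using that by (induction r x rule: reduce.induct) (auto split: if_splits)
  have r': "a = Cup" if "(i, a) \<in> set (reflect (reduce r x))" for i a r x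
    using that r unfolding reflect_def by fastforce
  assume "(i, a) \<in> set (connect x y)"
  then consider j z where "(i, a) \<in> set (marks j z)" | "a = Cap" | "a = Cup"
    using r r' unfolding connect_def set_append by blast
  then show ?thesis by cases (auto intro: m)
qed

lemma unit_PA:
  assumes "length a = k" "length b = k" "degree a = degree b"
  shows "unit_PA k s a b \<in> Sp PAlg k s" "mat (unit_PA k s a b) u v = of_bool (u = a \<and> v = b)"
proof -
  have nf: "normal_form [] a = normal_form [] b" using assms by (simp add: normal_form_alternating_word)
  have "goes (length a) (reduce [] a) (length (normal_form [] a))"
    "goes (length (normal_form [] b)) (reflect (reduce [] b)) (length b)"
    using goes_reduce[of "[]" a] goes_reflect[OF goes_reduce[of "[]" b]] by simp_all
  then have "goes k (reduce [] a @ reflect (reduce [] b)) k"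
    using assms(1,2) nf unfolding goes_append by metis
  then have "goes k ((reduce [] a @ reflect (reduce [] b)) @ marks 0 b) k"
    unfolding goes_append[of _ "_ @ _"] using assms(2) by force
  then have "goes k (connect a b) k" using assms(1) by (simp add: connect_def goes_marks)
  then have *: "unit_PA k s a b \<in> Sp PAlg k s \<and> (\<forall>u v. length u = k \<longrightarrow> length v = k \<longrightarrow>
     mat (unit_PA k s a b) u v = (\<Sum>z\<in>colourings k. of_bool (u = z) * ev colour_weight (connect a b) z v))"
    using cv_in_Sp[of s "[]" k k "connect a b"] elementary_connect by (auto simp: unit_PA_def)
  then show S: "unit_PA k s a b \<in> Sp PAlg k s" by simp
  show "mat (unit_PA k s a b) u v = of_bool (u = a \<and> v = b)"
  proof (cases "length u = k \<and> length v = k")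
    case True
    then show ?thesis using * ev_connect[OF nf, of u v] assms by (simp add: sum_colourings_delta)
  next
    case False
    then show ?thesis using mat_support[OF S, of u v] assms by auto
  qed
qed

text \<open>Together with \<open>mat_inject\<close> this identifies the box space with the degree-preserving matrices, the
  commutant of a circle acting on \<open>V \<otimes> V\<^sup>* \<otimes> V \<otimes> \<dots>\<close>, where \<open>V\<close> is the plane with weights \<open>1\<close> and \<open>-1\<close>.\<close>

lemma mat_surjective:
  assumes "\<And>a b. length a = k \<Longrightarrow> length b = k \<Longrightarrow> M a b \<noteq> 0 \<Longrightarrow> degree a = degree b"
  obtains x where "x \<in> Sp PAlg k s" "\<And>a b. length a = k \<Longrightarrow> length b = k \<Longrightarrow> mat x a b = M a b"
proof
  let ?x = "\<Sum>a\<in>colourings k. \<Sum>b\<in>colourings k. if M a b = 0 then 0 else scale_PA (M a b) (unit_PA k s a b)"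
  show "?x \<in> Sp PAlg k s"
    using assms unit_PA(1)
    by (intro pa.subspace_sum[OF subspace_Sp_PAlg])
        (auto intro!: pa.subspace_scale[OF subspace_Sp_PAlg] simp: pa.subspace_0[OF subspace_Sp_PAlg])
  have sum: "mat (\<Sum>i\<in>A. f i) a b = (\<Sum>i\<in>A. mat (f i) a b)" for f :: "bool list \<Rightarrow> PA" and A a b
    by (induction A rule: infinite_finite_induct) (auto simp: mat_add)
  fix u v :: "bool list" assume l: "length u = k" "length v = k"
  have "mat (if M a b = 0 then 0 else scale_PA (M a b) (unit_PA k s a b)) u v = of_bool (u
      = a) * (of_bool (v = b) * M a b)"
    if "length a = k" "length b = k" for a b
    using unit_PA(2)[OF that assms[OF that]] by (auto simp: mat_scale)
  then have "mat ?x u v = (\<Sum>a\<in>colourings k. of_bool (u = a) * (\<Sum>b\<in>colourings k. of_bool (v = b) * M a b))"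
    unfolding sum by (simp add: sum_distrib_left del: sum_of_bool_mult_eq sum_mult_of_bool_eq)
  then show "mat ?x u v = M u v" using l by (simp add: sum_colourings_delta)
qed


section \<open>The planar algebra axioms\<close>

lemma ev_cong_labels: "(\<And>b. b \<in> set (labels T) \<Longrightarrow> I b = J b) \<Longrightarrow> ev I T x y = ev J T x y"
proof (induction T arbitrary: x)
  case (Cons p T)
  then show ?case by (cases p; cases "snd p") (auto simp: ev.simps intro!: sum.cong)
qed simp

lemma ev_linear:
  assumes "distinct (labels T)" "b \<in> set (labels T)"
  shows "ev (I(b := (\<lambda>u t. c * M u t + d * N u t))) T x y
    = c * ev (I(b := M)) T x y + d * ev (I(b := N)) T x y"
  using assms
proof (induction T arbitrary: x)
  case (Cons p T)
  obtain i a where p: "p = (i, a)" by force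
  show ?case
  proof (cases a)
    case (Box n b')
    show ?thesis
    proof (cases "b' = b")
      case True
      then have "b \<notin> set (labels T)" using Cons.prems p Box by auto
      then have "ev (I(b := X)) T z y = ev I T z y" for X z by (intro ev_cong_labels) auto
      then show ?thesis by (simp add: p Box True ev.simps sum_distrib_left sum.distrib[symmetric] algebra_simps
          fun_upd_same del: fun_upd_apply)
    next
      case False
      then have "distinct (labels T)" "b \<in> set (labels T)" using Cons.prems p Box by auto
      from Cons.IH[OF this] show ?thesis
        using False by (simp add: p Box ev.simps sum_distrib_left sum.distrib[symmetric] algebra_simps
          fun_upd_other del: fun_upd_apply)
    qed
  next
    case Cup
    then have "distinct (labels T)" "b \<in> set (labels T)" using Cons.prems p by auto
    from Cons.IH[OF this] show ?thesis
      by (simp add: p Cup ev.simps sum_distrib_left sum.distrib[symmetric] algebra_simps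
          del: sum_of_bool_mult_eq sum_mult_of_bool_eq fun_upd_apply)
  next
    case Cap
    then have "distinct (labels T)" "b \<in> set (labels T)" using Cons.prems p by auto
    from Cons.IH[OF this] show ?thesis
      by (simp add: p Cap ev.simps algebra_simps del: fun_upd_apply)
  qed
qed simp

lemma boxes_unique:
  assumes "distinct (labels T)" "(b, j, t) \<in> set (boxes s T)" "(b, j', t') \<in> set (boxes s T)"
  shows "j = j' \<and> t = t'"
proof -
  have "labels T = map fst (boxes s T)"
    by (auto simp: labels_def boxes_def map_concat split: piece.split intro!: arg_cong[of _ _ concat])
  then show ?thesis using assms eq_key_imp_eq_value[of "boxes s T" b "(j, t)" "(j', t')"] by auto
qed

lemma labels_boxes: "b \<in> set (labels T) \<Longrightarrow> \<exists>j t. (b, j, t) \<in> set (boxes s T)"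
  using set_labels[of b T] by (auto simp: set_boxes)

text \<open>The action picks representatives of the inputs, whose matrices do not depend on the choice.\<close>

lemma Act_PAlg:
  assumes "tangle k T" "fits PAlg s T x"
  shows Act_PAlg_closed: "Act PAlg k s T x \<in> Sp PAlg k s"
    and mat_Act: "length a = k \<Longrightarrow> length c = k \<Longrightarrow> mat (Act PAlg k s T x) a c = ev (\<lambda>l. mat (x l)) T a c"
proof -
  have T: "goes k T k" "distinct (labels T)" using assms(1) by (auto simp: tangle_def)
  have "\<forall>b\<in>set (labels T). \<exists>y. (\<forall>j t. (b, j, t) \<in> set (boxes s T) \<longrightarrow> y \<in> Sp FA j t) \<and> abs_PA y = x b"
  proof
    fix b assume "b \<in> set (labels T)"
    then obtain j t where b: "(b, j, t) \<in> set (boxes s T)" using labels_boxes[of b T s] by blast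
    then have "x b \<in> abs_PA ` Sp FA j t" using assms(2) by (auto simp: fits_def Sp_PAlg)
    then obtain y where "y \<in> Sp FA j t" "abs_PA y = x b" by auto
    then show "\<exists>y. (\<forall>j t. (b, j, t) \<in> set (boxes s T) \<longrightarrow> y \<in> Sp FA j t) \<and> abs_PA y = x b"
      using boxes_unique[OF T(2) b] by (intro exI[of _ y] conjI allI impI) auto
  qed
  from bchoice[OF this] obtain y where
    "\<forall>b\<in>set (labels T). (\<forall>j t. (b, j, t) \<in> set (boxes s T) \<longrightarrow> y b \<in> Sp FA j t) \<and> abs_PA (y b) = x b" ..
  moreover have "b \<in> set (labels T)" if "(b, j, t) \<in> set (boxes s T)" for b j t
    using that by (auto simp: set_boxes labels_memI)
  ultimately have "\<exists>y. fits FA s T y \<and> (\<forall>b\<in>set (labels T). abs_PA (y b) = x b)"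
    by (intro exI[of _ y]) (auto simp: fits_def)
  note ex = someI_ex[OF this]
  define z where "z = (SOME y. fits FA s T y \<and> (\<forall>b\<in>set (labels T). abs_PA (y b) = x b))"
  have z: "fits FA s T z" "\<forall>b\<in>set (labels T). abs_PA (z b) = x b" using ex unfolding z_def by blast+
  have Act: "Act PAlg k s T x = abs_PA (Act FA k s T z)" by (simp add: PAlg_def z_def)
  show "Act PAlg k s T x \<in> Sp PAlg k s"
    unfolding Act Sp_PAlg using Act_FA_closed[OF T(1) z(1)] by blast
  assume l: "length a = k" "length c = k"
  show "mat (Act PAlg k s T x) a c = ev (\<lambda>l. mat (x l)) T a c"
    unfolding Act mat_abs evF_Act[OF assms(1) z(1) l]
    by (rule ev_cong_labels) (use z(2) in \<open>auto simp: mat_abs[symmetric]\<close>)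
qed

lemma boxes_append: "boxes s (u @ v) = boxes s u @ boxes s v"
  and boxes_Nil [simp]: "boxes s [] = []"
  and boxes_Box [simp]: "boxes s ((i, Box k b) # w) = (b, k, shade_at s i) # boxes s w"
  and boxes_Cup [simp]: "boxes s ((i, Cup) # w) = boxes s w"
  and boxes_Cap [simp]: "boxes s ((i, Cap) # w) = boxes s w"
  by (simp_all add: boxes_def)

lemma boxes_cups [simp]: "boxes s (cups i k) = []"
  and boxes_caps [simp]: "boxes s (caps i k) = []"
  by (auto simp: boxes_def cups_def caps_def)

lemma labels_cups [simp]: "labels (cups i k) = []"
  and labels_caps [simp]: "labels (caps i k) = []"
  by (auto simp: labels_def cups_def caps_def)

lemma boxes_move: "move l r \<Longrightarrow> set (boxes s l) = set (boxes s r)"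
proof (induction rule: move.induct)
  case (exchange i a j b)
  have "even (ins a + outs a)" by (cases a) auto
  with exchange have "even (j - ins a + outs a) = even j" by auto
  then show ?case by (cases a; cases b) (auto simp: boxes_def shade_at_def)
next
  case (full_turn i k b)
  show ?case by (simp add: boxes_append)
qed (auto simp: boxes_def)

lemma boxes_isotopic: "isotopic m n w w' \<Longrightarrow> set (boxes s w) = set (boxes s w')"
  unfolding isotopic_def
proof (induction rule: equivclp_induct)
  case (step y z)
  have "set (boxes s w) = set (boxes s w')" if mv: "move_in m n w w'" for w w' :: "'a diagram"
  proof -
    obtain u v l r where w: "w = u @ l @ v" "w' = u @ r @ v" "move l r" using mv by (auto simp: move_in_def)
    show ?thesis unfolding w(1,2) boxes_append set_append boxes_move[OF w(3)] ..
  qed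
  with step show ?case by metis
qed simp

lemma fits_cong:
  assumes "fits A s T x" "\<And>b. b \<in> set (labels T) \<Longrightarrow> x b = y b"
  shows "fits A s T y"
  unfolding fits_def
proof clarify
  fix b j t assume b: "(b, j, t) \<in> set (boxes s T)"
  then have "b \<in> set (labels T)" by (auto simp: set_boxes intro: labels_memI)
  then show "y b \<in> Sp A j t" using assms b by (auto simp: fits_def)
qed

lemma subst_box: "(i, Box j b) \<in> set T \<Longrightarrow> (h, Box l c) \<in> set (S b) \<Longrightarrow> (i + h, Box l c) \<in> set (subst T S)"
proof (induction T)
  case (Cons p T)
  then show ?case by (cases p; cases "snd p") (force simp: shift_def)+
qed simp

text \<open>Each axiom is an identity between state sums, since matrices separate the elements of a box space.\<close>

lemma planar_algebra_PAlg: "planar_algebra PAlg"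
proof (rule planar_algebra.intro)
  show "vector_space (scl PAlg)" by (simp add: pa.vector_space_axioms)
  show "module.subspace (scl PAlg) (Sp PAlg k s)" for k s by (simp add: subspace_Sp_PAlg)
  show "Act PAlg k s T x \<in> Sp PAlg k s" if "tangle k T" "fits PAlg s T x" for k s T x
    using Act_PAlg_closed[OF that] .
  show "Act PAlg k s T x = Act PAlg k s T y"
    if T: "tangle k T" "fits PAlg s T x" and e: "\<And>b. b \<in> set (labels T) \<Longrightarrow> x b = y b" for k s T x y
    by (rule mat_inject[OF Act_PAlg_closed[OF T] Act_PAlg_closed[OF T(1) fits_cong[OF T(2) e]]], assumption)
      (auto simp: mat_Act[OF T] mat_Act[OF T(1) fits_cong[OF T(2) e]] e intro!: ev_cong_labels)
next
  have fits_upd: "fits PAlg s T (x(b := w))"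
    if f: "fits PAlg s T (x(b := u))" and w: "\<And>j t. u \<in> Sp PAlg j t \<Longrightarrow> w \<in> Sp PAlg j t" for s T x b u w
    unfolding fits_def
  proof clarify
    fix b' j t assume "(b', j, t) \<in> set (boxes s T)"
    then have "(x(b := u)) b' \<in> Sp PAlg j t" using f by (auto simp: fits_def)
    then show "(x(b := w)) b' \<in> Sp PAlg j t" using w by (cases "b' = b") auto
  qed
  fix k s T b x u v
  assume T: "tangle k T" "b \<in> set (labels T)" "fits PAlg s T (x(b := u))"
  have d: "distinct (labels T)" using T by (simp add: tangle_def)
  have upd: "(\<lambda>l. mat ((x(b := w)) l)) = (\<lambda>l. mat (x l))(b := mat w)" for w by auto
  show "Act PAlg k s T (x(b := scl PAlg c u)) = scl PAlg c (Act PAlg k s T (x(b := u)))" for c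
    unfolding scl_PAlg
  proof (rule mat_inject)
    have f: "fits PAlg s T (x(b := scale_PA c u))"
      by (rule fits_upd[OF T(3)]) (simp add: pa.subspace_scale[OF subspace_Sp_PAlg])
    show "Act PAlg k s T (x(b := scale_PA c u)) \<in> Sp PAlg k s" by (rule Act_PAlg_closed[OF T(1) f])
    show "scale_PA c (Act PAlg k s T (x(b := u))) \<in> Sp PAlg k s"
      using Act_PAlg_closed[OF T(1,3)] by (simp add: pa.subspace_scale[OF subspace_Sp_PAlg])
    fix a e :: "bool list" assume l: "length a = k" "length e = k"
    show "mat (Act PAlg k s T (x(b := scale_PA c u))) a e = mat (scale_PA c (Act PAlg k s T (x(b := u)))) a e"
      using ev_linear[OF d T(2), of "\<lambda>l. mat (x l)" c "mat u" 0 "mat u" a e]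
      by (simp add: mat_Act[OF T(1) f l] mat_scale mat_Act[OF T(1,3) l] upd mat_scale[abs_def] del:
          fun_upd_apply)
  qed
  assume T': "fits PAlg s T (x(b := v))"
  show "Act PAlg k s T (x(b := u + v)) = Act PAlg k s T (x(b := u)) + Act PAlg k s T (x(b := v))"
  proof (rule mat_inject)
    have f: "fits PAlg s T (x(b := u + v))"
      unfolding fits_def
    proof clarify
      fix b' j t assume "(b', j, t) \<in> set (boxes s T)"
      then have "(x(b := u)) b' \<in> Sp PAlg j t" "(x(b := v)) b' \<in> Sp PAlg j t" using T(3) T' by
          (auto simp: fits_def)
      then show "(x(b := u + v)) b' \<in> Sp PAlg j t"
        using pa.subspace_add[OF subspace_Sp_PAlg] by (cases "b' = b") auto
    qed
    show "Act PAlg k s T (x(b := u + v)) \<in> Sp PAlg k s" by (rule Act_PAlg_closed[OF T(1) f])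
    show "Act PAlg k s T (x(b := u)) + Act PAlg k s T (x(b := v)) \<in> Sp PAlg k s"
      using Act_PAlg_closed[OF T(1,3)] Act_PAlg_closed[OF T(1) T'] by
          (simp add: pa.subspace_add[OF subspace_Sp_PAlg])
    fix a e :: "bool list" assume l: "length a = k" "length e = k"
    show "mat (Act PAlg k s T (x(b := u + v))) a e = mat (Act PAlg k s T (x(b := u))
        + Act PAlg k s T (x(b := v))) a e"
      using ev_linear[OF d T(2), of "\<lambda>l. mat (x l)" 1 "mat u" 1 "mat v" a e]
      by (simp add: mat_Act[OF T(1) f l] mat_add mat_Act[OF T(1,3) l] mat_Act[OF T(1) T' l] upd
          mat_add[abs_def] del: fun_upd_apply)
  qed
next
  fix k s T T' x
  assume T: "tangle k T" "tangle k T'" "isotopic k k T T'" "fits PAlg s T x"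
  have f: "fits PAlg s T' x" using T(4) boxes_isotopic[OF T(3)] by (simp add: fits_def)
  show "Act PAlg k s T x = Act PAlg k s T' x"
    by (rule mat_inject[OF Act_PAlg_closed[OF T(1,4)] Act_PAlg_closed[OF T(2) f]])
      (simp add: mat_Act[OF T(1,4)] mat_Act[OF T(2) f] ev_isotopic[OF T(3)])
next
  fix x :: "nat \<Rightarrow> PA" and b k s assume x: "x b \<in> Sp PAlg k s"
  have T: "tangle k [(0, Box k b)]" "fits PAlg s [(0, Box k b)] x"
    using x by (simp_all add: tangle_def fits_def boxes_def)
  show "Act PAlg k s [(0, Box k b)] x = x b"
  proof (rule mat_inject[OF Act_PAlg_closed[OF T] x])
    fix a c :: "bool list" assume l: "length a = k" "length c = k"
    have "ev (\<lambda>l. mat (x l)) [(0, Box k b)] a c = (\<Sum>t\<in>colourings k. of_bool (t = c) * mat (x b) a t)"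
      using ev_Box[where p = "[]" and i = 0 and u = a and k = k and I = "\<lambda>l. mat (x l)" and b = b
          and w = "[]" and q = "[]" and y = c] l by (simp add: mult.commute)
    then show "mat (Act PAlg k s [(0, Box k b)] x) a c = mat (x b) a c"
      using l by (simp add: mat_Act[OF T] sum_colourings_delta)
  qed
next
  fix k s T S and x y :: "nat \<Rightarrow> PA"
  assume T: "tangle k T" and S: "\<And>b j t. (b, j, t) \<in> set (boxes s T) \<Longrightarrow> tangle j (S b)"
    and c: "tangle k (subst T S)" "fits PAlg s (subst T S) x"
    and y: "\<And>b j t. (b, j, t) \<in> set (boxes s T) \<Longrightarrow> y b = Act PAlg j t (S b) x"
  have fS: "fits PAlg t (S b) x" if bt: "(b, j, t) \<in> set (boxes s T)" for b j t
    unfolding fits_def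
  proof (clarify)
    fix d l r assume "(d, l, r) \<in> set (boxes t (S b))"
    then obtain i h where "(i, Box j b) \<in> set T" "t = shade_at s i" "(h, Box l d) \<in> set (S b)"
        "r = shade_at t h"
      using bt by (auto simp: set_boxes)
    then have "(d, l, r) \<in> set (boxes s (subst T S))"
      using subst_box unfolding set_boxes by (metis shade_at_add)
    then show "x d \<in> Sp PAlg l r" using c(2) by (auto simp: fits_def)
  qed
  have fy: "fits PAlg s T y" unfolding fits_def using y S fS Act_PAlg_closed by auto
  show "Act PAlg k s (subst T S) x = Act PAlg k s T y"
  proof (rule mat_inject[OF Act_PAlg_closed[OF c] Act_PAlg_closed[OF T fy]])
    fix a e :: "bool list" assume l: "length a = k" "length e = k"
    have g: "goes k T k" using T by (simp add: tangle_def)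
    have b: "(b, j, shade_at s i) \<in> set (boxes s T)" if "(i, Box j b) \<in> set T" for i j b
      using that by (auto simp: set_boxes)
    have "ev (\<lambda>l. mat (x l)) (subst T S) a e = ev (\<lambda>b. ev (\<lambda>l. mat (x l)) (S b)) T a e"
      by (rule ev_subst[OF _ g l(1)]) (use S b in \<open>force simp: tangle_def\<close>)
    also have "\<dots> = ev (\<lambda>b. mat (y b)) T a e"
      by (rule ev_cong[OF _ g l(1)]) (use b in \<open>simp add: y[OF b] mat_Act[OF S[OF b] fS[OF b]]\<close>)
    finally show "mat (Act PAlg k s (subst T S) x) a e = mat (Act PAlg k s T y) a e"
      by (simp add: mat_Act[OF c l] mat_Act[OF T fy l])
  qed
qed


section \<open>The adjoint\<close>

lemma free_star_expand:
  assumes "finite K" "Poly_Mapping.keys f \<subseteq> K"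
  shows "free_star f = (\<Sum>D\<in>K. Poly_Mapping.single (ltangle (fst D) (fst (snd D)) (reflect (rep D))) (cnj
      (Poly_Mapping.lookup f D)))"
  unfolding free_star_def
  by (simp add: case_prod_beta, rule sum.mono_neutral_left[OF assms]) (auto simp: in_keys_iff)

lemma free_star_add: "free_star (f + g) = free_star f + free_star g"
proof -
  let ?K = "Poly_Mapping.keys f \<union> Poly_Mapping.keys g"
  show ?thesis using Poly_Mapping.keys_add[of f g]
    by (simp add: free_star_expand[of ?K] lookup_add single_add sum.distrib)
qed

lemma free_star_scale: "free_star (pm_scale c f) = pm_scale (cnj c) (free_star f)"
proof -
  have "Poly_Mapping.keys (pm_scale c f) \<subseteq> Poly_Mapping.keys f" by (auto simp: in_keys_iff lookup_pm_scale)
  then show ?thesis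
    by (simp add: free_star_expand[of "Poly_Mapping.keys f"] lookup_pm_scale pm.scale_sum_right)
qed

lemma free_star_0 [simp]: "free_star 0 = 0"
  by (simp add: free_star_def)

lemma boxes_fit_reflect: "boxes_fit s (reflect w) \<longleftrightarrow> boxes_fit s w"
  by (simp add: boxes_fit_def mem_reflect)

lemma free_star_Sp:
  assumes "f \<in> Sp FA k s"
  shows "free_star f \<in> Sp FA k s" "evF (free_star f) a b = cnj (evF f b a)"
proof -
  note K = mem_Sp_FA_keys[OF assms]
  have K': "fst D = k" "fst (snd D) = s" if "D \<in> Poly_Mapping.keys f" for D
    using K(2)[OF that] by (metis fst_ltangle) (metis K(2)[OF that] ltangle_def fst_conv snd_conv)
  have r: "fitting k s (reflect (rep D))" if "D \<in> Poly_Mapping.keys f" for D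
    using K(1)[OF that] by (simp add: fitting_iff goes_reflect boxes_fit_reflect)
  have fs: "free_star f = (\<Sum>D\<in>Poly_Mapping.keys f. Poly_Mapping.single (ltangle k s (reflect (rep D)))
      (cnj (Poly_Mapping.lookup f D)))"
    by (simp add: free_star_expand[of "Poly_Mapping.keys f" f] K')
  show "free_star f \<in> Sp FA k s"
    unfolding fs by (intro pm.subspace_sum[OF subspace_Sp_FA] single_in_Sp_FA r)
  have "ev_class (ltangle k s (reflect (rep D))) a b = cnj (ev_class D b a)" if "D \<in> Poly_Mapping.keys f" for D
  proof -
    have "(\<lambda>b u t. cnj (red_weight b t u)) = (red_weight :: gen \<Rightarrow> cmat)" by
        (auto simp: red_weight_def fun_eq_iff)
    then have "ev red_weight (reflect (rep D)) a b = cnj (ev red_weight (rep D) b a)"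
        if "length a = k" "length b = k"
      using ev_reflect[of k "rep D" k b a red_weight] K(1)[OF \<open>D \<in> _\<close>] that by (simp add: fitting_iff)
    then show ?thesis by (simp add: ev_class_ltangle) (simp add: ev_class_def K'[OF that])
  qed
  then show "evF (free_star f) a b = cnj (evF f b a)"
    unfolding fs evF_sum evF_single evF_def[of f] by simp
qed

lemma Sp_FA_eq_0:
  assumes "f \<in> Sp FA k s" "\<And>a b. evF f a b = 0"
  shows "abs_PA f = 0"
  using mat_inject[of "abs_PA f" k s 0] assms by
      (auto simp: Sp_PAlg mat_abs subspace_Sp_PAlg[unfolded Sp_PAlg, THEN pa.subspace_0])

text \<open>The involution of the quotient is computed from an arbitrary representative, which may differ from a
  given one by an element of the ideal of mixed type.\<close>

lemma free_star_ideal: "t \<in> total_ideal \<Longrightarrow> abs_PA (free_star t) = 0"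
  unfolding total_ideal_def scl_FA
proof (induction rule: pm.span_induct)
  case base
  show ?case by (auto simp: pm.subspace_def free_star_add free_star_scale abs_PA_add abs_PA_scale abs_PA_0)
next
  case (step t)
  then obtain k s where "t \<in> ev_kernel k s" using relation_ideal_le by blast
  then have "t \<in> Sp FA k s" "\<And>a b. evF t a b = 0" by (auto simp: ev_kernel_def)
  then show ?case using free_star_Sp[of t k s] by (intro Sp_FA_eq_0[of "free_star t" k s]) auto
qed

lemma abs_rep_PA: "abs_PA (rep_PA x) = x"
  using Quotient3_abs_rep[OF Quotient3_PA] .

lemma star_PA_abs: "star_PA (abs_PA f) = abs_PA (free_star f)"
proof -
  have "congr (rep_PA (abs_PA f)) f"
    using abs_rep_PA by (simp add: PA.abs_eq_iff[symmetric])
  then have "abs_PA (free_star (rep_PA (abs_PA f) - f)) = 0" by (intro free_star_ideal) (simp add: congr_def)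
  moreover have "free_star (rep_PA (abs_PA f)) = free_star (rep_PA (abs_PA f) - f) + free_star f"
    using free_star_add[of "rep_PA (abs_PA f) - f" f] by simp
  ultimately show ?thesis by (simp add: star_PA_def abs_PA_add)
qed

lemma star_PA_add: "star_PA (x + y) = star_PA x + star_PA y"
proof -
  obtain f g where "x = abs_PA f" "y = abs_PA g" using abs_rep_PA by metis
  then show ?thesis by (simp add: abs_PA_add[symmetric] star_PA_abs free_star_add)
qed

lemma star_PA_scale: "star_PA (scale_PA c x) = scale_PA (cnj c) (star_PA x)"
proof -
  obtain f where "x = abs_PA f" using abs_rep_PA by metis
  then show ?thesis by (simp add: abs_PA_scale[symmetric] star_PA_abs free_star_scale)
qed

lemma star_PA_Sp:
  assumes "x \<in> Sp PAlg k s"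
  shows "star_PA x \<in> Sp PAlg k s" "mat (star_PA x) a b = cnj (mat x b a)"
  using assms free_star_Sp[of _ k s] by (auto simp: Sp_PAlg star_PA_abs mat_abs)


section \<open>The subfactor planar algebra\<close>

lemma fits_reflect: "fits A s (reflect T) x \<longleftrightarrow> fits A s T x"
proof -
  have "set (boxes s (reflect T)) = set (boxes s T)"
    by (auto simp: set_boxes mem_reflect)
  then show ?thesis by (simp add: fits_def)
qed

lemma vert_PAlg: "vert PAlg k s \<in> Sp PAlg k s"
  "length a = k \<Longrightarrow> length b = k \<Longrightarrow> mat (vert PAlg k s) a b = of_bool (a = b)"
proof -
  have "tangle k []" "fits PAlg s [] x" for x by (simp_all add: tangle_def fits_def boxes_def)
  note T = this
  show "vert PAlg k s \<in> Sp PAlg k s" unfolding vert_def by (rule Act_PAlg_closed[OF T])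
  show "mat (vert PAlg k s) a b = of_bool (a = b)" if "length a = k" "length b = k"
    unfolding vert_def mat_Act[OF T that] by simp
qed

lemma edim_0: "edim PAlg {0} = 0"
proof -
  have "pa.dim {0} = 0" by (rule pa.dim_unique[of "{}"]) (auto simp: pa.independent_empty)
  then show ?thesis by (auto simp: edim_def zero_enat_def intro: exI[of _ "{0}"] pa.span_superset)
qed

lemma edim_1:
  assumes "x \<in> S" "x \<noteq> 0" "\<And>y. y \<in> S \<Longrightarrow> \<exists>c. y = scale_PA c x"
  shows "edim PAlg S = 1"
proof -
  have sub: "S \<subseteq> pa.span {x}" using assms(3) by (auto simp: pa.span_singleton)
  have "pa.dim S = 1" by (rule pa.dim_unique[of "{x}"]) (use assms sub in auto)
  then show ?thesis using sub unfolding edim_def scl_PAlg by (auto simp: one_enat_def)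
qed

lemma edim_1_multiple:
  assumes "edim PAlg S = 1" "x \<in> S" "x \<noteq> 0" "y \<in> S"
  shows "\<exists>c. y = scale_PA c x"
proof -
  obtain B where B: "finite B" "S \<subseteq> pa.span B"
    using assms(1) by (auto simp: edim_def split: if_splits)
  have dim: "pa.dim S = 1" using assms(1) by (simp add: edim_def one_enat_def split: if_splits)
  obtain E where E: "E \<subseteq> S" "pa.independent E" "S \<subseteq> pa.span E" "card E = pa.dim S"
    using pa.basis_exists[of S] by blast
  then obtain e where e: "E = {e}" using dim by (metis card_1_singletonE)
  have "\<exists>c. z = scale_PA c e" if "z \<in> S" for z
    using that E(3) by (auto simp: e pa.span_singleton)
  then obtain c d where c: "x = scale_PA c e" and d: "y = scale_PA d e" using assms(2,4) by metis
  then have "y = scale_PA (d / c) x" using assms(3) by auto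
  then show ?thesis ..
qed

lemma Sp_0:
  assumes "x \<in> Sp PAlg 0 s"
  shows "x = scale_PA (mat x [] []) (vert PAlg 0 s)"
  using assms vert_PAlg(1)[where k = 0 and s = s]
  by (intro mat_inject[of _ 0 s]) (auto simp: mat_scale pa.subspace_scale[OF subspace_Sp_PAlg] vert_PAlg(2))

lemma scalar_PAlg:
  assumes "x \<in> Sp PAlg 0 s"
  shows "scalar PAlg s x = mat x [] []"
  unfolding scalar_def scl_PAlg
proof (rule the_equality)
  show "x = scale_PA (mat x [] []) (vert PAlg 0 s)" by (rule Sp_0[OF assms])
  fix c assume "x = scale_PA c (vert PAlg 0 s)"
  then show "c = mat x [] []" by (simp add: mat_scale vert_PAlg)
qed

lemma mult_PAlg:
  assumes "f \<in> Sp PAlg k s" "g \<in> Sp PAlg k s"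
  shows "mult PAlg k s f g \<in> Sp PAlg k s"
    "length a = k \<Longrightarrow> length b = k \<Longrightarrow> mat (mult PAlg k s f g) a b = (\<Sum>z\<in>colourings k. mat g a z * mat f z b)"
proof -
  have T: "tangle k [(0, Box k 1), (0, Box k 0)]" "fits PAlg s [(0, Box k 1), (0, Box k 0)] ((!) [f, g])"
    using assms by (simp_all add: tangle_def fits_def boxes_def)
  show "mult PAlg k s f g \<in> Sp PAlg k s" unfolding mult_def by (rule Act_PAlg_closed[OF T])
  assume l: "length a = k" "length b = k"
  have "ev (\<lambda>l. mat ([f, g] ! l)) [(0, Box k 0)] z b = mat f z b" if "length z = k" for z
  proof -
    have "ev (\<lambda>l. mat ([f, g] ! l)) [(0, Box k 0)] z b = (\<Sum>t\<in>colourings k. of_bool (t = b) * mat f z t)"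
      using ev_Box[where p = "[]" and i = 0 and u = z and k = k and I = "\<lambda>l. mat ([f, g] ! l)" and b = 0
          and w = "[]" and q = "[]" and y = b] that by (simp add: mult.commute)
    then show ?thesis using l by (simp add: sum_colourings_delta)
  qed
  then show "mat (mult PAlg k s f g) a b = (\<Sum>z\<in>colourings k. mat g a z * mat f z b)"
    unfolding mult_def mat_Act[OF T l]
    using ev_Box[where p = "[]" and i = 0 and u = a and k = k and I = "\<lambda>l. mat ([f, g] ! l)" and b = 1
      and w = "[(0, Box k 0)]" and q = "[]" and y = b] l by simp
qed

lemma tr_right_PAlg:
  assumes "f \<in> Sp PAlg k s"
  shows "scalar PAlg s (tr_right PAlg k s f) = (\<Sum>t\<in>colourings k. mat f t t)"
proof -
  let ?T = "cups 0 k @ [(0, Box k 0)] @ caps 0 k" and ?I = "\<lambda>l. mat ([f] ! l)"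
  have "goes 0 ?T 0" using goes_caps[of 0 k "2 * k" "[]" 0] by (simp add: goes_cups mult_2)
  then have T: "tangle 0 ?T" by (simp add: tangle_def labels_append)
  have f: "fits PAlg s ?T ((!) [f])" using assms by (simp add: fits_def boxes_append)
  have "ev ?I ((0, Box k 0) # caps 0 k) (t @ rev t) [] = mat f t t" if t: "length t = k" for t
  proof -
    have "ev ?I ((0, Box k 0) # caps 0 k) ([] @ t @ rev t) []
        = (\<Sum>r\<in>colourings k. mat f t r * ev ?I (caps 0 k) (r @ rev t) [])"
      by (subst ev_Box) (use t in auto)
    also have "\<dots> = (\<Sum>r\<in>colourings k. of_bool (r = t) * mat f t r)"
    proof (intro sum.cong refl)
      fix r assume "r \<in> colourings k"
      then show "mat f t r * ev ?I (caps 0 k) (r @ rev t) [] = of_bool (r = t) * mat f t r"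
        using ev_caps[where p = "[]" and q = "[]" and v = "[]" and i = 0 and t = r and t' = "rev t"
            and k = k and I = ?I and y = "[]"] t by auto
    qed
    finally show ?thesis using t by (simp add: sum_colourings_delta)
  qed
  then have "ev ?I ?T [] [] = (\<Sum>t\<in>colourings k. mat f t t)"
    using ev_cups[where p = "[]" and q = "[]" and i = 0 and k = k and v = "[(0, Box k 0)] @ caps 0 k"
        and I = ?I and y = "[]"] by simp
  moreover have "mat (Act PAlg 0 s ?T ((!) [f])) [] [] = ev ?I ?T [] []" by (rule mat_Act[OF T f]) simp_all
  ultimately show ?thesis unfolding tr_right_def scalar_PAlg[OF Act_PAlg_closed[OF T f]] by simp
qed

lemma tr_left_PAlg:
  assumes "f \<in> Sp PAlg 1 s"
  shows "scalar PAlg (shade_at s 1) (tr_left PAlg 1 s f) = (\<Sum>t\<in>colourings 1. mat f t t)"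
proof -
  let ?T = "cups 0 1 @ [(1, Box 1 0)] @ caps 0 1"
  have T: "tangle 0 ?T" "fits PAlg (shade_at s 1) ?T ((!) [f])"
    using assms by (simp_all add: tangle_def fits_def boxes_def cups_Suc caps_Suc shade_at_def)
  have "mat (Act PAlg 0 (shade_at s 1) ?T ((!) [f])) [] [] = ev (\<lambda>l. mat ([f] ! l)) ?T [] []"
    by (rule mat_Act[OF T]) simp_all
  then show ?thesis unfolding tr_left_def scalar_PAlg[OF Act_PAlg_closed[OF T]]
    by (simp add: cups_Suc caps_Suc ev_compute)
qed

text \<open>The trace form is the sum of the products of conjugate matrix entries, which is positive definite.\<close>

lemma subfactor_PAlg: "subfactor_planar_algebra PAlg star_PA"
proof (intro subfactor_planar_algebra.intro planar_algebra_PAlg subfactor_planar_algebra_axioms.intro)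
  show "edim PAlg (Sp PAlg 0 s) = 1" for s
  proof (rule edim_1)
    show "vert PAlg 0 s \<in> Sp PAlg 0 s" by (rule vert_PAlg)
    show "vert PAlg 0 s \<noteq> 0" using vert_PAlg(2)[of "[]" 0 "[]" s] by auto
  qed (use Sp_0 in blast)
  show "scalar PAlg (shade_at s 1) (tr_left PAlg 1 s f) = scalar PAlg s (tr_right PAlg 1 s f)"
      if "f \<in> Sp PAlg 1 s" for f s
    using that by (simp only: tr_right_PAlg tr_left_PAlg)
  show "star_PA f \<in> Sp PAlg k s" if "f \<in> Sp PAlg k s" for f k s using star_PA_Sp(1)[OF that] .
  show "star_PA (f + g) = star_PA f + star_PA g" for f g by (rule star_PA_add)
  show "star_PA (scl PAlg c f) = scl PAlg (cnj c) (star_PA f)" for c f by (simp add: star_PA_scale)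
  show "star_PA (star_PA f) = f" if "f \<in> Sp PAlg k s" for f k s
    using star_PA_Sp[OF that] star_PA_Sp[OF star_PA_Sp(1)[OF that]] that by (intro mat_inject[of _ k s]) auto
next
  fix k s T x assume T: "tangle k T" "fits PAlg s T x"
  have T': "tangle k (reflect T)" using T(1) by (simp add: tangle_def goes_reflect labels_reflect)
  have f: "fits PAlg s (reflect T) (\<lambda>b. star_PA (x b))"
    using T(2) star_PA_Sp(1) unfolding fits_reflect by (auto simp: fits_def)
  note C = Act_PAlg_closed[OF T]
  show "star_PA (Act PAlg k s T x) = Act PAlg k s (reflect T) (\<lambda>b. star_PA (x b))"
  proof (rule mat_inject[OF star_PA_Sp(1)[OF C] Act_PAlg_closed[OF T' f]])
    fix a b :: "bool list" assume l: "length a = k" "length b = k"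
    have "mat (star_PA (x c)) = (\<lambda>u t. cnj (mat (x c) t u))" if c: "c \<in> set (labels T)" for c
    proof -
      obtain j t where "(c, j, t) \<in> set (boxes s T)" using labels_boxes[OF c, of s] by blast
      then have "x c \<in> Sp PAlg j t" using T(2) by (auto simp: fits_def)
      then show ?thesis by (intro ext star_PA_Sp(2))
    qed
    then have "ev (\<lambda>c. mat (star_PA (x c))) (reflect T) a b = ev (\<lambda>c u t. cnj (mat (x c) t u)) (reflect T) a b"
      by (intro ev_cong_labels) (auto simp: labels_reflect)
    also have "\<dots> = cnj (ev (\<lambda>c. mat (x c)) T b a)"
      by (rule ev_reflect) (use T(1) l in \<open>auto simp: tangle_def\<close>)
    finally show "mat (star_PA (Act PAlg k s T x)) a b = mat (Act PAlg k s (reflect T) (\<lambda>b. star_PA (x b))) a b"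
      by (simp add: star_PA_Sp(2)[OF C] mat_Act[OF T] mat_Act[OF T' f] l)
  qed
next
  fix k s f assume f: "f \<in> Sp PAlg k s" "f \<noteq> 0"
  have "scalar PAlg s (tr_right PAlg k s (mult PAlg k s (star_PA f) f))
     = (\<Sum>t\<in>colourings k. \<Sum>z\<in>colourings k. mat f t z * cnj (mat f t z))"
    using f(1) star_PA_Sp[OF f(1)] by (simp add: tr_right_PAlg mult_PAlg)
  also have "\<dots> = of_real (\<Sum>t\<in>colourings k. \<Sum>z\<in>colourings k. (cmod (mat f t z))\<^sup>2)"
    by (simp add: complex_norm_square[symmetric])
  finally have e: "scalar PAlg s (tr_right PAlg k s (mult PAlg k s (star_PA f) f))
     = of_real (\<Sum>t\<in>colourings k. \<Sum>z\<in>colourings k. (cmod (mat f t z))\<^sup>2)" .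
  have "\<exists>a b. length a = k \<and> length b = k \<and> mat f a b \<noteq> 0"
    using mat_inject[OF f(1) pa.subspace_0[OF subspace_Sp_PAlg]] f(2) by auto
  then obtain a b where ab: "length a = k" "length b = k" "mat f a b \<noteq> 0" by blast
  have "0 < (cmod (mat f a b))\<^sup>2" using ab by simp
  also have "\<dots> \<le> (\<Sum>z\<in>colourings k. (cmod (mat f a z))\<^sup>2)"
    using ab by (intro member_le_sum) auto
  also have "\<dots> \<le> (\<Sum>t\<in>colourings k. \<Sum>z\<in>colourings k. (cmod (mat f t z))\<^sup>2)"
    using ab by (intro member_le_sum[of a _ "\<lambda>t. \<Sum>z\<in>colourings k. (cmod (mat f t z))\<^sup>2"])
        (auto intro: sum_nonneg)
  finally show "scalar PAlg s (tr_right PAlg k s (mult PAlg k s (star_PA f) f)) \<in> \<real> \<and>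
        0 < Re (scalar PAlg s (tr_right PAlg k s (mult PAlg k s (star_PA f) f)))"
    unfolding e by simp
qed


section \<open>Bending\<close>

lemma sum_colourings_add:
  "(\<Sum>z\<in>colourings (m + n). f z) = (\<Sum>u\<in>colourings m. \<Sum>v\<in>colourings n. f (u @ v))"
proof (induction m arbitrary: f)
  case (Suc m)
  have "(\<Sum>z\<in>colourings (Suc m + n). f z) = (\<Sum>c\<in>UNIV. \<Sum>z\<in>colourings (m + n). f (c # z))"
    by (simp add: sum_colourings_Suc)
  also have "\<dots> = (\<Sum>c\<in>UNIV. \<Sum>u\<in>colourings m. \<Sum>v\<in>colourings n. f (c # u @ v))"
    using Suc.IH by simp
  finally show ?case by (simp add: sum_colourings_Suc)
qed simp

text \<open>Bending does not change the colours read once around a box, along the bottom from left to right and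
  then back along the top.\<close>

definition bent :: "nat \<Rightarrow> cmat \<Rightarrow> cmat" where
  "bent n M x y = M (take n (x @ rev y)) (take n (y @ rev x))"

lemma ev_bend:
  assumes "a + b = 2 * n" "length x = a"
  shows "ev I (bend a b c @ v) x y = (\<Sum>z\<in>colourings b. bent n (I c) x z * ev I v z y)"
proof (cases "a \<le> b")
  case True
  define d where "d = (b - a) div 2"
  have ab: "n = a + d" "b = n + d" "(a + b) div 2 = n" "(a - b) div 2 = 0" using assms True by
      (auto simp: d_def)
  have bend: "bend a b c = cups a d @ [(0, Box n c)]"
    unfolding bend_def ab(3,4) d_def by simp
  have "ev I (bend a b c @ v) x y = (\<Sum>t\<in>colourings d. ev I ((0, Box n c) # v) (x @ t @ rev t) y)"
    using ev_cups[where p = x and i = a and k = d and q = "[]" and I = I and v = "(0, Box n c) # v"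
        and y = y] assms
    by (simp add: bend)
  also have "\<dots> = (\<Sum>t\<in>colourings d. \<Sum>t'\<in>colourings n. I c (x @ t) t' * ev I v (t' @ rev t) y)"
  proof (intro sum.cong refl)
    fix t assume "t \<in> colourings d"
    then show "ev I ((0, Box n c) # v) (x @ t @ rev t) y
        = (\<Sum>t'\<in>colourings n. I c (x @ t) t' * ev I v (t' @ rev t) y)"
      using ev_Box[where p = "[]" and i = 0 and u = "x @ t" and k = n and q = "rev t" and I = I and b = c
          and w = v and y = y] assms ab
      by simp
  qed
  also have "\<dots> = (\<Sum>t\<in>colourings d. \<Sum>t'\<in>colourings n. I c (x @ rev t) t' * ev I v (t' @ t) y)"
    using sum_colourings_rev[where f = "\<lambda>t. \<Sum>t'\<in>colourings n. I c (x @ t) t' * ev I v (t' @ rev t) y"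
        and k = d] by simp
  also have "\<dots> = (\<Sum>t'\<in>colourings n. \<Sum>t\<in>colourings d. I c (x @ rev t) t' * ev I v (t' @ t) y)"
    by (rule sum.swap)
  also have "\<dots> = (\<Sum>z\<in>colourings (n + d). bent n (I c) x z * ev I v z y)"
    unfolding sum_colourings_add bent_def using assms ab by (intro sum.cong refl) simp
  finally show ?thesis using ab by simp
next
  case False
  define d where "d = (a - b) div 2"
  have ab: "n = b + d" "a = n + d" "(a + b) div 2 = n" "(b - a) div 2 = 0" using assms False by
      (auto simp: d_def)
  have bend: "bend a b c = [(0, Box n c)] @ caps b d"
    unfolding bend_def ab(3,4) d_def by simp
  define x1 x2 where "x1 = take n x" and "x2 = drop n x"
  have x: "x = x1 @ x2" "length x1 = n" "length x2 = d" using assms ab by (auto simp: x1_def x2_def)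
  have "ev I (bend a b c @ v) x y = (\<Sum>t\<in>colourings n. I c x1 t * ev I (caps b d @ v) (t @ x2) y)"
    using ev_Box[where p = "[]" and i = 0 and u = x1 and k = n and q = x2 and I = I and b = c
        and w = "caps b d @ v" and y = y] x
    by (simp add: bend)
  also have "\<dots> = (\<Sum>z\<in>colourings b. \<Sum>t\<in>colourings d. I c x1 (z @ t) * ev I (caps b d @ v) (z @ t @ x2) y)"
    unfolding ab(1) sum_colourings_add by simp
  also have "\<dots> = (\<Sum>z\<in>colourings b. \<Sum>t\<in>colourings d. of_bool (t = rev x2) * (I c x1 (z @ t) * ev I v z y))"
  proof (intro sum.cong refl)
    fix z t assume "z \<in> colourings b" "t \<in> colourings d"
    then show "I c x1 (z @ t) * ev I (caps b d @ v) (z @ t @ x2) y = of_bool (t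
        = rev x2) * (I c x1 (z @ t) * ev I v z y)"
      using ev_caps[where p = z and i = b and k = d and t = t and t' = x2 and q = "[]" and I = I and v = v
          and y = y] x
      by auto
  qed
  also have "\<dots> = (\<Sum>z\<in>colourings b. bent n (I c) x z * ev I v z y)"
  proof (intro sum.cong refl)
    fix z assume "z \<in> colourings b"
    then show "(\<Sum>t\<in>colourings d. of_bool (t = rev x2) * (I c x1 (z @ t) * ev I v z y))
        = bent n (I c) x z * ev I v z y"
      using x ab by (simp add: sum_colourings_delta bent_def)
  qed
  finally show ?thesis .
qed

lemma goes_extend: "goes a W b \<Longrightarrow> goes (a + r) (W @ v) n \<longleftrightarrow> goes (b + r) v n"
  using goes_shift_append[of a W b 0 r v n] by simp

lemma ev_extend:
  assumes "goes a W b" "length x = a"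
  shows "ev I (W @ v) (x @ q) y = (\<Sum>t\<in>colourings b. ev I W x t * ev I v (t @ q) y)"
  using ev_shift_append[OF assms(1), of "[]" 0 x I v q y] assms(2) by simp

lemma ev_unbend:
  assumes "a + b = 2 * n" "goes a W b" "length u = n" "length v = n"
  shows "ev I (unbend a b W) u v = ev I W (take a (u @ rev v)) (rev (drop a (u @ rev v)))"
    and goes_unbend: "goes n (unbend a b W) n"
proof -
  have "goes n (unbend a b W) n \<and> ev I (unbend a b W) u v
      = ev I W (take a (u @ rev v)) (rev (drop a (u @ rev v)))"
  proof (cases "b \<le> a")
    case True
    define d where "d = (a - b) div 2"
    have ab: "n = b + d" "a = n + d" "(a + b) div 2 = n" "(b - a) div 2 = 0" using assms True by
        (auto simp: d_def)
    have ub: "unbend a b W = cups n d @ W" unfolding unbend_def ab(3,4) d_def by simp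
    define v1 v2 where "v1 = take b v" and "v2 = drop b v"
    have v: "v = v1 @ v2" "length v1 = b" "length v2 = d" using assms ab by (auto simp: v1_def v2_def)
    have "ev I (unbend a b W) u v = (\<Sum>t\<in>colourings d. ev I (W @ []) ((u @ t) @ rev t) v)"
      using ev_cups[where p = u and i = n and k = d and q = "[]" and I = I and v = W and y = v] assms by
          (simp add: ub)
    also have "\<dots> = (\<Sum>t\<in>colourings d. \<Sum>z\<in>colourings b. ev I W (u @ t) z * of_bool (z @ rev t = v))"
      using assms ab by (intro sum.cong refl, subst ev_extend[OF assms(2)]) auto
    also have "\<dots> = (\<Sum>t\<in>colourings d. of_bool (t = rev v2) * (\<Sum>z\<in>colourings b. of_bool (z
        = v1) * ev I W (u @ t) z))"
      unfolding sum_distrib_left using v by (intro sum.cong refl) (auto simp: rev_swap)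
    also have "\<dots> = ev I W (u @ rev v2) v1" using v by (simp add: sum_colourings_delta)
    finally have "ev I (unbend a b W) u v = ev I W (u @ rev v2) v1" .
    moreover have "goes n (unbend a b W) n"
    proof -
      have e: "n + 2 * d = a + d" "b + d = n" using ab by simp_all
      show ?thesis unfolding ub goes_cups[OF order_refl] e(1)
        using goes_extend[OF assms(2), of d "[]" n] e(2) by simp
    qed
    moreover have "take a (u @ rev v) = u @ rev v2" "rev (drop a (u @ rev v)) = v1"
      using v ab(2) assms(3) by simp_all
    ultimately show ?thesis by (simp only: simp_thms)
  next
    case False
    define d where "d = (b - a) div 2"
    have ab: "n = a + d" "b = n + d" "(a + b) div 2 = n" "(a - b) div 2 = 0" using assms False by
        (auto simp: d_def)
    have ub: "unbend a b W = W @ caps n d" unfolding unbend_def ab(3,4) d_def by simp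
    define u1 u2 where "u1 = take a u" and "u2 = drop a u"
    have u: "u = u1 @ u2" "length u1 = a" "length u2 = d" using assms ab by (auto simp: u1_def u2_def)
    have "ev I (unbend a b W) u v = (\<Sum>z\<in>colourings (n + d). ev I W u1 z * ev I (caps n d) (z @ u2) v)"
      using ev_extend[OF assms(2) u(2), of I "caps n d" u2 v] unfolding ub u(1) ab(2)[symmetric] .
    also have "\<dots> = (\<Sum>z1\<in>colourings n. \<Sum>z2\<in>colourings d. ev I W u1 (z1 @ z2) * ev I (caps n d) (z1 @ z2 @ u2) v)"
      unfolding sum_colourings_add by simp
    also have "\<dots> = (\<Sum>z1\<in>colourings n. of_bool (z1 = v) * (\<Sum>z2\<in>colourings d. of_bool (z2
        = rev u2) * ev I W u1 (z1 @ z2)))"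
      unfolding sum_distrib_left
    proof (intro sum.cong refl)
      fix z1 z2 assume "z1 \<in> colourings n" "z2 \<in> colourings d"
      then show "ev I W u1 (z1 @ z2) * ev I (caps n d) (z1 @ z2 @ u2) v
         = of_bool (z1 = v) * (of_bool (z2 = rev u2) * ev I W u1 (z1 @ z2))"
        using ev_caps[where p = z1 and i = n and k = d and t = z2 and t' = u2 and q = "[]" and v = "[]"
            and I = I and y = v] u
        by auto
    qed
    also have "\<dots> = ev I W u1 (v @ rev u2)" using u assms by (simp add: sum_colourings_delta)
    finally have "ev I (unbend a b W) u v = ev I W u1 (v @ rev u2)" .
    moreover have "goes n (unbend a b W) n"
    proof -
      have e: "a + d = n" "b + d = n + 2 * d" using ab by simp_all
      have "goes (n + 2 * d) (caps n d) n" using goes_caps[of n d "n + 2 * d" "[]" n] by simp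
      then show ?thesis unfolding ub
        using goes_extend[OF assms(2), of d "caps n d" n] unfolding e by simp
    qed
    moreover have "take a (u @ rev v) = u1" "rev (drop a (u @ rev v)) = v @ rev u2"
      using u by simp_all
    ultimately show ?thesis by (simp only: simp_thms)
  qed
  then show "ev I (unbend a b W) u v = ev I W (take a (u @ rev v)) (rev (drop a (u @ rev v)))"
    "goes n (unbend a b W) n" by auto
qed

lemma degree_rev: "degree (rev x) = - ((- 1) ^ length x) * degree x"
  by (induction x) (auto simp: degree_append algebra_simps)

lemma degree_parity: "even (degree x) \<longleftrightarrow> even (length x)"
  by (induction x) auto

lemma degree_circle:
  assumes "even (length x + length y)"
  shows "degree (x @ rev y) = degree x - degree y"
  using assms by (cases "even (length x)") (auto simp: degree_append degree_rev)

lemma bent_colourings: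
  assumes "length x + length y = 2 * n"
  shows "length (take n (x @ rev y)) = n" "length (take n (y @ rev x)) = n"
    "take n (x @ rev y) @ rev (take n (y @ rev x)) = x @ rev y"
proof -
  show "length (take n (x @ rev y)) = n" "length (take n (y @ rev x)) = n" using assms by auto
  have "take n (y @ rev x) = rev (drop n (x @ rev y))"
    using assms by (subst rev_drop) (simp add: mult_2 add.commute)
  then show "take n (x @ rev y) @ rev (take n (y @ rev x)) = x @ rev y" by (simp del: take_append drop_append)
qed

lemma unbent_colourings:
  assumes "a + b = 2 * n" "length u = n" "length v = n"
  defines "x \<equiv> take a (u @ rev v)" and "y \<equiv> rev (drop a (u @ rev v))"
  shows "length x = a" "length y = b" "take n (x @ rev y) = u" "take n (y @ rev x) = v"
proof -
  have xy: "x @ rev y = u @ rev v" by (simp add: x_def y_def del: take_append drop_append)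
  show "length x = a" "length y = b" using assms by (auto simp: x_def y_def)
  show "take n (x @ rev y) = u" unfolding xy using assms by simp
  have "y @ rev x = v @ rev u" using arg_cong[OF xy, of rev] by simp
  then show "take n (y @ rev x) = v" using assms by simp
qed

lemma bent_support:
  assumes "f \<in> Sp PAlg n s" "length x + length y = 2 * n" "bent n (mat f) x y \<noteq> 0"
  shows "degree x = degree y"
proof -
  note l = bent_colourings[OF assms(2)]
  have "degree (take n (x @ rev y)) = degree (take n (y @ rev x))"
    using mat_support(3)[OF assms(1)] assms(3) by (simp add: bent_def)
  moreover have "degree (take n (x @ rev y) @ rev (take n (y @ rev x)))
     = degree (take n (x @ rev y)) - degree (take n (y @ rev x))"
    by (rule degree_circle) (simp only: l(1,2), simp)
  then have "degree (x @ rev y) = degree (take n (x @ rev y)) - degree (take n (y @ rev x))"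
    by (simp only: l(3))
  moreover have "degree (x @ rev y) = degree x - degree y" using assms(2) by (intro degree_circle) simp
  ultimately show ?thesis by simp
qed

lemma bent_inject:
  assumes "f \<in> Sp PAlg n s" "g \<in> Sp PAlg n s" "a + b = 2 * n"
    and "\<And>x y. length x = a \<Longrightarrow> length y = b \<Longrightarrow> bent n (mat f) x y = bent n (mat g) x y"
  shows "f = g"
proof (rule mat_inject[OF assms(1,2)])
  fix u v :: "bool list" assume l: "length u = n" "length v = n"
  note x = unbent_colourings[OF assms(3) l]
  show "mat f u v = mat g u v" using assms(4)[OF x(1,2)] x(3,4) by (simp add: bent_def)
qed

lemma bent_surjective:
  assumes "a + b = 2 * n"
    and "\<And>x y. length x = a \<Longrightarrow> length y = b \<Longrightarrow> M x y \<noteq> 0 \<Longrightarrow> degree x = degree y"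
  obtains f where "f \<in> Sp PAlg n s"
    "\<And>x y. length x = a \<Longrightarrow> length y = b \<Longrightarrow> bent n (mat f) x y = M x y"
proof -
  let ?M = "\<lambda>u v. M (take a (u @ rev v)) (rev (drop a (u @ rev v)))"
  have "degree u = degree v" if l: "length u = n" "length v = n" "?M u v \<noteq> 0" for u v
  proof -
    note x = unbent_colourings[OF assms(1) l(1,2)]
    have "degree (take a (u @ rev v)) = degree (rev (drop a (u @ rev v)))"
      using assms(2)[OF x(1,2) l(3)] .
    moreover have "degree (take a (u @ rev v) @ rev (rev (drop a (u @ rev v))))
       = degree (take a (u @ rev v)) - degree (rev (drop a (u @ rev v)))"
      by (rule degree_circle) (use x assms(1) in presburger)
    moreover have "degree (u @ rev v) = degree u - degree v" using l by (intro degree_circle) simp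
    ultimately show ?thesis by (simp del: take_append drop_append)
  qed
  then obtain f where f: "f \<in> Sp PAlg n s" "\<And>u v. length u = n \<Longrightarrow> length v = n \<Longrightarrow> mat f u v = ?M u v"
    using mat_surjective[of n ?M s] by blast
  show ?thesis
  proof (rule that[OF f(1)])
    fix x y :: "bool list" assume l: "length x = a" "length y = b"
    then have "length x + length y = 2 * n" using assms(1) by simp
    note b = bent_colourings[OF this]
    show "bent n (mat f) x y = M x y"
      unfolding bent_def f(2)[OF b(1,2)] b(3) using l by simp
  qed
qed

lemma bent_star:
  "f \<in> Sp PAlg n s \<Longrightarrow> bent n (mat (star_PA f)) y x = cnj (bent n (mat f) x y)"
  by (simp add: bent_def star_PA_Sp(2))

lemma goes_bend:
  assumes "a + b = 2 * n"
  shows "goes a (bend a b c @ v) m \<longleftrightarrow> goes b v m"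
proof (cases "a \<le> b")
  case True
  define d where "d = (b - a) div 2"
  have ab: "n = a + d" "b = n + d" "(a + b) div 2 = n" "(a - b) div 2 = 0" using assms True by
      (auto simp: d_def)
  have "bend a b c = cups a d @ [(0, Box n c)]" unfolding bend_def ab(3,4) d_def by simp
  then show ?thesis using ab(1,2) by (simp add: goes_cups mult_2 add_ac)
next
  case False
  define d where "d = (a - b) div 2"
  have ab: "n = b + d" "a = n + d" "(a + b) div 2 = n" "(b - a) div 2 = 0" using assms False by
      (auto simp: d_def)
  have "bend a b c = [(0, Box n c)] @ caps b d" unfolding bend_def ab(3,4) d_def by simp
  then show ?thesis using ab(1,2) by (simp add: goes_caps)
qed


section \<open>Minimal projections\<close>

lemma hom_PAlg:
  assumes n: "a + b = 2 * n" and p: "p \<in> Sp PAlg a s" and q: "q \<in> Sp PAlg b s"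
  shows "f \<in> hom PAlg s a p b q \<longleftrightarrow> f \<in> Sp PAlg n s \<and>
    (\<forall>x y. length x = a \<longrightarrow> length y = b \<longrightarrow> bent n (mat f) x y =
      (\<Sum>x'\<in>colourings a. mat p x x' * (\<Sum>y'\<in>colourings b. bent n (mat f) x' y' * mat q y' y)))"
proof (cases "f \<in> Sp PAlg n s")
  case False
  then show ?thesis using n by (simp add: hom_def)
next
  case True
  let ?W = "[(0, Box a 0)] @ bend a b 1 @ [(0, Box b 2)] :: nat diagram" and ?I = "\<lambda>l. mat ([p, f, q] ! l)"
  have n2: "(a + b) div 2 = n" "even (a + b)" using n by auto
  have W: "goes a ?W b" by (simp add: goes_bend[OF n])
  have lb: "labels ?W = [0, 1, 2]" "boxes s ?W = [(0, a, s), (1, n, s), (2, b, s)]"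
    using n2 by (simp_all add: bend_def labels_append boxes_append)
  have "labels (unbend a b ?W) = [0, 1, 2]" "boxes s (unbend a b ?W) = [(0, a, s), (1, n, s), (2, b, s)]"
    using lb by (simp_all add: unbend_def labels_append boxes_append)
  moreover have "goes n (unbend a b ?W) n"
    by (rule goes_unbend[OF n W, of "replicate n True" "replicate n True"]) simp_all
  ultimately have T: "tangle n (unbend a b ?W)" "fits PAlg s (unbend a b ?W) ((!) [p, f, q])"
    using p q True by (simp_all add: tangle_def fits_def)
  have ev: "ev ?I ?W x y = (\<Sum>x'\<in>colourings a. mat p x x' * (\<Sum>y'\<in>colourings b. bent n (mat f) x' y' * mat q
      y' y))"
    if l: "length x = a" "length y = b" for x y
  proof -
    have "ev ?I [(0, Box b 2)] y' y = mat q y' y" if "length y' = b" for y'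
    proof -
      have "ev ?I [(0, Box b 2)] y' y = (\<Sum>t\<in>colourings b. of_bool (t = y) * mat q y' t)"
        using ev_Box[where p = "[]" and i = 0 and u = y' and k = b and I = ?I and b = 2 and w = "[]"
            and q = "[]" and y = y] that
        by (simp add: mult.commute)
      then show ?thesis using l by (simp add: sum_colourings_delta)
    qed
    then have "ev ?I (bend a b 1 @ [(0, Box b 2)]) x' y = (\<Sum>y'\<in>colourings b. bent n (mat f) x' y' * mat q y' y)"
      if "length x' = a" for x' using ev_bend[OF n that, of ?I 1 "[(0, Box b 2)]" y] by simp
    then show ?thesis
      using ev_Box[where p = "[]" and i = 0 and u = x and k = a and I = ?I and b = 0
          and w = "bend a b 1 @ [(0, Box b 2)]" and q = "[]" and y = y] l
      by simp
  qed
  let ?A = "Act PAlg n s (unbend a b ?W) ((!) [p, f, q])"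
  have "bent n (mat ?A) x y = ev ?I ?W x y" if l: "length x = a" "length y = b" for x y
  proof -
    have "length x + length y = 2 * n" using l n by simp
    note bc = bent_colourings[OF this]
    show ?thesis unfolding bent_def mat_Act[OF T bc(1,2)] ev_unbend[OF n W bc(1,2)] bc(3) using l by simp
  qed
  then have "?A = f \<longleftrightarrow> (\<forall>x y. length x = a \<longrightarrow> length y = b \<longrightarrow> bent n (mat f) x y = ev ?I ?W x y)"
    using bent_inject[OF Act_PAlg_closed[OF T] True n] by metis
  moreover have "f \<in> hom PAlg s a p b q \<longleftrightarrow> ?A = f" using True n2 by (simp add: hom_def)
  ultimately show ?thesis using True ev by auto
qed

lemma hcomp_PAlg:
  assumes n: "a + b = 2 * n" and f: "f \<in> Sp PAlg n s" and g: "g \<in> Sp PAlg n s"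
  shows "hcomp PAlg s a b g f \<in> Sp PAlg a s"
    "length x = a \<Longrightarrow> length z = a \<Longrightarrow> mat (hcomp PAlg s a b g f) x z =
      (\<Sum>y\<in>colourings b. bent n (mat f) x y * bent n (mat g) y z)"
proof -
  let ?T = "bend a b 0 @ bend b a 1 :: nat diagram" and ?I = "\<lambda>l. mat ([f, g] ! l)"
  have n': "b + a = 2 * n" "(a + b) div 2 = n" "(b + a) div 2 = n" using n by auto
  have "goes a (bend a b (0 :: nat) @ bend b a 1 @ []) a" unfolding goes_bend[OF n] goes_bend[OF n'(1)] by simp
  then have T: "tangle a ?T" "fits PAlg s ?T ((!) [f, g])"
    using f g n' by (auto simp: tangle_def fits_def bend_def labels_append boxes_append)
  show "hcomp PAlg s a b g f \<in> Sp PAlg a s" unfolding hcomp_def by (rule Act_PAlg_closed[OF T])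
  assume l: "length x = a" "length z = a"
  have "ev ?I (bend b a 1) y z = bent n (mat g) y z" if "length y = b" for y
  proof -
    have "ev ?I (bend b a 1 @ []) y z = (\<Sum>t\<in>colourings a. bent n (mat g) y t * of_bool (t = z))"
      by (subst ev_bend[OF n'(1) that]) simp
    also have "\<dots> = (\<Sum>t\<in>colourings a. of_bool (t = z) * bent n (mat g) y t)" by (simp only: mult.commute)
    finally show ?thesis using l by (simp add: sum_colourings_delta)
  qed
  then show "mat (hcomp PAlg s a b g f) x z = (\<Sum>y\<in>colourings b. bent n (mat f) x y * bent n (mat g) y z)"
    unfolding hcomp_def mat_Act[OF T l] using ev_bend[OF n l(1), of ?I 0 "bend b a 1" z] by simp
qed

text \<open>The range of the projection has an orthonormal basis of homogeneous vectors. One vector describes a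
  minimal projection, two are needed after a strand is added.\<close>

definition spanned_by :: "nat \<Rightarrow> shade \<Rightarrow> PA \<Rightarrow> 'c set \<Rightarrow> ('c \<Rightarrow> bool list \<Rightarrow> complex) \<Rightarrow> ('c \<Rightarrow> int) \<Rightarrow> bool" where
  "spanned_by k s p C g d \<longleftrightarrow> finite C \<and> p \<in> Sp PAlg k s \<and>
     (\<forall>x y. length x = k \<longrightarrow> length y = k \<longrightarrow> mat p x y = (\<Sum>c\<in>C. g c x * cnj (g c y))) \<and>
     (\<forall>c\<in>C. \<forall>c'\<in>C. (\<Sum>x\<in>colourings k. cnj (g c x) * g c' x) = of_bool (c = c')) \<and>
     (\<forall>c\<in>C. \<forall>x. length x = k \<longrightarrow> g c x \<noteq> 0 \<longrightarrow> degree x = d c)"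

lemma spanned_by_nonzero:
  assumes "spanned_by k s p C g d" "c \<in> C"
  obtains x where "length x = k" "g c x \<noteq> 0" "degree x = d c"
proof -
  have "(\<Sum>x\<in>colourings k. cnj (g c x) * g c x) \<noteq> 0" using assms by (auto simp: spanned_by_def)
  then obtain x where "x \<in> colourings k" "cnj (g c x) * g c x \<noteq> 0"
      by (rule sum.not_neutral_contains_not_neutral)
  then show ?thesis using that assms by (auto simp: spanned_by_def)
qed

text \<open>A morphism \<open>f = q f p\<close> is determined by its values on the basis of the range of \<open>p\<close>, and it preserves
  the degree.\<close>

lemma hom_spanned:
  assumes p: "spanned_by a s p C g d" and q: "spanned_by b s q {()} (\<lambda>_. w) (\<lambda>_. e)"
    and n: "a + b = 2 * n" and f: "f \<in> hom PAlg s a p b q"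
  obtains r where "\<And>x y. length x = a \<Longrightarrow> length y = b \<Longrightarrow>
      bent n (mat f) x y = (\<Sum>c\<in>C. r c * (g c x * cnj (w y)))"
    "\<And>c. c \<in> C \<Longrightarrow> r c \<noteq> 0 \<Longrightarrow> d c = e"
proof
  let ?r = "\<lambda>c. \<Sum>x\<in>colourings a. \<Sum>y\<in>colourings b. cnj (g c x) * (bent n (mat f) x y * w y)"
  have pS: "p \<in> Sp PAlg a s" and qS: "q \<in> Sp PAlg b s" using p q by (auto simp: spanned_by_def)
  note f' = f[unfolded hom_PAlg[OF n pS qS]]
  show "bent n (mat f) x y = (\<Sum>c\<in>C. ?r c * (g c x * cnj (w y)))" if l: "length x = a" "length y = b" for x y
  proof -
    have "bent n (mat f) x y = (\<Sum>x'\<in>colourings a. mat p x x' * (\<Sum>y'\<in>colourings b. bent n (mat f) x' y' *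
        mat q y' y))"
      using f' l by blast
    also have "\<dots> = (\<Sum>x'\<in>colourings a. \<Sum>c\<in>C. \<Sum>y'\<in>colourings b.
        cnj (g c x') * (bent n (mat f) x' y' * w y') * (g c x * cnj (w y)))"
    proof (intro sum.cong refl)
      fix x' assume x': "x' \<in> colourings a"
      have "mat p x x' = (\<Sum>c\<in>C. g c x * cnj (g c x'))" using p l x' by (simp add: spanned_by_def)
      moreover have "mat q y' y = w y' * cnj (w y)" if "y' \<in> colourings b" for y'
        using q l that by (simp add: spanned_by_def)
      ultimately show "mat p x x' * (\<Sum>y'\<in>colourings b. bent n (mat f) x' y' * mat q y' y)
          = (\<Sum>c\<in>C. \<Sum>y'\<in>colourings b.
        cnj (g c x') * (bent n (mat f) x' y' * w y') * (g c x * cnj (w y)))"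
        by (simp add: sum_product mult_ac)
    qed
    also have "\<dots> = (\<Sum>c\<in>C. ?r c * (g c x * cnj (w y)))"
      by (subst sum.swap) (simp add: sum_distrib_right)
    finally show ?thesis .
  qed
  show "d c = e" if c: "c \<in> C" "?r c \<noteq> 0" for c
  proof -
    obtain x where x: "x \<in> colourings a" "(\<Sum>y\<in>colourings b. cnj (g c x) * (bent n (mat f) x y * w y)) \<noteq> 0"
      using c(2) by (rule sum.not_neutral_contains_not_neutral)
    obtain y where y: "y \<in> colourings b" "cnj (g c x) * (bent n (mat f) x y * w y) \<noteq> 0"
      using x(2) by (rule sum.not_neutral_contains_not_neutral)
    have "degree x = d c" "degree y = e" using p q c x y by (auto simp: spanned_by_def)
    moreover have "degree x = degree y"
      by (rule bent_support[of f n s]) (use f' x y n in auto)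
    ultimately show ?thesis by simp
  qed
qed

lemma spanned_by_parity:
  assumes "spanned_by k s p C g d" "c \<in> C"
  shows "even (d c) \<longleftrightarrow> even k"
  using spanned_by_nonzero[OF assms] degree_parity by metis

lemma hom_dim_0:
  assumes p: "spanned_by a s p C g d" and q: "spanned_by b s q {()} (\<lambda>_. w) (\<lambda>_. e)"
    and ne: "\<And>c. c \<in> C \<Longrightarrow> d c \<noteq> e"
  shows "hom PAlg s a p b q = {0}"
proof (cases "even (a + b)")
  case False
  then show ?thesis by (simp only: hom_def if_False)
next
  case True
  then obtain n where n: "a + b = 2 * n" by (elim evenE)
  have S: "p \<in> Sp PAlg a s" "q \<in> Sp PAlg b s" using p q by (auto simp: spanned_by_def)
  have z: "0 \<in> Sp PAlg n s" by (rule pa.subspace_0[OF subspace_Sp_PAlg])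
  then have "0 \<in> hom PAlg s a p b q" unfolding hom_PAlg[OF n S] by (simp add: bent_def)
  moreover have "f = 0" if f: "f \<in> hom PAlg s a p b q" for f
  proof -
    obtain r where "\<And>x y. length x = a \<Longrightarrow> length y = b \<Longrightarrow> bent n (mat f) x y = (\<Sum>c\<in>C. r c * (g c x * cnj (w y)))"
      "\<And>c. c \<in> C \<Longrightarrow> r c \<noteq> 0 \<Longrightarrow> d c = e" using hom_spanned[OF p q n f] by blast
    then have "bent n (mat f) x y = 0" if "length x = a" "length y = b" for x y
      using ne that by (metis (mono_tags, lifting) mult_zero_left sum.neutral)
    then show ?thesis using f[unfolded hom_PAlg[OF n S]] by (intro bent_inject[OF _ z n]) (auto simp: bent_def)
  qed
  ultimately show ?thesis by blast
qed

lemma hom_generator: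
  assumes p: "spanned_by a s p C g d" and q: "spanned_by b s q {()} (\<lambda>_. w) (\<lambda>_. e)"
    and c0: "c0 \<in> C" "d c0 = e" and n: "a + b = 2 * n"
  obtains f where "f \<in> hom PAlg s a p b q" "f \<in> Sp PAlg n s"
    "\<And>x y. length x = a \<Longrightarrow> length y = b \<Longrightarrow> bent n (mat f) x y = g c0 x * cnj (w y)"
proof -
  have S: "p \<in> Sp PAlg a s" "q \<in> Sp PAlg b s" using p q by (auto simp: spanned_by_def)
  obtain f where f: "f \<in> Sp PAlg n s"
    "\<And>x y. length x = a \<Longrightarrow> length y = b \<Longrightarrow> bent n (mat f) x y = g c0 x * cnj (w y)"
    by (rule bent_surjective[OF n, of "\<lambda>x y. g c0 x * cnj (w y)" s])
      (use p q c0 in \<open>auto simp: spanned_by_def\<close>)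
  have "g c0 x * cnj (w y) = (\<Sum>x'\<in>colourings a. mat p x x' * (\<Sum>y'\<in>colourings b. bent n (mat f) x' y' * mat
      q y' y))"
    if l: "length x = a" "length y = b" for x y
  proof -
    have w1: "(\<Sum>y'\<in>colourings b. cnj (w y') * w y') = 1" using q by (simp add: spanned_by_def)
    have "(\<Sum>y'\<in>colourings b. bent n (mat f) x' y' * mat q y' y) = g c0 x' * cnj (w y)" if "length x' = a" for x'
    proof -
      have "(\<Sum>y'\<in>colourings b. bent n (mat f) x' y' * mat q y' y)
          = (\<Sum>y'\<in>colourings b. g c0 x' * cnj (w y) * (cnj (w y') * w y'))"
        using f(2) q that l by (intro sum.cong) (auto simp: spanned_by_def)
      then show ?thesis by (simp add: sum_distrib_left[symmetric] w1)
    qed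
    then have "(\<Sum>x'\<in>colourings a. mat p x x' * (\<Sum>y'\<in>colourings b. bent n (mat f) x' y' * mat q y' y))
       = (\<Sum>x'\<in>colourings a. \<Sum>c\<in>C. g c x * cnj (w y) * (cnj (g c x') * g c0 x'))"
      using p l by (intro sum.cong) (auto simp: spanned_by_def sum_distrib_right sum_distrib_left mult_ac)
    also have "\<dots> = (\<Sum>c\<in>C. g c x * cnj (w y) * (\<Sum>x'\<in>colourings a. cnj (g c x') * g c0 x'))"
      by (subst sum.swap) (simp add: sum_distrib_left)
    also have "\<dots> = (\<Sum>c\<in>C. if c = c0 then g c x * cnj (w y) else 0)"
      using p c0 by (intro sum.cong) (auto simp: spanned_by_def)
    also have "\<dots> = g c0 x * cnj (w y)" using p c0 by (simp add: spanned_by_def)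
    finally show ?thesis by simp
  qed
  note E = this
  have "f \<in> hom PAlg s a p b q" unfolding hom_PAlg[OF n S]
  proof (intro conjI allI impI f(1))
    fix x y :: "bool list" assume l: "length x = a" "length y = b"
    show "bent n (mat f) x y = (\<Sum>x'\<in>colourings a. mat p x x' * (\<Sum>y'\<in>colourings b. bent n (mat f) x' y' *
        mat q y' y))"
      unfolding f(2)[OF l] by (rule E[OF l])
  qed
  then show ?thesis using that f by blast
qed

lemma hom_dim_1:
  assumes p: "spanned_by a s p C g d" and q: "spanned_by b s q {()} (\<lambda>_. w) (\<lambda>_. e)"
    and c0: "c0 \<in> C" "d c0 = e" and uniq: "\<And>c. c \<in> C \<Longrightarrow> d c = e \<Longrightarrow> c = c0"
  shows "edim PAlg (hom PAlg s a p b q) = 1"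
proof -
  have "even (a + b)" using spanned_by_parity[OF p c0(1)] spanned_by_parity[OF q] c0(2) by simp
  then obtain n where n: "a + b = 2 * n" by (elim evenE)
  have S: "p \<in> Sp PAlg a s" "q \<in> Sp PAlg b s" using p q by (auto simp: spanned_by_def)
  obtain f0 where f0: "f0 \<in> hom PAlg s a p b q" "f0 \<in> Sp PAlg n s"
    "\<And>x y. length x = a \<Longrightarrow> length y = b \<Longrightarrow> bent n (mat f0) x y = g c0 x * cnj (w y)"
    using hom_generator[OF p q c0 n] by blast
  show ?thesis
  proof (rule edim_1[OF f0(1)])
    obtain x where x: "length x = a" "g c0 x \<noteq> 0" using spanned_by_nonzero[OF p c0(1)] by blast
    obtain y where y: "length y = b" "w y \<noteq> 0" using spanned_by_nonzero[OF q, of "()"] by blast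
    show "f0 \<noteq> 0" using f0(3)[OF x(1) y(1)] x y by (auto simp: bent_def)
    fix f assume f: "f \<in> hom PAlg s a p b q"
    obtain r where r: "\<And>x y. length x = a \<Longrightarrow> length y = b \<Longrightarrow> bent n (mat f) x y
        = (\<Sum>c\<in>C. r c * (g c x * cnj (w y)))"
      "\<And>c. c \<in> C \<Longrightarrow> r c \<noteq> 0 \<Longrightarrow> d c = e" using hom_spanned[OF p q n f] by blast
    have "f = scale_PA (r c0) f0"
    proof (rule bent_inject[OF _ _ n])
      show "f \<in> Sp PAlg n s" using f unfolding hom_PAlg[OF n S] by blast
      show "scale_PA (r c0) f0 \<in> Sp PAlg n s" by (rule pa.subspace_scale[OF subspace_Sp_PAlg f0(2)])
      fix x y :: "bool list" assume l: "length x = a" "length y = b"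
      have "(\<Sum>c\<in>C. r c * (g c x * cnj (w y))) = (\<Sum>c\<in>C. if c = c0 then r c * (g c x * cnj (w y)) else 0)"
      proof (intro sum.cong refl)
        fix c assume "c \<in> C"
        then have "r c = 0 \<or> c = c0" using r(2) uniq by blast
        then show "r c * (g c x * cnj (w y)) = (if c = c0 then r c * (g c x * cnj (w y)) else 0)" by auto
      qed
      also have "\<dots> = r c0 * (g c0 x * cnj (w y))" using p c0 by (simp add: spanned_by_def)
      finally have "bent n (mat f) x y = r c0 * (g c0 x * cnj (w y))" using r(1)[OF l] by simp
      then show "bent n (mat f) x y = bent n (mat (scale_PA (r c0) f0)) x y"
        using f0(3)[OF l] by (simp add: bent_def mat_scale)
    qed
    then show "\<exists>c. f = scale_PA c f0" ..
  qed
qed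

abbreviation rank_one :: "nat \<Rightarrow> shade \<Rightarrow> PA \<Rightarrow> (bool list \<Rightarrow> complex) \<Rightarrow> int \<Rightarrow> bool" where
  "rank_one k s p w e \<equiv> spanned_by k s p {()} (\<lambda>_. w) (\<lambda>_. e)"

lemma projection_iff:
  "is_projection PAlg star_PA s k p \<longleftrightarrow> p \<in> Sp PAlg k s \<and>
    (\<forall>x y. length x = k \<longrightarrow> length y = k \<longrightarrow> (\<Sum>z\<in>colourings k. mat p x z * mat p z y) = mat p x y \<and> cnj (mat p
        y x) = mat p x y)"
proof (cases "p \<in> Sp PAlg k s")
  case True
  have "mult PAlg k s p p = p \<longleftrightarrow> (\<forall>x y. length x = k \<longrightarrow> length y
      = k \<longrightarrow> (\<Sum>z\<in>colourings k. mat p x z * mat p z y) = mat p x y)"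
    using mat_inject[OF mult_PAlg(1)[OF True True] True] mult_PAlg(2)[OF True True] by metis
  moreover have "star_PA p = p \<longleftrightarrow> (\<forall>x y. length x = k \<longrightarrow> length y = k \<longrightarrow> cnj (mat p y x) = mat p x y)"
    using mat_inject[OF star_PA_Sp(1)[OF True] True] star_PA_Sp(2)[OF True] by metis
  ultimately show ?thesis using True by (auto simp: is_projection_def)
qed (simp add: is_projection_def)

lemma rank_one_mat: "rank_one k s p w e \<Longrightarrow> length x = k \<Longrightarrow> length y = k \<Longrightarrow> mat p x y = w x * cnj (w y)"
  and rank_one_norm: "rank_one k s p w e \<Longrightarrow> (\<Sum>x\<in>colourings k. cnj (w x) * w x) = 1"
  and rank_one_Sp: "rank_one k s p w e \<Longrightarrow> p \<in> Sp PAlg k s"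
  by (auto simp: spanned_by_def)

lemma rank_one_minimal:
  assumes "rank_one k s p w e"
  shows "is_minimal PAlg star_PA s k p"
proof -
  have "(\<Sum>z\<in>colourings k. mat p x z * mat p z y) = mat p x y" if l: "length x = k" "length y = k" for x y
  proof -
    have "(\<Sum>z\<in>colourings k. mat p x z * mat p z y) = (\<Sum>z\<in>colourings k. w x * cnj (w y) * (cnj (w z) * w z))"
      using l by (intro sum.cong) (auto simp: rank_one_mat[OF assms])
    then show ?thesis using l by (simp add: sum_distrib_left[symmetric] rank_one_norm[OF assms]
        rank_one_mat[OF assms])
  qed
  then have "is_projection PAlg star_PA s k p" unfolding projection_iff
    using rank_one_Sp[OF assms] by (auto simp: rank_one_mat[OF assms])
  moreover have "edim PAlg (hom PAlg s k p k p) = 1" by (rule hom_dim_1[OF assms assms]) auto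
  ultimately show ?thesis by (simp add: is_minimal_def)
qed

lemma bent_same: "length x = k \<Longrightarrow> length y = k \<Longrightarrow> bent k M x y = M x y"
  by (simp add: bent_def)

text \<open>Compress the matrix unit at a nonzero diagonal entry of the projection: minimality makes the
  projection a multiple of the result, which has rank one.\<close>

lemma minimal_rank_one:
  assumes "is_minimal PAlg star_PA s k p"
  obtains w e where "rank_one k s p w e"
proof -
  have pS: "p \<in> Sp PAlg k s"
    and idem: "\<And>x y. length x = k \<Longrightarrow> length y = k \<Longrightarrow> (\<Sum>z\<in>colourings k. mat p x z * mat p z y) = mat p x y"
    and herm: "\<And>x y. length x = k \<Longrightarrow> length y = k \<Longrightarrow> cnj (mat p y x) = mat p x y"
    and dim: "edim PAlg (hom PAlg s k p k p) = 1"
    using assms by (auto simp: is_minimal_def projection_iff)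
  have kk: "k + k = 2 * k" by simp
  have "p \<noteq> 0"
  proof
    assume "p = 0"
    then have "f = 0" if "f \<in> hom PAlg s k p k p" for f
      using that unfolding hom_PAlg[OF kk pS pS] by (intro mat_inject[of f k s 0])
          (auto simp: bent_same pa.subspace_0[OF subspace_Sp_PAlg])
    moreover have "0 \<in> hom PAlg s k p k p"
      unfolding hom_PAlg[OF kk pS pS] by (simp add: bent_def pa.subspace_0[OF subspace_Sp_PAlg])
    ultimately have "hom PAlg s k p k p = {0}" by blast
    then show False using dim edim_0 by simp
  qed
  then obtain a b where ab: "length a = k" "length b = k" "mat p a b \<noteq> 0"
    using mat_inject[OF pS pa.subspace_0[OF subspace_Sp_PAlg]] by auto
  have diag: "mat p b b = of_real (\<Sum>z\<in>colourings k. (cmod (mat p z b))\<^sup>2)"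
  proof -
    have "mat p b b = (\<Sum>z\<in>colourings k. mat p b z * mat p z b)" by (rule idem[OF ab(2,2), symmetric])
    also have "\<dots> = (\<Sum>z\<in>colourings k. of_real ((cmod (mat p z b))\<^sup>2))"
    proof (intro sum.cong refl)
      fix z assume "z \<in> colourings k"
      then have "mat p b z = cnj (mat p z b)" using herm[OF ab(2), of z] by simp
      then show "mat p b z * mat p z b = of_real ((cmod (mat p z b))\<^sup>2)"
        by (simp only: complex_norm_square mult.commute)
    qed
    finally show ?thesis by simp
  qed
  define r where "r = (\<Sum>z\<in>colourings k. (cmod (mat p z b))\<^sup>2)"
  have "0 < (cmod (mat p a b))\<^sup>2" using ab by simp
  also have "\<dots> \<le> r" unfolding r_def using ab by (intro member_le_sum) auto
  finally have r: "0 < r" .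
  have pbb: "mat p b b = of_real r" using diag by (simp add: r_def)
  \<comment> \<open>\<open>n\<close> is \<open>p\<close> times the matrix unit at \<open>(b, b)\<close> times \<open>p\<close>\<close>
  obtain n where n: "n \<in> Sp PAlg k s" "\<And>x y. length x = k \<Longrightarrow> length y = k \<Longrightarrow> mat n x y = mat p x b * mat p b y"
    by (rule mat_surjective[of k "\<lambda>x y. mat p x b * mat p b y" s])
      (use mat_support(3)[OF pS] in auto)
  have "n \<in> hom PAlg s k p k p" unfolding hom_PAlg[OF kk pS pS]
  proof (intro conjI allI impI n(1))
    fix x y :: "bool list" assume l: "length x = k" "length y = k"
    have "(\<Sum>y'\<in>colourings k. bent k (mat n) x' y' * mat p y' y) = mat p x' b * mat p b y"
        if "length x' = k" for x'
    proof -
      have "(\<Sum>y'\<in>colourings k. bent k (mat n) x' y' * mat p y' y)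
          = (\<Sum>y'\<in>colourings k. mat p x' b * (mat p b y' * mat p y' y))"
        using n(2) that by (intro sum.cong) (auto simp: bent_same)
      then show ?thesis using idem ab(2) l by (simp add: sum_distrib_left[symmetric])
    qed
    then have "(\<Sum>x'\<in>colourings k. mat p x x' * (\<Sum>y'\<in>colourings k. bent k (mat n) x' y' * mat p y' y))
       = (\<Sum>x'\<in>colourings k. (mat p x x' * mat p x' b) * mat p b y)"
      by (intro sum.cong) auto
    also have "\<dots> = mat p x b * mat p b y" using idem ab(2) l by (simp add: sum_distrib_right[symmetric])
    finally show "bent k (mat n) x y = (\<Sum>x'\<in>colourings k. mat p x x' * (\<Sum>y'\<in>colourings k. bent k (mat n)
        x' y' * mat p y' y))"
      using n(2) l by (simp add: bent_same)
  qed
  moreover have "p \<in> hom PAlg s k p k p" unfolding hom_PAlg[OF kk pS pS]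
    using pS idem by (simp add: bent_same)
  moreover have "n \<noteq> 0" using n(2)[OF ab(2,2)] pbb r by auto
  ultimately obtain c where c: "p = scale_PA c n"
    using edim_1_multiple[OF dim] by blast
  have M: "mat p x y = mat p x b * mat p b y / of_real r" if l: "length x = k" "length y = k" for x y
  proof -
    have "mat p x y = c * (mat p x b * mat p b y)" if "length x = k" "length y = k" for x y
      using that n(2) by (subst c) (simp add: mat_scale)
    from this[OF ab(2,2)] have "c * of_real r = 1" using pbb r by simp
    then have "c = 1 / of_real r" using r by (simp add: field_simps)
    then show ?thesis using \<open>\<And>x y. _ \<Longrightarrow> _ \<Longrightarrow> mat p x y = c * _\<close> l by simp
  qed
  let ?w = "\<lambda>x. mat p x b / of_real (sqrt r)"
  have "rank_one k s p ?w (degree b)" unfolding spanned_by_def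
  proof (intro conjI allI impI ballI pS)
    have rr: "of_real (sqrt r) * of_real (sqrt r) = (of_real r :: complex)" using r by
        (simp add: of_real_mult[symmetric] del: of_real_mult)
    fix x y :: "bool list" assume l: "length x = k" "length y = k"
    show "mat p x y = (\<Sum>c\<in>{()}. ?w x * cnj (?w y))"
      using M[OF l] herm[OF ab(2) l(2)] by (simp add: rr)
  next
    fix c c' :: unit
    have "(\<Sum>x\<in>colourings k. cnj (?w x) * ?w x) = (\<Sum>x\<in>colourings k. of_real ((cmod (mat p x b))\<^sup>2 / r))"
    proof (intro sum.cong refl)
      fix x
      have "cnj (?w x) * ?w x = of_real ((cmod (?w x))\<^sup>2)" by (simp only: complex_norm_square mult.commute)
      also have "(cmod (?w x))\<^sup>2 = (cmod (mat p x b))\<^sup>2 / r" using r by (simp add: norm_divide power_divide)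
      finally show "cnj (?w x) * ?w x = of_real ((cmod (mat p x b))\<^sup>2 / r)" .
    qed
    also have "\<dots> = of_real ((\<Sum>x\<in>colourings k. (cmod (mat p x b))\<^sup>2) / r)"
      by (simp only: of_real_sum sum_divide_distrib)
    also have "\<dots> = 1" using r by (simp add: r_def[symmetric])
    finally show "(\<Sum>x\<in>colourings k. cnj (?w x) * ?w x) = of_bool (c = c')" by simp
  next
    fix x :: "bool list" assume "length x = k" "?w x \<noteq> 0"
    then show "degree x = degree b" using mat_support(3)[OF pS, of x b] by auto
  qed simp
  then show ?thesis using that by blast
qed

text \<open>Between lines of the same degree the rank one operator of two unit vectors is a partial isometry;
  between lines of different degrees there is no morphism but zero.\<close>

lemma iso_rank_one:
  assumes p: "rank_one a s p u d" and q: "rank_one b s q w e"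
  shows "iso_proj PAlg star_PA s (a, p) (b, q) \<longleftrightarrow> d = e"
proof
  assume "iso_proj PAlg star_PA s (a, p) (b, q)"
  then obtain f where f: "even (a + b)" "f \<in> hom PAlg s a p b q" "hcomp PAlg s a b (star_PA f) f = p"
    by (auto simp: iso_proj_def)
  obtain n where n: "a + b = 2 * n" using f(1) by (elim evenE)
  show "d = e"
  proof (rule ccontr)
    assume "d \<noteq> e"
    then have "f = 0" using hom_dim_0[OF p q] f(2) by auto
    have z: "0 \<in> Sp PAlg n s" by (rule pa.subspace_0[OF subspace_Sp_PAlg])
    obtain x where x: "length x = a" "u x \<noteq> 0" using spanned_by_nonzero[OF p, of "()"] by blast
    have "mat p x x = 0"
      using hcomp_PAlg(2)[OF n z star_PA_Sp(1)[OF z] x(1,1)] f(3) \<open>f = 0\<close> by (simp add: bent_def)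
    then show False using rank_one_mat[OF p x(1,1)] x by simp
  qed
next
  assume de: "d = e"
  have ev: "even (a + b)" using spanned_by_parity[OF p] spanned_by_parity[OF q] de by simp
  then obtain n where n: "a + b = 2 * n" by (elim evenE)
  then have n': "b + a = 2 * n" by simp
  obtain f where f: "f \<in> hom PAlg s a p b q" "f \<in> Sp PAlg n s"
    "\<And>x y. length x = a \<Longrightarrow> length y = b \<Longrightarrow> bent n (mat f) x y = u x * cnj (w y)"
    using hom_generator[OF p q _ de n] by blast
  note fs = star_PA_Sp(1)[OF f(2)]
  have bs: "bent n (mat (star_PA f)) y x = cnj (u x) * w y" if "length x = a" "length y = b" for x y
    using f(3)[OF that] bent_star[OF f(2)] by simp
  have "hcomp PAlg s a b (star_PA f) f = p"
  proof (rule mat_inject[OF hcomp_PAlg(1)[OF n f(2) fs] rank_one_Sp[OF p]])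
    fix x z :: "bool list" assume l: "length x = a" "length z = a"
    have "mat (hcomp PAlg s a b (star_PA f) f) x z = (\<Sum>y\<in>colourings b. u x * cnj (u z) * (cnj (w y) * w y))"
      unfolding hcomp_PAlg(2)[OF n f(2) fs l] using f(3) bs l by (intro sum.cong) auto
    then show "mat (hcomp PAlg s a b (star_PA f) f) x z = mat p x z"
      by (simp add: sum_distrib_left[symmetric] rank_one_norm[OF q] rank_one_mat[OF p l])
  qed
  moreover have "hcomp PAlg s b a f (star_PA f) = q"
  proof (rule mat_inject[OF hcomp_PAlg(1)[OF n' fs f(2)] rank_one_Sp[OF q]])
    fix y z :: "bool list" assume l: "length y = b" "length z = b"
    have "mat (hcomp PAlg s b a f (star_PA f)) y z = (\<Sum>x\<in>colourings a. w y * cnj (w z) * (cnj (u x) * u x))"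
      unfolding hcomp_PAlg(2)[OF n' fs f(2) l] using f(3) bs l by (intro sum.cong) auto
    then show "mat (hcomp PAlg s b a f (star_PA f)) y z = mat q y z"
      by (simp add: sum_distrib_left[symmetric] rank_one_norm[OF p] rank_one_mat[OF q l])
  qed
  ultimately show "iso_proj PAlg star_PA s (a, p) (b, q)" using ev f(1) by (auto simp: iso_proj_def)
qed


section \<open>The principal graphs\<close>

lemma tensor_PAlg:
  assumes "f \<in> Sp PAlg k s" "g \<in> Sp PAlg l (shade_at s k)"
  shows "tensor PAlg k s l f g \<in> Sp PAlg (k + l) s"
    "length x = k \<Longrightarrow> length x' = l \<Longrightarrow> length y = k \<Longrightarrow> length y' = l \<Longrightarrow>
      mat (tensor PAlg k s l f g) (x @ x') (y @ y') = mat f x y * mat g x' y'"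
proof -
  let ?T = "[(0, Box k 0), (k, Box l 1)] :: nat diagram" and ?I = "\<lambda>l. mat ([f, g] ! l)"
  have T: "tangle (k + l) ?T" "fits PAlg s ?T ((!) [f, g])"
    using assms by (simp_all add: tangle_def fits_def)
  show "tensor PAlg k s l f g \<in> Sp PAlg (k + l) s" unfolding tensor_def by (rule Act_PAlg_closed[OF T])
  assume l: "length x = k" "length x' = l" "length y = k" "length y' = l"
  have "ev ?I [(k, Box l 1)] (t @ x') (y @ y') = of_bool (t = y) * mat g x' y'" if "length t = k" for t
  proof -
    have "ev ?I [(k, Box l 1)] (t @ x' @ []) (y @ y') = (\<Sum>t'\<in>colourings l. of_bool (t' = y') * (of_bool (t
        = y) * mat g x' t'))"
      by (subst ev_Box) (use that l in \<open>auto intro!: sum.cong\<close>)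
    then show ?thesis using l by (simp add: sum_colourings_delta)
  qed
  then have "ev ?I ?T ([] @ x @ x') (y @ y') = (\<Sum>t\<in>colourings k. of_bool (t = y) * (mat f x t * mat g x' y'))"
    by (subst ev_Box) (use l in \<open>auto intro!: sum.cong simp del: sum_of_bool_mult_eq sum_mult_of_bool_eq
        sum_of_bool_eq\<close>)
  moreover have "mat (Act PAlg (k + l) s ?T ((!) [f, g])) (x @ x') (y @ y') = ev ?I ?T (x @ x') (y @ y')"
    by (rule mat_Act[OF T]) (use l in auto)
  ultimately show "mat (tensor PAlg k s l f g) (x @ x') (y @ y') = mat f x y * mat g x' y'"
    unfolding tensor_def using l by (simp add: sum_colourings_delta)
qed

definition charge :: "bool \<Rightarrow> int" where
  "charge c = (if c then 1 else - 1)"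

text \<open>Adding a strand of either colour moves the degree by one, in the two opposite directions.\<close>

lemma tensor_strand:
  assumes "rank_one k s p w e"
  shows "spanned_by (k + 1) s (tensor PAlg k s 1 p (vert PAlg 1 (shade_at s k))) UNIV
    (\<lambda>c x. of_bool (drop k x = [c]) * w (take k x)) (\<lambda>c. e + (- 1) ^ k * charge c)"
proof -
  let ?t = "tensor PAlg k s 1 p (vert PAlg 1 (shade_at s k))"
  have S: "p \<in> Sp PAlg k s" "vert PAlg 1 (shade_at s k) \<in> Sp PAlg 1 (shade_at s k)"
    using rank_one_Sp[OF assms] vert_PAlg(1) by auto
  have split: "\<exists>z c. x = z @ [c] \<and> length z = k" if "length x = k + 1" for x :: "bool list"
    using that by (cases x rule: rev_cases) auto
  have sums: "(\<Sum>x\<in>colourings (k + 1). f x) = (\<Sum>z\<in>colourings k. \<Sum>c\<in>UNIV. f (z @ [c]))"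
      for f :: "bool list \<Rightarrow> complex"
    unfolding sum_colourings_add by (simp add: sum_colourings_Suc)
  show ?thesis unfolding spanned_by_def
  proof (intro conjI allI impI ballI tensor_PAlg(1)[OF S])
    fix x y :: "bool list" assume l: "length x = k + 1" "length y = k + 1"
    obtain z c z' c' where xy: "x = z @ [c]" "length z = k" "y = z' @ [c']" "length z' = k" using split l
        by metis
    have "mat ?t x y = w z * cnj (w z') * of_bool (c = c')"
    proof -
      have "mat ?t (z @ [c]) (z' @ [c']) = mat p z z' * mat (vert PAlg 1 (shade_at s k)) [c] [c']"
        by (rule tensor_PAlg(2)[OF S]) (use xy in auto)
      then show ?thesis unfolding xy(1,3) using xy(2,4) by (simp add: rank_one_mat[OF assms] vert_PAlg(2))
    qed
    also have "\<dots> = (\<Sum>d\<in>UNIV. of_bool (drop k x = [d]) * w (take k x) * cnj (of_bool (drop k y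
        = [d]) * w (take k y)))"
      using xy by (cases c; cases c') (simp_all add: UNIV_bool)
    finally show "mat ?t x y = \<dots>" .
  next
    fix c c' :: bool
    have "(\<Sum>x\<in>colourings (k + 1). cnj (of_bool (drop k x = [c]) * w (take k x)) * (of_bool (drop k x
        = [c']) * w (take k x)))
       = (\<Sum>z\<in>colourings k. of_bool (c = c') * (cnj (w z) * w z))"
      unfolding sums by (intro sum.cong) (cases c; cases c'; auto simp: UNIV_bool)+
    then show "(\<Sum>x\<in>colourings (k + 1). cnj (of_bool (drop k x = [c]) * w (take k x)) * (of_bool (drop k x
        = [c']) * w (take k x)))
       = of_bool (c = c')"
      by (simp add: sum_distrib_left[symmetric] rank_one_norm[OF assms] del: sum_of_bool_mult_eq
          sum_mult_of_bool_eq)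
  next
    fix c and x :: "bool list" assume x: "length x = k + 1" "of_bool (drop k x = [c]) * w (take k x) \<noteq> 0"
    then obtain z where z: "x = z @ [c]" "length z = k" using split[OF x(1)] by auto
    then have "degree z = e" using x assms by (auto simp: spanned_by_def)
    then show "degree x = e + (- 1) ^ k * charge c" using z by (simp add: degree_append charge_def)
  qed simp
qed

lemma path_edges:
  assumes p: "rank_one a s p u m" and q: "rank_one b s q w n"
  shows "edim PAlg (hom PAlg s (a + 1) (tensor PAlg a s 1 p (vert PAlg 1 (shade_at s a))) b q)
    = (if \<bar>m - n\<bar> = 1 then 1 else 0)"
proof -
  note t = tensor_strand[OF p]
  have pm: "(- 1) ^ a = (1 :: int) \<or> (- 1) ^ a = (- 1 :: int)" by (cases "even a") auto
  show ?thesis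
  proof (cases "\<bar>m - n\<bar> = 1")
    case True
    then have "\<exists>c. m + (- 1) ^ a * charge c = n"
      using pm unfolding charge_def by (auto simp: ex_bool_eq)
    then obtain c where c: "m + (- 1) ^ a * charge c = n" by blast
    have "edim PAlg (hom PAlg s (a + 1) (tensor PAlg a s 1 p (vert PAlg 1 (shade_at s a))) b q) = 1"
    proof (rule hom_dim_1[OF t q _ c])
      fix c' assume "m + (- 1) ^ a * charge c' = n"
      then show "c' = c" using c pm by (auto simp: charge_def split: if_splits)
    qed simp
    then show ?thesis using True by simp
  next
    case False
    have "hom PAlg s (a + 1) (tensor PAlg a s 1 p (vert PAlg 1 (shade_at s a))) b q = {0}"
      by (rule hom_dim_0[OF t q]) (use False pm in \<open>auto simp: charge_def split: if_splits\<close>)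
    then show ?thesis using False edim_0 by simp
  qed
qed

text \<open>The degree of the line onto which a minimal projection projects is a complete invariant, so one
  projection for each integer suffices.\<close>

lemma two_sided_path:
  assumes v: "\<And>n. \<exists>k p w. v n = (k, p) \<and> rank_one k s p w n"
  shows "is_two_sided_path PAlg star_PA s v"
proof -
  let ?V = "minimal_projections PAlg star_PA s" and ?C = "iso_class PAlg star_PA s"
  define has_degree where "has_degree x n \<longleftrightarrow> (\<exists>w. rank_one (fst x) s (snd x) w n)" for x n
  have vd: "has_degree (v n) n" for n using v[of n] by (auto simp: has_degree_def)
  have V: "x \<in> ?V \<longleftrightarrow> (\<exists>n. has_degree x n)" for x
    unfolding minimal_projections_def has_degree_def
    using rank_one_minimal minimal_rank_one by (cases x) (auto, metis)
  have iso: "iso_proj PAlg star_PA s x y \<longleftrightarrow> m = n" if "has_degree x m" "has_degree y n" for x y m n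
    using that iso_rank_one unfolding has_degree_def by (metis prod.collapse)
  have C: "?C x = {y. has_degree y n}" if x: "has_degree x n" for x n
  proof -
    have "y \<in> ?C x \<longleftrightarrow> has_degree y n" for y
    proof
      assume "y \<in> ?C x"
      then obtain m where "has_degree y m" "iso_proj PAlg star_PA s x y" using V by (auto simp: iso_class_def)
      then show "has_degree y n" using iso[OF x] by metis
    next
      assume "has_degree y n"
      then show "y \<in> ?C x" using iso[OF x] V by (auto simp: iso_class_def)
    qed
    then show ?thesis by blast
  qed
  have "bij_betw (\<lambda>n. ?C (v n)) UNIV (graph_vertices PAlg star_PA s)"
    unfolding bij_betw_def
  proof
    show "inj (\<lambda>n. ?C (v n))"
    proof (rule injI)
      fix m n assume "?C (v m) = ?C (v n)"
      then have "has_degree (v n) m" using C[OF vd[of m]] C[OF vd[of n]] vd[of n] by blast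
      then show "m = n" using iso[of "v n" m "v n" n] iso[of "v n" m "v n" m] vd[of n] by blast
    qed
    have "?C x \<in> range (\<lambda>n. ?C (v n))" if x: "x \<in> ?V" for x
    proof -
      obtain n where n: "has_degree x n" using V x by blast
      have "?C x = ?C (v n)" unfolding C[OF n] C[OF vd] ..
      then show ?thesis by blast
    qed
    moreover have "v n \<in> ?V" for n using V vd by blast
    ultimately show "range (\<lambda>n. ?C (v n)) = graph_vertices PAlg star_PA s"
      unfolding graph_vertices_def by blast
  qed
  moreover have "graph_edges PAlg s (?C (v m)) (?C (v n)) = (if \<bar>m - n\<bar> = 1 then 1 else 0)" for m n
  proof -
    let ?e = "\<lambda>(a, p) (b, q). edim PAlg (hom PAlg s (a
        + 1) (tensor PAlg a s 1 p (vert PAlg 1 (shade_at s a))) b q)"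
    have e: "?e x y = (if \<bar>m - n\<bar> = 1 then 1 else 0)" if "has_degree x m" "has_degree y n" for x y
      using that path_edges unfolding has_degree_def by (cases x; cases y) auto
    show ?thesis unfolding graph_edges_def C[OF vd]
    proof (rule the_equality)
      show "\<forall>(a, p)\<in>{y. has_degree y m}. \<forall>(b, q)\<in>{y. has_degree y n}.
         edim PAlg (hom PAlg s (a + 1) (tensor PAlg a s 1 p (vert PAlg 1 (shade_at s a))) b q) = (if \<bar>m -
             n\<bar> = 1 then 1 else 0)"
        using e by force
      fix d assume "\<forall>(a, p)\<in>{y. has_degree y m}. \<forall>(b, q)\<in>{y. has_degree y n}.
         edim PAlg (hom PAlg s (a + 1) (tensor PAlg a s 1 p (vert PAlg 1 (shade_at s a))) b q) = d"
      then have "?e (v m) (v n) = d" using vd[of m] vd[of n] by (cases "v m"; cases "v n") auto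
      then show "d = (if \<bar>m - n\<bar> = 1 then 1 else 0)" using e[OF vd vd] by simp
    qed
  qed
  ultimately show ?thesis using V vd unfolding is_two_sided_path_def by blast
qed

text \<open>Tensor products of matrix units concatenate the colourings.\<close>

lemma alt_PAlg:
  assumes "x \<in> Sp PAlg 1 s" "\<And>a b. mat x a b = of_bool (a = [c] \<and> b = [c])"
    and "y \<in> Sp PAlg 1 (opp s)" "\<And>a b. mat y a b = of_bool (a = [\<not> c] \<and> b = [\<not> c])"
  shows "alt s x y k \<in> Sp PAlg k s \<and> (\<forall>a b. length a = k \<longrightarrow> length b = k \<longrightarrow>
    mat (alt s x y k) a b = of_bool (a = alternating c k \<and> b = alternating c k))"
  using assms
proof (induction k arbitrary: s x y c)
  case 0
  then show ?case by (simp add: vert_PAlg)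
next
  case (Suc k)
  have IH: "alt (opp s) y x k \<in> Sp PAlg k (opp s)" "\<And>a b. length a = k \<Longrightarrow> length b = k \<Longrightarrow>
    mat (alt (opp s) y x k) a b = of_bool (a = alternating (\<not> c) k \<and> b = alternating (\<not> c) k)"
    using Suc.IH[of y "opp s" "\<not> c" x] Suc.prems by auto
  have S: "alt (opp s) y x k \<in> Sp PAlg k (shade_at s 1)" using IH(1) by (simp add: shade_at_def)
  have "mat (tensor PAlg 1 s k x (alt (opp s) y x k)) a b = of_bool (a = alternating c (Suc k) \<and> b
      = alternating c (Suc k))"
    if l: "length a = Suc k" "length b = Suc k" for a b
  proof -
    obtain a0 a1 b0 b1 where ab: "a = [a0] @ a1" "length a1 = k" "b = [b0] @ b1" "length b1 = k"
      using l by (auto simp: length_Suc_conv)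
    have "mat (tensor PAlg 1 s k x (alt (opp s) y x k)) ([a0] @ a1) ([b0] @ b1)
        = mat x [a0] [b0] * mat (alt (opp s) y x k) a1 b1"
      by (rule tensor_PAlg(2)[OF Suc.prems(1) S]) (use ab in auto)
    then show ?thesis unfolding ab(1,3) using ab by (auto simp: Suc.prems(2) IH(2))
  qed
  then show ?case using tensor_PAlg(1)[OF Suc.prems(1) S] by simp
qed

lemma matrix_unit_rank_one:
  assumes "p \<in> Sp PAlg k s" "\<And>a b. length a = k \<Longrightarrow> length b = k \<Longrightarrow> mat p a b = of_bool (a = x \<and> b = x)"
      "length x = k"
  shows "rank_one k s p (\<lambda>a. of_bool (a = x)) (degree x)"
proof -
  have "(\<Sum>a\<in>colourings k. cnj (of_bool (a = x)) * of_bool (a = x)) = (\<Sum>a\<in>colourings k. of_bool (a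
      = x) * (1 :: complex))"
    by (intro sum.cong) auto
  then show ?thesis using assms sum_colourings_delta(2)[OF assms(3), of "\<lambda>_. 1"]
    by (auto simp: spanned_by_def simp del: sum_of_bool_eq sum_of_bool_mult_eq sum_mult_of_bool_eq)
qed

lemma alternating_rank_one:
  assumes "x \<in> Sp PAlg 1 s" "\<And>a b. mat x a b = of_bool (a = [c] \<and> b = [c])"
    and "y \<in> Sp PAlg 1 (opp s)" "\<And>a b. mat y a b = of_bool (a = [\<not> c] \<and> b = [\<not> c])"
  shows "rank_one k s (alt s x y k) (\<lambda>a. of_bool (a = alternating c k)) (if c then int k else - int k)"
  using matrix_unit_rank_one[of "alt s x y k" k s "alternating c k"] alt_PAlg[OF assms] by
      (simp add: degree_alternating)

lemma colour_PAlg: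
  "abs_PA (free_colour c) \<in> Sp PAlg 1 Unshaded"
  "mat (abs_PA (free_colour c)) a b = of_bool (a = [c] \<and> b = [c])"
  unfolding Sp_PAlg mat_abs by (rule imageI[OF free_colour_in_Sp], rule evF_free_colour)

lemma rot_PAlg:
  assumes "x \<in> Sp PAlg 1 Unshaded" "\<And>a b. mat x a b = of_bool (a = [c] \<and> b = [c])"
  shows "rot PAlg 1 Unshaded x \<in> Sp PAlg 1 Shaded"
      "mat (rot PAlg 1 Unshaded x) a b = of_bool (a = [c] \<and> b = [c])"
proof -
  let ?T = "cups 0 1 @ [(1, Box 1 0)] @ caps 1 1"
  have T: "tangle 1 ?T" "fits PAlg Shaded ?T ((!) [x])"
    using assms(1) by (simp_all add: tangle_def fits_def cups_Suc caps_Suc shade_at_def)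
  have r: "rot PAlg 1 Unshaded x = Act PAlg 1 Shaded ?T ((!) [x])" by (simp add: rot_def shade_at_def)
  show S: "rot PAlg 1 Unshaded x \<in> Sp PAlg 1 Shaded" unfolding r by (rule Act_PAlg_closed[OF T])
  show "mat (rot PAlg 1 Unshaded x) a b = of_bool (a = [c] \<and> b = [c])"
  proof (cases "length a = 1 \<and> length b = 1")
    case True
    then obtain a0 b0 where "a = [a0]" "b = [b0]" by (auto simp: length_1_iff)
    moreover have "mat (rot PAlg 1 Unshaded x) a b = ev (\<lambda>l. mat ([x] ! l)) ?T a b"
      unfolding r by (rule mat_Act[OF T]) (use True in auto)
    ultimately show ?thesis
      by (cases a0; cases b0; cases c) (simp_all add: cups_Suc caps_Suc ev_compute assms(2))
  next
    case False
    then show ?thesis using mat_support[OF S, of a b] by force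
  qed
qed

lemma P1_eq: "P1 = abs_PA (free_colour True)"
  by (simp add: P1_def freeP_eq)

lemma Q1_eq: "Q1 = abs_PA (free_colour False)"
proof -
  have S: "abs_PA (vert FA 1 Unshaded) \<in> Sp PAlg 1 Unshaded"
    unfolding Sp_PAlg vert_FA by (intro imageI single_in_Sp_FA) (simp add: fitting_iff)
  have "vert PAlg 1 Unshaded = abs_PA (vert FA 1 Unshaded)"
    by (rule mat_inject[OF vert_PAlg(1) S])
      (simp add: vert_PAlg(2) vert_FA mat_abs evF_single ev_class_ltangle)
  then show ?thesis unfolding Q1_def P1_def freeQ_eq[symmetric] freeQ_def by (simp add: abs_PA_diff)
qed

lemma star_colour: "star_PA (abs_PA (free_colour c)) = abs_PA (free_colour c)"
  by (rule mat_inject[of _ 1 Unshaded]) (auto simp: star_PA_Sp colour_PAlg[unfolded One_nat_def]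
      star_PA_Sp[OF colour_PAlg(1)[unfolded One_nat_def]])

theorem mainTheorem16:
  shows "(\<forall>k s. \<forall>f \<in> Sp FA k s. star_PA (abs_PA f) = abs_PA (free_star f)) \<and>
    star_PA P1 = P1 \<and> star_PA Q1 = Q1 \<and>
    subfactor_planar_algebra PAlg star_PA \<and>
    is_two_sided_path PAlg star_PA Unshaded (two_sided P_seq Q_seq) \<and>
    is_two_sided_path PAlg star_PA Shaded (two_sided P_seq' Q_seq')"
proof (intro conjI allI ballI)
  show "star_PA (abs_PA f) = abs_PA (free_star f)" for f by (rule star_PA_abs)
  show "star_PA P1 = P1" "star_PA Q1 = Q1" unfolding P1_eq Q1_eq by (rule star_colour)+
  show "subfactor_planar_algebra PAlg star_PA" by (rule subfactor_PAlg)
  note P = colour_PAlg[of True, folded P1_eq, simplified]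
      and Q = colour_PAlg[of False, folded Q1_eq, simplified]
  note P' = rot_PAlg[OF colour_PAlg[of True], folded P1_eq, simplified]
      and Q' = rot_PAlg[OF colour_PAlg[of False], folded Q1_eq, simplified]
  have "\<exists>w. rank_one k Unshaded (P_seq k) w (int k)" "\<exists>w. rank_one k Unshaded (Q_seq k) w (- int k)" for k
    unfolding P_seq_def Q_seq_def
    using alternating_rank_one[of P1 Unshaded True "rot PAlg 1 Unshaded Q1" k] alternating_rank_one[of Q1
        Unshaded False "rot PAlg 1 Unshaded P1" k] P Q P' Q'
    by auto
  then show "is_two_sided_path PAlg star_PA Unshaded (two_sided P_seq Q_seq)"
    by (intro two_sided_path) (auto simp: two_sided_def, metis nat_0_le, metis nat_0_le minus_minus
        neg_0_le_iff_le linear)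
  have "\<exists>w. rank_one k Shaded (P_seq' k) w (int k)" "\<exists>w. rank_one k Shaded (Q_seq' k) w (- int k)" for k
    unfolding P_seq'_def Q_seq'_def
    using alternating_rank_one[of "rot PAlg 1 Unshaded P1" Shaded True Q1 k] alternating_rank_one[of
        "rot PAlg 1 Unshaded Q1" Shaded False P1 k] P Q P' Q'
    by auto
  then show "is_two_sided_path PAlg star_PA Shaded (two_sided P_seq' Q_seq')"
    by (intro two_sided_path) (auto simp: two_sided_def, metis nat_0_le, metis nat_0_le minus_minus
        neg_0_le_iff_le linear)
qed

end
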